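(* Let $D$ be an integral domain. The following are equivalent. (a) $D$ is a TAF-domain. (b) $D$ has finite character and $D_M$ is a TAF-domain for each maximal ideal $M$ of $D$. (c) $D$ has finite character and $D_M$ is an atomic PVD for each maximal ideal $M$ of $D$. (d) $D$ has finite character and $D_M$ is a PVD satisfying ACCP for each maximal ideal $M$ of $D$. (e) $D$ is a one-dimensional domain which has finite character and every proper principal ideal of $D$ has a TA-factorization. (f) $D$ is a one-dimensional domain satisfying ACCP which has finite character and every principal ideal of $D$ generated by an atom has a TA-factorization.
   Context: All rings are commutative with identity; "local" means having a unique maximal ideal (not necessarily Noetherian). An ideal $I$ of a ring $R$ is a 2-absorbing ideal (TA-ideal) if whenever $a,b,c\in R$ and $abc\in I$, then $ab\in I$ or $ac\in I$ or $bc\in I$. A TA-factorization of an ideal $I$ is an expression $I=J_1\cdots J_n$ as a product of proper TA-ideals. A TAF-domain is an integral domain in which every proper ideal has a TA-factorization. A domain $D$ has finite character if every $x\in D\setminus\{0\}$ belongs to only finitely many maximal ideals of $D$. $D_M$ denotes the localization of $D$ at $M$. A local domain $(D,M)$ with quotient field $K$ is a pseudo-valuation domain (PVD) if it is a field or if $(M:M)=\{x\in K\mid xM\subseteq M\}$ is a valuation domain with maximal ideal $M$. An atom is a nonzero nonunit that is not a product of two nonunits; a domain is atomic if every nonzero nonunit is a finite product of atoms. A domain satisfies ACCP if every ascending chain of principal ideals stabilizes.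
   Formalization: In (e) and (f), "one-dimensional" is read as "a field or of Krull dimension one", because a field satisfies (a)–(d) but has dimension zero, so the literal equivalence fails for fields; for domains that are not fields the statement is unchanged. *)

theory Defs
  imports "HOL-Library.Extended_Nat" "HOL-Algebra.Algebra"
begin

section \<open>Two-absorbing ideals and TA-factorizations\<close>

definition ta_ideal :: "'a set \<Rightarrow> ('a, 'm) ring_scheme \<Rightarrow> bool" where
  "ta_ideal I R \<longleftrightarrow> ideal I R \<and>
     (\<forall>a\<in>carrier R. \<forall>b\<in>carrier R. \<forall>c\<in>carrier R.
        a \<otimes>\<^bsub>R\<^esub> b \<otimes>\<^bsub>R\<^esub> c \<in> I \<longrightarrow>
        a \<otimes>\<^bsub>R\<^esub> b \<in> I \<or> a \<otimes>\<^bsub>R\<^esub> c \<in> I \<or> b \<otimes>\<^bsub>R\<^esub> c \<in> I)"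

text \<open>The unit ideal \<^term>\<open>carrier R\<close> is the neutral element of the product of ideals,
  so the fold below is just the product of the (at least one) ideals in the list.\<close>

definition has_ta_factorization :: "('a, 'm) ring_scheme \<Rightarrow> 'a set \<Rightarrow> bool" where
  "has_ta_factorization R I \<longleftrightarrow>
     (\<exists>Js. Js \<noteq> [] \<and> (\<forall>J\<in>set Js. ta_ideal J R \<and> J \<noteq> carrier R) \<and>
           I = foldr (ideal_prod R) Js (carrier R))"

definition taf_domain :: "('a, 'm) ring_scheme \<Rightarrow> bool" where
  "taf_domain R \<longleftrightarrow> domain R \<and>
     (\<forall>I. ideal I R \<and> I \<noteq> carrier R \<longrightarrow> has_ta_factorization R I)"


section \<open>Finiteness conditions and dimension\<close>

definition finite_character :: "('a, 'm) ring_scheme \<Rightarrow> bool" where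
  "finite_character R \<longleftrightarrow>
     (\<forall>x \<in> carrier R - {\<zero>\<^bsub>R\<^esub>}. finite {M. maximalideal M R \<and> x \<in> M})"

definition accp :: "('a, 'm) ring_scheme \<Rightarrow> bool" where
  "accp R \<longleftrightarrow>
     (\<forall>I :: nat \<Rightarrow> 'a set. (\<forall>n. principalideal (I n) R) \<and> (\<forall>n. I n \<subseteq> I (Suc n)) \<longrightarrow>
        (\<exists>N. \<forall>n\<ge>N. I n = I N))"

definition atom :: "('a, 'm) ring_scheme \<Rightarrow> 'a \<Rightarrow> bool" where
  "atom R p \<longleftrightarrow> p \<in> carrier R \<and> ring_irreducible\<^bsub>R\<^esub> p"

lemma (in domain) atom_iff:
  "atom R p \<longleftrightarrow> p \<in> carrier R \<and> p \<noteq> \<zero> \<and> p \<notin> Units R \<and>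
     \<not> (\<exists>a \<in> carrier R - Units R. \<exists>b \<in> carrier R - Units R. p = a \<otimes> b)"
proof
  assume "atom R p"
  then show "p \<in> carrier R \<and> p \<noteq> \<zero> \<and> p \<notin> Units R \<and>
     \<not> (\<exists>a \<in> carrier R - Units R. \<exists>b \<in> carrier R - Units R. p = a \<otimes> b)"
    unfolding atom_def using ring_irreducibleE[of p] by blast
next
  assume "p \<in> carrier R \<and> p \<noteq> \<zero> \<and> p \<notin> Units R \<and>
     \<not> (\<exists>a \<in> carrier R - Units R. \<exists>b \<in> carrier R - Units R. p = a \<otimes> b)"
  then show "atom R p"
    unfolding atom_def by (intro conjI ring_irreducibleI) auto
qed

definition atomic :: "('a, 'm) ring_scheme \<Rightarrow> bool" where
  "atomic R \<longleftrightarrow>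
     (\<forall>x \<in> carrier R - {\<zero>\<^bsub>R\<^esub>}. x \<notin> Units R \<longrightarrow>
        (\<exists>ps. (\<forall>p\<in>set ps. atom R p) \<and> x = foldr (\<otimes>\<^bsub>R\<^esub>) ps \<one>\<^bsub>R\<^esub>))"

text \<open>The supremum of the lengths \<open>n\<close> of the chains \<open>P 0 \<subset> P 1 \<subset> \<dots> \<subset> P n\<close> of prime ideals.\<close>

definition krull_dim :: "('a, 'm) ring_scheme \<Rightarrow> enat" where
  "krull_dim R =
     (SUP n \<in> {n :: nat. \<exists>P. (\<forall>i\<le>n. primeideal (P i) R) \<and> (\<forall>i<n. P i \<subset> P (Suc i))}. enat n)"


section \<open>Localizations and the quotient field\<close>

definition loc_rel :: "('a, 'm) ring_scheme \<Rightarrow> 'a set \<Rightarrow> (('a \<times> 'a) \<times> ('a \<times> 'a)) set" where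
  "loc_rel R S = {((a, s), (b, t)).
     a \<in> carrier R \<and> b \<in> carrier R \<and> s \<in> S \<and> t \<in> S \<and>
     (\<exists>u\<in>S. u \<otimes>\<^bsub>R\<^esub> (a \<otimes>\<^bsub>R\<^esub> t) = u \<otimes>\<^bsub>R\<^esub> (b \<otimes>\<^bsub>R\<^esub> s))}"

text \<open>The fraction \<open>a / s\<close> as an equivalence class of pairs.\<close>

definition fraction :: "('a, 'm) ring_scheme \<Rightarrow> 'a set \<Rightarrow> 'a \<Rightarrow> 'a \<Rightarrow> ('a \<times> 'a) set" where
  "fraction R S a s = loc_rel R S `` {(a, s)}"

text \<open>Sum and product of two classes are taken as the union, over all pairs of representatives,
  of the resulting class; as the operations respect \<^const>\<open>loc_rel\<close>, this is a single class.\<close>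

definition localization :: "('a, 'm) ring_scheme \<Rightarrow> 'a set \<Rightarrow> ('a \<times> 'a) set ring" where
  "localization R S =
     \<lparr> carrier = (carrier R \<times> S) // loc_rel R S,
       monoid.mult = (\<lambda>A B. \<Union>{fraction R S (a \<otimes>\<^bsub>R\<^esub> b) (s \<otimes>\<^bsub>R\<^esub> t) | a s b t.
                             (a, s) \<in> A \<and> (b, t) \<in> B}),
       one = fraction R S \<one>\<^bsub>R\<^esub> \<one>\<^bsub>R\<^esub>,
       ring.zero = fraction R S \<zero>\<^bsub>R\<^esub> \<one>\<^bsub>R\<^esub>,
       ring.add = (\<lambda>A B. \<Union>{fraction R S (a \<otimes>\<^bsub>R\<^esub> t \<oplus>\<^bsub>R\<^esub> b \<otimes>\<^bsub>R\<^esub> s) (s \<otimes>\<^bsub>R\<^esub> t) | a s b t.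
                          (a, s) \<in> A \<and> (b, t) \<in> B}) \<rparr>"

definition localization_at :: "('a, 'm) ring_scheme \<Rightarrow> 'a set \<Rightarrow> ('a \<times> 'a) set ring" where
  "localization_at R P = localization R (carrier R - P)"

definition quotient_field :: "('a, 'm) ring_scheme \<Rightarrow> ('a \<times> 'a) set ring" where
  "quotient_field R = localization R (carrier R - {\<zero>\<^bsub>R\<^esub>})"

definition to_quotient_field :: "('a, 'm) ring_scheme \<Rightarrow> 'a \<Rightarrow> ('a \<times> 'a) set" where
  "to_quotient_field R a = fraction R (carrier R - {\<zero>\<^bsub>R\<^esub>}) a \<one>\<^bsub>R\<^esub>"


section \<open>Pseudo-valuation domains\<close>

text \<open>Applied to the numerator and denominator of \<open>x\<close>, the divisibility condition says that \<open>x\<close> or its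
  inverse lies in \<open>V\<close>, for every nonzero \<open>x\<close> in the quotient field of \<open>V\<close>.\<close>

definition valuation_domain :: "('a, 'm) ring_scheme \<Rightarrow> bool" where
  "valuation_domain V \<longleftrightarrow> domain V \<and>
     (\<forall>a\<in>carrier V. \<forall>b\<in>carrier V. a divides\<^bsub>V\<^esub> b \<or> b divides\<^bsub>V\<^esub> a)"

text \<open>The overring \<open>(I : I)\<close> of \<open>R\<close>, as a subring of the quotient field.\<close>

definition colon_ring :: "('a, 'm) ring_scheme \<Rightarrow> 'a set \<Rightarrow> ('a \<times> 'a) set ring" where
  "colon_ring R I = (quotient_field R)
     \<lparr> carrier := {x \<in> carrier (quotient_field R).
         \<forall>m\<in>I. x \<otimes>\<^bsub>quotient_field R\<^esub> to_quotient_field R m \<in> to_quotient_field R ` I} \<rparr>"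

definition pvd :: "('a, 'm) ring_scheme \<Rightarrow> bool" where
  "pvd R \<longleftrightarrow> domain R \<and>
     (\<exists>M. {N. maximalideal N R} = {M} \<and>
        (field R \<or>
         valuation_domain (colon_ring R M) \<and>
         maximalideal (to_quotient_field R ` M) (colon_ring R M)))"

end

theory Submission
  imports Defs
begin

text \<open>Locally, the conditions (TAF, atomic PVD, PVD with ACCP) on \<open>E = D\<^sub>M\<close> all amount to: \<open>E\<close> is
  atomic and every atom divides every product of two nonunits. An exchange argument then shows that
  the number of atoms in a factorization is an additive function \<open>v\<close> with \<open>a | b\<close> whenever
  \<open>v a < v b\<close>. If \<open>n\<close> is the least value of \<open>v\<close> on an ideal \<open>I\<close> and \<open>p\<close> is an atom, this gives
  \<open>I = (p)\<^sup>n\<^sup>-\<^sup>1 J\<close>, where \<open>(p)\<close> and \<open>J\<close> contain the square of the maximal ideal and hence are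
  TA-ideals. Conversely, the factors of a TA-factorization of a principal ideal of \<open>E\<close> are invertible,
  hence principal, and in dimension one each of them contains the square of the maximal ideal.

  Globally, finite character allows one to contract the local factors at the finitely many maximal
  ideals containing \<open>I\<close> and to multiply them to a TA-factorization of \<open>I\<close>. That a TAF-domain is at
  most one-dimensional is seen on a localization in which a nonzero prime lies strictly below the
  maximal ideal \<open>M\<close>: for suitable \<open>z\<close> and \<open>t\<close>, the factors of the ideals \<open>(z, t\<^sup>n)\<close> contain
  \<open>t\<^sup>2\<close>, while their number is bounded unless \<open>z\<close> lies in every power of \<open>M\<close>. Finite character
  holds because a TA-ideal has at most two minimal primes.\<close>

section \<open>Ideals of commutative rings\<close>

text \<open>The local core is a description of TA-ideals by the maximal ideal \<open>M\<close>: an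
  ideal containing \<open>M^2\<close> is 2-absorbing, and a 2-absorbing ideal with radical
  \<open>M\<close> contains \<open>M^2\<close>. The length \<open>v\<close> is not the valuation of
  a discrete valuation ring: elements of equal length need not divide each other. They become
  associates only in \<open>(M:M)\<close>, which is how the PVD condition enters, and this is why
  divisibility is tied to a strict inequality and why the exponent is \<open>n - 1\<close>.

  In the bound on the dimension, nothing excludes \<open>M = M^2\<close> or a nonzero intersection
  of the powers of \<open>M\<close>. If \<open>M\<close> differs from \<open>M^2\<close>, any
  \<open>t\<close> outside \<open>M^2\<close> generates an ideal with radical \<open>M\<close>, and
  \<open>z\<close> generates a factor, inside the smaller prime, of a principal ideal. If
  \<open>M = M^2\<close>, the argument rests on having localized at a prime minimal over the smaller
  prime and one further element.

  Globally, (b), (c) and (d) all amount to finite character with local length functions; the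
  equivalences close as a cycle through (a), (e) and this condition, with (f) attached to
  (e).\<close>

context cring
begin

lemma ideal_criterion:
  assumes "I \<subseteq> carrier R" "\<zero> \<in> I"
    and add: "\<And>x y. \<lbrakk>x \<in> I; y \<in> I\<rbrakk> \<Longrightarrow> x \<oplus> y \<in> I"
    and mult: "\<And>x r. \<lbrakk>x \<in> I; r \<in> carrier R\<rbrakk> \<Longrightarrow> r \<otimes> x \<in> I"
  shows "ideal I R"
proof (rule idealI[OF ring_axioms])
  have "\<ominus> x \<in> I" if "x \<in> I" for x
    using mult[OF that, of "\<ominus> \<one>"] that assms(1) by (simp add: l_minus subset_iff)
  then show "subgroup I (add_monoid R)"
    using assms by (auto intro!: add.subgroupI simp: a_inv_def[symmetric])
  show "r \<otimes> x \<in> I" if "x \<in> I" "r \<in> carrier R" for x r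
    using mult that by simp
  show "x \<otimes> r \<in> I" if "x \<in> I" "r \<in> carrier R" for x r
    using mult[OF that] that assms(1) by (simp add: m_comm subset_iff)
qed

lemma ideal_add: "\<lbrakk>ideal I R; x \<in> I; y \<in> I\<rbrakk> \<Longrightarrow> x \<oplus> y \<in> I"
  by (simp add: additive_subgroup.a_closed ideal.axioms(1))

lemma ideal_zero: "ideal I R \<Longrightarrow> \<zero> \<in> I"
  by (simp add: additive_subgroup.zero_closed ideal.axioms(1))

lemma ideal_minus: "\<lbrakk>ideal I R; x \<in> I; y \<in> I\<rbrakk> \<Longrightarrow> x \<ominus> y \<in> I"
  by (simp add: a_minus_def additive_subgroup.a_closed additive_subgroup.a_inv_closed ideal.axioms(1))

lemma ideal_subset: "ideal I R \<Longrightarrow> I \<subseteq> carrier R"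
  by (rule subsetI) (rule ideal.Icarr)

lemma ideal_add_cancel:
  assumes "ideal I R" "x \<oplus> y \<in> I" "y \<in> I" "x \<in> carrier R"
  shows "x \<in> I"
proof -
  have "x = (x \<oplus> y) \<ominus> y"
    using assms ideal.Icarr[OF assms(1)] by (simp add: a_minus_def a_assoc r_neg)
  then show ?thesis
    using ideal_minus[OF assms(1-3)] by simp
qed

lemma ideal_proper_iff: "ideal I R \<Longrightarrow> I \<noteq> carrier R \<longleftrightarrow> \<one> \<notin> I"
  using ideal.one_imp_carrier by auto

lemma ideal_unit: "\<lbrakk>ideal I R; u \<in> I; u \<in> Units R\<rbrakk> \<Longrightarrow> I = carrier R"
  by (metis Units_inv_closed Units_l_inv ideal.I_l_closed ideal.one_imp_carrier)

lemma PIdl_iff: "x \<in> PIdl a \<longleftrightarrow> (\<exists>y\<in>carrier R. x = y \<otimes> a)"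
  unfolding cgenideal_def by auto

lemma principalideal_iff: "principalideal I R \<longleftrightarrow> (\<exists>a\<in>carrier R. I = PIdl a)"
  by (metis cgenideal_eq_genideal cgenideal_is_principalideal principalideal.generate)

lemma PIdl_eq_carrier_iff: "a \<in> carrier R \<Longrightarrow> PIdl a = carrier R \<longleftrightarrow> a \<in> Units R"
proof
  assume a: "a \<in> carrier R" "PIdl a = carrier R"
  then obtain y where "y \<in> carrier R" "\<one> = y \<otimes> a"
    using PIdl_iff[of \<one> a] by auto
  with a show "a \<in> Units R"
    by (metis m_comm Units_def[THEN eq_refl, THEN subsetD] Units_r_inv_ex unit_factor Units_one_closed)
next
  assume "a \<in> carrier R" "a \<in> Units R"
  then show "PIdl a = carrier R"
    using ideal_unit cgenideal_ideal cgenideal_self by blast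
qed

lemma ideal_sum_iff: "x \<in> I <+>\<^bsub>R\<^esub> J \<longleftrightarrow> (\<exists>a\<in>I. \<exists>b\<in>J. x = a \<oplus> b)"
  by (auto simp: set_add_def')

lemma sum_ideals_contain:
  assumes "ideal I R" "ideal J R"
  shows "I \<subseteq> I <+>\<^bsub>R\<^esub> J" "J \<subseteq> I <+>\<^bsub>R\<^esub> J"
proof -
  show "I \<subseteq> I <+>\<^bsub>R\<^esub> J"
  proof
    fix x assume "x \<in> I"
    then have "x = x \<oplus> \<zero>" "\<zero> \<in> J" using assms ideal_zero ideal.Icarr by fastforce+
    with \<open>x \<in> I\<close> show "x \<in> I <+>\<^bsub>R\<^esub> J" unfolding ideal_sum_iff by blast
  qed
  show "J \<subseteq> I <+>\<^bsub>R\<^esub> J"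
  proof
    fix x assume "x \<in> J"
    then have "x = \<zero> \<oplus> x" "\<zero> \<in> I" using assms ideal_zero ideal.Icarr by fastforce+
    with \<open>x \<in> J\<close> show "x \<in> I <+>\<^bsub>R\<^esub> J" unfolding ideal_sum_iff by blast
  qed
qed

lemma sum_ideals_least:
  assumes "ideal K R" "I \<subseteq> K" "J \<subseteq> K"
  shows "I <+>\<^bsub>R\<^esub> J \<subseteq> K"
proof
  fix x assume "x \<in> I <+>\<^bsub>R\<^esub> J"
  then obtain a b where "a \<in> I" "b \<in> J" "x = a \<oplus> b" unfolding ideal_sum_iff by blast
  then show "x \<in> K" using ideal_add[OF assms(1), of a b] assms(2,3) by (simp add: subset_iff)
qed

lemma mem_sum_PIdl_iff:
  "x \<in> I <+>\<^bsub>R\<^esub> PIdl t \<longleftrightarrow> (\<exists>p\<in>I. \<exists>y\<in>carrier R. x = p \<oplus> y \<otimes> t)"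
  unfolding ideal_sum_iff cgenideal_def by auto

section \<open>Existence of maximal ideals and of minimal primes\<close>

lemma exists_maximalideal:
  assumes I: "ideal I R" "I \<noteq> carrier R"
  obtains M where "maximalideal M R" "I \<subseteq> M"
proof -
  \<comment> \<open>Properness is phrased as \<open>\<one> \<notin> J\<close> because this form
    passes to unions of chains.\<close>
  let ?A = "{J. ideal J R \<and> I \<subseteq> J \<and> \<one> \<notin> J}"
  have "\<exists>M\<in>?A. \<forall>B\<in>?A. M \<subseteq> B \<longrightarrow> B = M"
  proof (rule subset_Zorn_nonempty)
    show "?A \<noteq> {}"
      using I ideal_proper_iff by auto
    fix C assume C: "C \<noteq> {}" "subset.chain ?A C"
    then have "C \<subseteq> ?A"
      by (simp add: subset.chain_def)
    moreover have "subset.chain {I. ideal I R} C"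
      using C(2) unfolding subset.chain_def by blast
    then have "ideal (\<Union>C) R"
      using chain_Union_is_ideal[of C] C(1) by simp
    ultimately show "\<Union>C \<in> ?A"
      using C(1) by blast
  qed
  then obtain M where M: "M \<in> ?A" and max: "\<forall>B\<in>?A. M \<subseteq> B \<longrightarrow> B = M" ..
  have "maximalideal M R"
  proof (rule maximalidealI)
    show "ideal M R" "carrier R \<noteq> M" using M by auto
    fix J assume J: "ideal J R" "M \<subseteq> J" "J \<subseteq> carrier R"
    show "J = M \<or> J = carrier R"
    proof (cases "\<one> \<in> J")
      case True
      then show ?thesis using ideal.one_imp_carrier[OF J(1)] by simp
    next
      case False
      then have "J \<in> ?A" using J M by auto
      then show ?thesis using max J by simp
    qed
  qed
  with M that show ?thesis by auto
qed

lemma maximal_eq_if_subset: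
  assumes "maximalideal M R" "ideal N R" "M \<subseteq> N" "N \<noteq> carrier R"
  shows "N = M"
  using maximalideal.I_maximal[OF assms(1-3)] assms(2,4) ideal_subset by blast

text \<open>Invertibility of \<open>s\<close> modulo \<open>M\<close>: the sum of
  \<open>PIdl s\<close> and \<open>M\<close> is strictly larger than \<open>M\<close>, hence the
  whole ring.\<close>

lemma maximalideal_inverse:
  assumes M: "maximalideal M R" and s: "s \<in> carrier R" "s \<notin> M"
  obtains r m where "r \<in> carrier R" "m \<in> M" "r \<otimes> s \<oplus> m = \<one>"
proof -
  have iM: "ideal M R"
    using M by (simp add: maximalideal.axioms(1))
  have "ideal (PIdl s <+>\<^bsub>R\<^esub> M) R"
    using s iM add_ideals cgenideal_ideal by blast
  moreover have "s \<in> PIdl s <+>\<^bsub>R\<^esub> M" "M \<subseteq> PIdl s <+>\<^bsub>R\<^esub> M"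
    using sum_ideals_contain[OF cgenideal_ideal[OF s(1)] iM] cgenideal_self[OF s(1)] by auto
  ultimately have "PIdl s <+>\<^bsub>R\<^esub> M = carrier R"
    using maximal_eq_if_subset[OF M] s by metis
  then have "\<one> \<in> PIdl s <+>\<^bsub>R\<^esub> M"
    by simp
  then obtain a b where "a \<in> PIdl s" "b \<in> M" "\<one> = a \<oplus> b"
    unfolding ideal_sum_iff by blast
  then show ?thesis
    using that unfolding PIdl_iff by metis
qed

lemma one_notin_prime: "primeideal P R \<Longrightarrow> \<one> \<notin> P"
  using ideal_proper_iff primeideal.axioms(1) primeideal.I_notcarr by metis

lemma prime_pow:
  assumes "primeideal P R" "x \<in> carrier R" "x [^] (n::nat) \<in> P"
  shows "x \<in> P"
  using assms(3)
proof (induction n)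
  case 0
  then show ?case
    using primeideal.I_notcarr[OF assms(1)] ideal.one_imp_carrier primeideal.axioms(1)[OF assms(1)]
    by fastforce
next
  case (Suc n)
  then show ?case
    using primeideal.I_prime[OF assms(1), of "x [^] n" x] assms(2) by auto
qed

lemma ideal_pow_ge:
  assumes "ideal I R" "x \<in> carrier R" "x [^] (n::nat) \<in> I" "n \<le> m"
  shows "x [^] m \<in> I"
proof -
  have "x [^] m = x [^] n \<otimes> x [^] (m - n)"
    using assms by (simp add: nat_pow_mult)
  then show ?thesis
    using assms by (simp add: ideal.I_r_closed)
qed

text \<open>A replacement for the binomial expansion. One factor \<open>x \<oplus> y\<close> is
  split off, and its summands are absorbed into the multiplier \<open>u\<close>, which lowers
  \<open>k\<close> or \<open>l\<close> by one; this is why \<open>u\<close> is part of the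
  statement.\<close>

lemma pow_add_mem:
  assumes I: "ideal I R" and x: "x \<in> carrier R" "y \<in> carrier R"
    and "u \<in> carrier R" "u \<otimes> x [^] (k::nat) \<in> I" "u \<otimes> y [^] (l::nat) \<in> I"
  shows "u \<otimes> (x \<oplus> y) [^] (k + l) \<in> I"
  using assms(4-6)
proof (induction "k + l" arbitrary: u k l)
  case 0
  then show ?case by simp
next
  case (Suc n)
  show ?case
  proof (cases "k = 0 \<or> l = 0")
    case True
    with Suc.prems have "u \<in> I" by auto
    then show ?thesis
      using I x by (simp add: ideal.I_r_closed)
  next
    case False
    then obtain k' l' where k': "k = Suc k'" "l = Suc l'"
      by (metis not0_implies_Suc)
    note carr = x Suc.prems(1)
    have "(u \<otimes> x) \<otimes> x [^] k' = u \<otimes> x [^] k" "(u \<otimes> y) \<otimes> y [^] l' = u \<otimes> y [^] l"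
      using carr k' nat_pow_Suc2 by (simp_all add: m_assoc)
    then have "(u \<otimes> x) \<otimes> x [^] k' \<in> I" "(u \<otimes> y) \<otimes> y [^] l' \<in> I"
      using Suc.prems(2,3) by auto
    moreover have "(u \<otimes> x) \<otimes> y [^] l = x \<otimes> (u \<otimes> y [^] l)" "(u \<otimes> y) \<otimes> x [^] k = y \<otimes> (u \<otimes> x [^] k)"
      using carr by (simp_all add: m_ac)
    then have "(u \<otimes> x) \<otimes> y [^] l \<in> I" "(u \<otimes> y) \<otimes> x [^] k \<in> I"
      using Suc.prems(2,3) x I by (auto simp: ideal.I_l_closed)
    ultimately have "(u \<otimes> x) \<otimes> (x \<oplus> y) [^] (k' + l) \<in> I" "(u \<otimes> y) \<otimes> (x \<oplus> y) [^] (k + l') \<in> I"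
      using Suc.hyps(1)[of k' l "u \<otimes> x"] Suc.hyps(1)[of k l' "u \<otimes> y"] Suc.hyps(2) Suc.prems(1) x k'
      by auto
    moreover have "k' + l = n" "k + l' = n" "k + l = Suc n"
      using k' Suc.hyps(2) by auto
    ultimately have "(u \<otimes> x) \<otimes> (x \<oplus> y) [^] n \<oplus> (u \<otimes> y) \<otimes> (x \<oplus> y) [^] n \<in> I"
      using I ideal_add by auto
    moreover have "(u \<otimes> x) \<otimes> (x \<oplus> y) [^] n \<oplus> (u \<otimes> y) \<otimes> (x \<oplus> y) [^] n = u \<otimes> (x \<oplus> y) [^] Suc n"
      using carr by (simp add: m_assoc l_distr r_distr m_comm[of "(x \<oplus> y) [^] n"])
    ultimately show ?thesis
      using \<open>k + l = Suc n\<close> by simp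
  qed
qed

text \<open>The complement of a maximal multiplicative set avoiding \<open>I\<close> is a prime ideal minimal over
  \<open>I\<close>; the last conclusion says that it is the radical of \<open>I\<close> after localization.\<close>

lemma exists_minimal_prime:
  assumes I: "ideal I R" and S: "S \<subseteq> carrier R" "\<one> \<in> S" "S \<inter> I = {}"
    and S_mult: "\<And>x y. \<lbrakk>x \<in> S; y \<in> S\<rbrakk> \<Longrightarrow> x \<otimes> y \<in> S"
  obtains Q where "primeideal Q R" "I \<subseteq> Q" "Q \<inter> S = {}"
    "\<And>a. a \<in> Q \<Longrightarrow> \<exists>s\<in>carrier R - Q. \<exists>n::nat. s \<otimes> a [^] n \<in> I"
proof -
  let ?A = "{T. S \<subseteq> T \<and> T \<subseteq> carrier R \<and> T \<inter> I = {} \<and> (\<forall>x\<in>T. \<forall>y\<in>T. x \<otimes> y \<in> T)}"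
  have "\<exists>T\<in>?A. \<forall>B\<in>?A. T \<subseteq> B \<longrightarrow> B = T"
  proof (rule subset_Zorn_nonempty)
    have "S \<in> ?A" using S S_mult by simp
    then show "?A \<noteq> {}" by (rule ex_in_conv[THEN iffD1, OF exI])
    fix C assume C: "C \<noteq> {}" "subset.chain ?A C"
    have memA: "B \<in> ?A" if "B \<in> C" for B
      using C(2) that unfolding subset_chain_def by (meson subsetD)
    have "x \<otimes> y \<in> \<Union>C" if xy: "x \<in> \<Union>C" "y \<in> \<Union>C" for x y
    proof -
      obtain B B' where B: "B \<in> C" "B' \<in> C" "x \<in> B" "y \<in> B'" using xy by (elim UnionE)
      then have "B \<subseteq> B' \<or> B' \<subseteq> B"
        using C(2) by (simp add: subset_chain_def)
      then obtain B'' where "B'' \<in> C" "x \<in> B''" "y \<in> B''"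
        using B by (meson subsetD)
      then have "x \<otimes> y \<in> B''" using memA[of B''] by simp
      with \<open>B'' \<in> C\<close> show ?thesis by (rule UnionI)
    qed
    moreover have "S \<subseteq> \<Union>C" using C(1) memA by fastforce
    moreover have "\<Union>C \<subseteq> carrier R" "\<Union>C \<inter> I = {}" using memA by fastforce+
    ultimately show "\<Union>C \<in> ?A" by simp
  qed
  then obtain T where TA: "T \<in> ?A" and Tmax: "\<forall>B\<in>?A. T \<subseteq> B \<longrightarrow> B = T" ..
  then have T: "S \<subseteq> T" "T \<subseteq> carrier R" "T \<inter> I = {}" "\<And>x y. \<lbrakk>x \<in> T; y \<in> T\<rbrakk> \<Longrightarrow> x \<otimes> y \<in> T"
    by simp_all
  have oneT: "\<one> \<in> T" using S T by blast
  have pow: "a [^] (n::nat) \<in> T" if "a \<in> T" for a n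
    using that oneT T(4) by (induction n) auto
  \<comment> \<open>The multiplicative set generated by \<open>T\<close> and \<open>a\<close> is
    strictly larger than \<open>T\<close>, so by maximality it meets \<open>I\<close>. This one fact
    yields both that the complement of \<open>T\<close> is an ideal and the final
    conclusion.\<close>
  have out: "\<exists>t\<in>T. \<exists>n::nat. t \<otimes> a [^] n \<in> I" if a: "a \<in> carrier R" "a \<notin> T" for a
  proof (rule ccontr)
    assume neg: "\<not> ?thesis"
    define B where "B = {t \<otimes> a [^] n |t n. t \<in> T \<and> n \<in> (UNIV::nat set)}"
    have in_B: "t \<otimes> a [^] (n::nat) \<in> B" if "t \<in> T" for t n
      using that unfolding B_def by blast
    have TB: "T \<subseteq> B"
    proof
      fix t assume t: "t \<in> T"
      then have "t \<otimes> a [^] (0::nat) = t" using T(2) by auto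
      with in_B[OF t, of 0] show "t \<in> B" by simp
    qed
    have "x \<otimes> y \<in> B" if "x \<in> B" "y \<in> B" for x y
    proof -
      obtain t n t' m where *: "t \<in> T" "t' \<in> T" "x = t \<otimes> a [^] (n::nat)" "y = t' \<otimes> a [^] (m::nat)"
        using \<open>x \<in> B\<close> \<open>y \<in> B\<close> unfolding B_def by blast
      then have "x \<otimes> y = (t \<otimes> t') \<otimes> (a [^] n \<otimes> a [^] m)"
        using a T(2) by (simp add: m_ac subset_iff)
      then show ?thesis
        using in_B[of "t \<otimes> t'" "n + m"] a * T(4) by (simp add: nat_pow_mult)
    qed
    moreover have "B \<subseteq> carrier R" using a(1) T(2) unfolding B_def by (auto simp: subset_iff)
    moreover have "B \<inter> I = {}" using neg unfolding B_def by blast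
    moreover have "S \<subseteq> B" using T(1) TB by (rule subset_trans)
    ultimately have "B \<in> ?A" by simp
    with Tmax have "T \<subseteq> B \<longrightarrow> B = T" by (rule bspec)
    with TB have "B = T" by simp
    moreover have "a \<in> B" using in_B[OF oneT, of 1] a by simp
    ultimately show False using a by simp
  qed
  let ?Q = "carrier R - T"
  have idQ: "ideal ?Q R"
  proof (rule ideal_criterion)
    show "\<zero> \<in> ?Q" using ideal_zero[OF I] T(3) by auto
    fix x assume x: "x \<in> ?Q"
    then obtain t and n :: nat where t: "t \<in> T" "t \<otimes> x [^] n \<in> I" using out[of x] by auto
    {
      fix y assume y: "y \<in> ?Q"
      then obtain t' and m :: nat where t': "t' \<in> T" "t' \<otimes> y [^] m \<in> I" using out[of y] by auto
      have "t \<otimes> t' \<otimes> x [^] n \<in> I" "t \<otimes> t' \<otimes> y [^] m \<in> I"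
        using ideal.I_l_closed[OF I t(2), of t'] ideal.I_l_closed[OF I t'(2), of t] t t' T(2) x y
        by (auto simp: m_ac subset_iff)
      then have "t \<otimes> t' \<otimes> (x \<oplus> y) [^] (n + m) \<in> I"
        using pow_add_mem[OF I, of x y "t \<otimes> t'" n m] x y t t' T(2) by auto
      moreover have "t \<otimes> t' \<otimes> (x \<oplus> y) [^] (n + m) \<in> T" if "x \<oplus> y \<in> T"
        using that T(4) t t' pow by simp
      ultimately show "x \<oplus> y \<in> ?Q"
        using x y T(3) by auto
    }
    fix r assume r: "r \<in> carrier R"
    have "t \<otimes> (r \<otimes> x) [^] n = r [^] n \<otimes> (t \<otimes> x [^] n)"
      using r x t T(2) by (simp add: nat_pow_distrib m_ac subset_iff)
    then have "t \<otimes> (r \<otimes> x) [^] n \<in> I"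
      using t r I by (simp add: ideal.I_l_closed)
    moreover have "t \<otimes> (r \<otimes> x) [^] n \<in> T" if "r \<otimes> x \<in> T"
      using that T(4) t pow by simp
    ultimately show "r \<otimes> x \<in> ?Q"
      using x r T(3) by auto
  qed auto
  have "primeideal ?Q R"
    using idQ is_cring oneT T(4) by (intro primeidealI) auto
  moreover have "I \<subseteq> ?Q" "?Q \<inter> S = {}"
    using ideal_subset[OF I] T(1,3) by auto
  moreover have "\<exists>s\<in>carrier R - ?Q. \<exists>n::nat. s \<otimes> a [^] n \<in> I" if a: "a \<in> ?Q" for a
  proof -
    obtain t and n :: nat where "t \<in> T" "t \<otimes> a [^] n \<in> I" using out[of a] a by auto
    then show ?thesis using T(2) by (intro bexI[of _ t] exI[of _ n]) auto
  qed
  ultimately show ?thesis using that[of ?Q] by simp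
qed

lemma exists_minimal_prime_below:
  assumes I: "ideal I R" "I \<subseteq> M" and M: "primeideal M R"
  obtains Q where "primeideal Q R" "I \<subseteq> Q" "Q \<subseteq> M"
    "\<And>a. a \<in> Q \<Longrightarrow> \<exists>s\<in>carrier R - Q. \<exists>n::nat. s \<otimes> a [^] n \<in> I"
proof (rule exists_minimal_prime[of I "carrier R - M"])
  show "ideal I R" "(carrier R - M) \<inter> I = {}" "\<one> \<in> carrier R - M"
    using I one_notin_prime[OF M] by auto
  show "x \<otimes> y \<in> carrier R - M" if "x \<in> carrier R - M" "y \<in> carrier R - M" for x y
    using primeideal.I_prime[OF M, of x y] that by auto
  fix Q assume Q: "primeideal Q R" "I \<subseteq> Q" "Q \<inter> (carrier R - M) = {}"
    "\<And>a. a \<in> Q \<Longrightarrow> \<exists>s\<in>carrier R - Q. \<exists>n::nat. s \<otimes> a [^] n \<in> I"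
  have "Q \<subseteq> M"
    using Q(3) ideal_subset[OF primeideal.axioms(1)[OF Q(1)]] by auto
  with Q(1,2,4) show thesis by (intro that[of Q])
qed auto

end

section \<open>Products of ideals and two-absorbing ideals\<close>

context cring
begin

abbreviation iprod :: "'a set list \<Rightarrow> 'a set" where
  "iprod Js \<equiv> foldr (ideal_prod R) Js (carrier R)"

lemma iprod_ideal: "(\<And>J. J \<in> set Js \<Longrightarrow> ideal J R) \<Longrightarrow> ideal (iprod Js) R"
  by (induction Js) (auto simp: oneideal ideal_prod_is_ideal)

lemma ideal_prod_one_left: "ideal I R \<Longrightarrow> ideal_prod R (carrier R) I = I"
  using ideal_prod_commute[OF oneideal] ideal_prod_one by metis

lemma iprod_append:
  assumes "\<And>J. J \<in> set Js \<union> set Ks \<Longrightarrow> ideal J R"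
  shows "iprod (Js @ Ks) = ideal_prod R (iprod Js) (iprod Ks)"
  using assms
proof (induction Js)
  case Nil
  then show ?case using ideal_prod_one_left[OF iprod_ideal[of Ks]] by simp
next
  case (Cons J Js)
  then show ?case
    using ideal_prod_assoc[of J "iprod Js" "iprod Ks"] iprod_ideal[of Js] iprod_ideal[of Ks] by simp
qed

lemma ideal_prod_least:
  assumes "ideal K R" "\<And>i j. \<lbrakk>i \<in> I; j \<in> J\<rbrakk> \<Longrightarrow> i \<otimes> j \<in> K"
  shows "ideal_prod R I J \<subseteq> K"
proof
  fix x assume "x \<in> ideal_prod R I J"
  then show "x \<in> K"
    by induction (use assms ideal_add in auto)
qed

lemma ideal_prod_mono:
  assumes "I \<subseteq> I'" "J \<subseteq> J'"
  shows "ideal_prod R I J \<subseteq> ideal_prod R I' J'"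
proof
  fix x assume "x \<in> ideal_prod R I J"
  then show "x \<in> ideal_prod R I' J'"
    by induction (use assms ideal_prod.prod ideal_prod.sum in \<open>metis subsetD\<close>)+
qed

lemma iprod_subset:
  assumes "\<And>J. J \<in> set Js \<Longrightarrow> ideal J R" "J \<in> set Js"
  shows "iprod Js \<subseteq> J"
  using assms
proof (induction Js)
  case (Cons K Js)
  have K: "ideal K R" "ideal (iprod Js) R"
    using Cons.prems(1) iprod_ideal[of Js] by auto
  have "iprod (K # Js) \<subseteq> K \<inter> iprod Js"
    using ideal_prod_inter[OF K] by simp
  then show ?case
    using Cons by (cases "J = K") auto
qed simp

lemma prime_iprod:
  assumes "primeideal P R" "\<And>J. J \<in> set Js \<Longrightarrow> ideal J R" "iprod Js \<subseteq> P"
  shows "\<exists>J\<in>set Js. J \<subseteq> P"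
  using assms(2,3)
proof (induction Js)
  case Nil
  then show ?case
    using primeideal.I_notcarr[OF assms(1)] ideal_subset[OF primeideal.axioms(1)[OF assms(1)]] by simp
next
  case (Cons K Js)
  then have "K \<subseteq> P \<or> iprod Js \<subseteq> P"
    using primeideal_divides_ideal_prod[OF assms(1), of K "iprod Js"] iprod_ideal[of Js] by simp
  then show ?case
    using Cons by auto
qed

lemma PIdl_prod:
  assumes "a \<in> carrier R" "b \<in> carrier R"
  shows "ideal_prod R (PIdl a) (PIdl b) = PIdl (a \<otimes> b)"
proof
  show "ideal_prod R (PIdl a) (PIdl b) \<subseteq> PIdl (a \<otimes> b)"
  proof (rule ideal_prod_least)
    show "ideal (PIdl (a \<otimes> b)) R" using assms cgenideal_ideal by simp
    fix i j assume "i \<in> PIdl a" "j \<in> PIdl b"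
    then obtain x y where "x \<in> carrier R" "y \<in> carrier R" "i = x \<otimes> a" "j = y \<otimes> b"
      unfolding PIdl_iff by auto
    then have "i \<otimes> j = (x \<otimes> y) \<otimes> (a \<otimes> b)" "x \<otimes> y \<in> carrier R"
      using assms by (simp_all add: m_ac)
    then show "i \<otimes> j \<in> PIdl (a \<otimes> b)"
      unfolding PIdl_iff by auto
  qed
  have "a \<otimes> b \<in> ideal_prod R (PIdl a) (PIdl b)"
    using assms by (intro ideal_prod.prod cgenideal_self)
  then show "PIdl (a \<otimes> b) \<subseteq> ideal_prod R (PIdl a) (PIdl b)"
    using cgenideal_minimal ideal_prod_is_ideal cgenideal_ideal assms by simp
qed

lemma iprod_PIdl:
  assumes "set xs \<subseteq> carrier R"
  shows "iprod (map (\<lambda>x. PIdl x) xs) = PIdl (foldr (\<otimes>) xs \<one>) \<and> foldr (\<otimes>) xs \<one> \<in> carrier R"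
  using assms
proof (induction xs)
  case Nil
  then show ?case using PIdl_eq_carrier_iff[of \<one>] by simp
next
  case (Cons x xs)
  then show ?case using PIdl_prod[of x "foldr (\<otimes>) xs \<one>"] by simp
qed

section \<open>Powers of an ideal\<close>

definition ideal_pow :: "'a set \<Rightarrow> nat \<Rightarrow> 'a set" where
  "ideal_pow N k = iprod (replicate k N)"

lemma ideal_pow_0 [simp]: "ideal_pow N 0 = carrier R"
  and ideal_pow_Suc [simp]: "ideal_pow N (Suc k) = ideal_prod R N (ideal_pow N k)"
  by (simp_all add: ideal_pow_def)

lemma ideal_pow_ideal: "ideal N R \<Longrightarrow> ideal (ideal_pow N k) R"
  by (induction k) (auto simp: oneideal ideal_prod_is_ideal)

text \<open>Serves to bound the number of factors: a product of ideals inside \<open>N\<close> that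
  has an element outside \<open>ideal_pow N k\<close> has fewer than \<open>k\<close>
  factors.\<close>

lemma iprod_subset_ideal_pow:
  assumes "\<And>J. J \<in> set Js \<Longrightarrow> J \<subseteq> N"
  shows "iprod Js \<subseteq> ideal_pow N (length Js)"
  using assms
proof (induction Js)
  case (Cons J Js)
  then have "ideal_prod R J (iprod Js) \<subseteq> ideal_prod R N (ideal_pow N (length Js))"
    by (intro ideal_prod_mono) auto
  then show ?case by simp
qed simp

lemma ideal_pow_antimono:
  assumes "ideal N R" "m \<le> n"
  shows "ideal_pow N n \<subseteq> ideal_pow N m"
  using assms(2)
proof (induction n rule: dec_induct)
  case (step n)
  then show ?case
    using ideal_prod_inter[OF assms(1) ideal_pow_ideal[OF assms(1), of n]] by auto
qed simp

text \<open>Each factor swallows two copies of \<open>N\<close>, whence the exponent is twice the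
  number of factors.\<close>

lemma ideal_pow_double_subset:
  assumes "ideal N R" "\<And>J. J \<in> set Js \<Longrightarrow> ideal J R"
    "\<And>J x y. \<lbrakk>J \<in> set Js; x \<in> N; y \<in> N\<rbrakk> \<Longrightarrow> x \<otimes> y \<in> J"
  shows "ideal_pow N (2 * length Js) \<subseteq> iprod Js"
  using assms(2,3)
proof (induction Js)
  case (Cons J Js)
  let ?K = "ideal_pow N (2 * length Js)"
  have "ideal_pow N (2 * length (J # Js)) = ideal_prod R (ideal_prod R N N) ?K"
    using ideal_prod_assoc[OF assms(1,1) ideal_pow_ideal[OF assms(1)]] by simp
  also have "\<dots> \<subseteq> ideal_prod R J (iprod Js)"
    using Cons by (intro ideal_prod_mono ideal_prod_least) auto
  finally show ?case by simp
qed simp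

section \<open>Radicals and minimal primes of two-absorbing ideals\<close>

lemma ta_idealD:
  assumes "ta_ideal J R"
  shows "ideal J R"
    and "\<lbrakk>a \<in> carrier R; b \<in> carrier R; c \<in> carrier R; a \<otimes> b \<otimes> c \<in> J\<rbrakk>
      \<Longrightarrow> a \<otimes> b \<in> J \<or> a \<otimes> c \<in> J \<or> b \<otimes> c \<in> J"
  using assms unfolding ta_ideal_def by auto

lemma ta_idealI:
  assumes "ideal J R" "\<And>a b c. \<lbrakk>a \<in> carrier R; b \<in> carrier R; c \<in> carrier R; a \<otimes> b \<otimes> c \<in> J\<rbrakk>
      \<Longrightarrow> a \<otimes> b \<in> J \<or> a \<otimes> c \<in> J \<or> b \<otimes> c \<in> J"
  shows "ta_ideal J R"
  using assms unfolding ta_ideal_def by auto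

text \<open>Read the product as a triple \<open>c\<close>, \<open>a [^] n\<close>, \<open>a\<close>:
  the last two have a power of \<open>a\<close> as product, which is excluded, so either the
  exponent drops by one or \<open>c \<otimes> a\<close> is in \<open>J\<close>.\<close>

lemma ta_ideal_cancel_pow:
  assumes J: "ta_ideal J R" and a: "a \<in> carrier R" "c \<in> carrier R"
    and "c \<otimes> a [^] (n::nat) \<in> J" "\<And>m::nat. a [^] m \<notin> J"
  shows "c \<otimes> a \<in> J"
  using assms(4)
proof (induction n)
  case 0
  then show ?case using a ideal.I_r_closed[OF ta_idealD(1)[OF J]] by simp
next
  case (Suc n)
  have "c \<otimes> a [^] n \<otimes> a \<in> J"
    using Suc.prems a by (simp add: m_assoc)
  then have "c \<otimes> a [^] n \<in> J \<or> c \<otimes> a \<in> J \<or> a [^] Suc n \<in> J"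
    using ta_idealD(2)[OF J, of c "a [^] n" a] a by simp
  then show ?case
    using Suc.IH assms(5)[of "Suc n"] by auto
qed

text \<open>In the triple \<open>a [^] m\<close>, \<open>a\<close>, \<open>a\<close> the pairwise
  products are \<open>a [^] (m + 1)\<close> and \<open>a \<otimes> a\<close>, so the exponent can be
  lowered until it reaches two.\<close>

lemma ta_ideal_square:
  assumes J: "ta_ideal J R" and a: "a \<in> carrier R" "a [^] (n::nat) \<in> J"
  shows "a \<otimes> a \<in> J"
  using a(2)
proof (induction n)
  case 0
  then show ?case using a(1) ideal.one_imp_carrier[OF ta_idealD(1)[OF J]] by simp
next
  case (Suc n)
  show ?case
  proof (cases n)
    case 0
    then show ?thesis using Suc.prems a(1) ideal.I_r_closed[OF ta_idealD(1)[OF J]] by simp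
  next
    case (Suc m)
    then have "a [^] m \<otimes> a \<otimes> a \<in> J" using Suc.prems by simp
    then have "a [^] n \<in> J \<or> a \<otimes> a \<in> J"
      using ta_idealD(2)[OF J, of "a [^] m" a a] a(1) Suc by auto
    then show ?thesis using Suc.IH by auto
  qed
qed

text \<open>Polarization: \<open>a\<close>, \<open>a \<oplus> b\<close>, \<open>b\<close> have
  product in \<open>J\<close> because both squares are in \<open>J\<close>, and each of the three
  possible outcomes gives \<open>a \<otimes> b\<close> after subtracting a square. Thus
  \<open>J\<close> contains the square of its radical.\<close>

lemma ta_ideal_radical_prod:
  assumes J: "ta_ideal J R" and a: "a \<in> carrier R" "a [^] (n::nat) \<in> J"
    and b: "b \<in> carrier R" "b [^] (m::nat) \<in> J"
  shows "a \<otimes> b \<in> J"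
proof -
  note iJ = ta_idealD(1)[OF J]
  have aa: "a \<otimes> a \<in> J" and bb: "b \<otimes> b \<in> J"
    using ta_ideal_square[OF J] a b by auto
  have "a \<otimes> (a \<oplus> b) \<otimes> b = b \<otimes> (a \<otimes> a) \<oplus> a \<otimes> (b \<otimes> b)"
    using a b by (simp add: r_distr l_distr m_ac)
  then have "a \<otimes> (a \<oplus> b) \<otimes> b \<in> J"
    using iJ aa bb a(1) b(1) by (simp add: ideal_add ideal.I_l_closed)
  then consider "a \<otimes> (a \<oplus> b) \<in> J" | "a \<otimes> b \<in> J" | "(a \<oplus> b) \<otimes> b \<in> J"
    using ta_idealD(2)[OF J, of a "a \<oplus> b" b] a(1) b(1) by auto
  then show ?thesis
  proof cases
    case 1
    then have "a \<otimes> b \<oplus> a \<otimes> a \<in> J" using a(1) b(1) by (simp add: r_distr a_comm)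
    then show ?thesis using ideal_add_cancel[OF iJ _ aa] a(1) b(1) by simp
  next
    case 3
    then have "a \<otimes> b \<oplus> b \<otimes> b \<in> J" using a(1) b(1) by (simp add: l_distr)
    then show ?thesis using ideal_add_cancel[OF iJ _ bb] a(1) b(1) by simp
  qed
qed

text \<open>The argument by which a group is not the union of two proper subgroups: if neither
  \<open>x\<close> nor \<open>y\<close> avoids both ideals, then their sum does.\<close>

lemma avoid_two_ideals:
  assumes "ideal M R" "ideal A R" "ideal B R" "\<not> M \<subseteq> A" "\<not> M \<subseteq> B"
  obtains u where "u \<in> M" "u \<notin> A" "u \<notin> B"
proof -
  obtain x y where xy: "x \<in> M" "x \<notin> A" "y \<in> M" "y \<notin> B"
    using assms(4,5) by auto
  have c: "x \<in> carrier R" "y \<in> carrier R"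
    using xy ideal_subset[OF assms(1)] by auto
  show ?thesis
  proof (cases "x \<in> B \<and> y \<in> A")
    case True
    have "x \<oplus> y \<notin> A"
      using ideal_add_cancel[OF assms(2), of x y] True xy c by auto
    moreover have "x \<oplus> y \<notin> B"
      using ideal_add_cancel[OF assms(3), of y x] True xy c a_comm by auto
    ultimately show ?thesis
      using that[of "x \<oplus> y"] ideal_add[OF assms(1)] xy by auto
  next
    case False
    then show ?thesis using that xy by auto
  qed
qed

text \<open>The last two hypotheses say that \<open>P1\<close> and \<open>P2\<close> are minimal primes over \<open>J\<close>.\<close>

lemma ta_ideal_three_primes:
  assumes J: "ta_ideal J R" and P: "primeideal P1 R" "primeideal P2 R" "primeideal P3 R"
    and sub: "J \<subseteq> P1" "J \<subseteq> P2" "J \<subseteq> P3"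
    and incomp: "\<not> P1 \<subseteq> P2" "\<not> P1 \<subseteq> P3" "\<not> P2 \<subseteq> P1" "\<not> P2 \<subseteq> P3"
    and min1: "\<And>a. a \<in> P1 \<Longrightarrow> \<exists>s\<in>carrier R - P1. \<exists>n::nat. s \<otimes> a [^] n \<in> J"
    and min2: "\<And>a. a \<in> P2 \<Longrightarrow> \<exists>s\<in>carrier R - P2. \<exists>n::nat. s \<otimes> a [^] n \<in> J"
  shows False
proof -
  note iP = P[THEN primeideal.axioms(1)] and iJ = ta_idealD(1)[OF J]
  obtain a where a: "a \<in> P1" "a \<notin> P2" "a \<notin> P3"
    using avoid_two_ideals[OF iP(1,2,3)] incomp by metis
  obtain b where b: "b \<in> P2" "b \<notin> P1" "b \<notin> P3"
    using avoid_two_ideals[OF iP(2,1,3)] incomp by metis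
  have carr: "a \<in> carrier R" "b \<in> carrier R"
    using a b ideal_subset iP by (meson subsetD)+
  obtain c and n :: nat where c: "c \<in> carrier R" "c \<notin> P1" "c \<otimes> a [^] n \<in> J"
    using min1[OF a(1)] by auto
  obtain d and m :: nat where d: "d \<in> carrier R" "d \<notin> P2" "d \<otimes> b [^] m \<in> J"
    using min2[OF b(1)] by auto
  \<comment> \<open>No power of \<open>a\<close> lies in \<open>J\<close>, since \<open>a\<close> is
    outside the prime \<open>P2\<close> that contains \<open>J\<close>; the same works for
    \<open>b\<close> and \<open>P1\<close>.\<close>
  have ca: "c \<otimes> a \<in> J"
    using ta_ideal_cancel_pow[OF J carr(1) c(1,3)] prime_pow[OF P(2) carr(1)] a(2) sub(2) by auto
  have db: "d \<otimes> b \<in> J"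
    using ta_ideal_cancel_pow[OF J carr(2) d(1,3)] prime_pow[OF P(1) carr(2)] b(2) sub(1) by auto
  have cP2: "c \<in> P2"
    using primeideal.I_prime[OF P(2) c(1) carr(1)] ca sub(2) a(2) by auto
  have dP1: "d \<in> P1"
    using primeideal.I_prime[OF P(1) d(1) carr(2)] db sub(1) b(2) by auto
  have e: "c \<oplus> d \<notin> P1" "c \<oplus> d \<notin> P2"
    using ideal_add_cancel[OF iP(1), of c d] ideal_add_cancel[OF iP(2), of d c] c d cP2 dP1 a_comm
    by auto
  \<comment> \<open>The critical triple: its product is in \<open>J\<close> through
    \<open>c \<otimes> a\<close> and \<open>d \<otimes> b\<close>, but the three pairwise products
    avoid \<open>P2\<close>, \<open>P1\<close> and \<open>P3\<close> respectively.\<close>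
  have "(c \<oplus> d) \<otimes> a \<otimes> b = b \<otimes> (c \<otimes> a) \<oplus> a \<otimes> (d \<otimes> b)"
    using c(1) d(1) carr by (simp add: l_distr r_distr m_ac)
  then have "(c \<oplus> d) \<otimes> a \<otimes> b \<in> J"
    using ca db carr iJ by (simp add: ideal_add ideal.I_l_closed)
  then have "(c \<oplus> d) \<otimes> a \<in> J \<or> (c \<oplus> d) \<otimes> b \<in> J \<or> a \<otimes> b \<in> J"
    using ta_idealD(2)[OF J, of "c \<oplus> d" a b] c(1) d(1) carr by auto
  moreover have "(c \<oplus> d) \<otimes> a \<notin> P2"
    using primeideal.I_prime[OF P(2), of "c \<oplus> d" a] e a c(1) d(1) carr by auto
  moreover have "(c \<oplus> d) \<otimes> b \<notin> P1"
    using primeideal.I_prime[OF P(1), of "c \<oplus> d" b] e b c(1) d(1) carr by auto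
  moreover have "a \<otimes> b \<notin> P3"
    using primeideal.I_prime[OF P(3), of a b] a b carr by auto
  ultimately show False
    using sub by auto
qed

lemma has_ta_factorizationE:
  assumes "has_ta_factorization R I"
  obtains Js where "Js \<noteq> []" "\<forall>J\<in>set Js. ta_ideal J R \<and> ideal J R \<and> J \<noteq> carrier R" "I = iprod Js"
  using assms ta_idealD(1) unfolding has_ta_factorization_def by auto

lemma has_ta_factorizationI:
  assumes "Js \<noteq> []" "\<And>J. J \<in> set Js \<Longrightarrow> ta_ideal J R" "\<And>J. J \<in> set Js \<Longrightarrow> J \<noteq> carrier R" "I = iprod Js"
  shows "has_ta_factorization R I"
  using assms unfolding has_ta_factorization_def by auto

lemma has_ta_factorization_mult:
  assumes "has_ta_factorization R I" "has_ta_factorization R J"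
  shows "has_ta_factorization R (ideal_prod R I J)"
proof -
  obtain Is where Is: "Is \<noteq> []" "\<forall>J\<in>set Is. ta_ideal J R \<and> ideal J R \<and> J \<noteq> carrier R" "I = iprod Is"
    using assms(1) by (elim has_ta_factorizationE)
  obtain Js where Js: "Js \<noteq> []" "\<forall>J\<in>set Js. ta_ideal J R \<and> ideal J R \<and> J \<noteq> carrier R" "J = iprod Js"
    using assms(2) by (elim has_ta_factorizationE)
  have "ideal_prod R I J = iprod (Is @ Js)"
    using iprod_append[of Is Js] Is Js by auto
  then show ?thesis
    using Is Js by (intro has_ta_factorizationI[of "Is @ Js"]) auto
qed

end

section \<open>Local domains\<close>

lemma (in domain) zero_not_unit: "\<zero> \<notin> Units R"
  by (metis Units_l_inv_ex r_null zero_not_one)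

text \<open>Locality is expressed by the sums of nonunits, so that the maximal ideal is the concrete
  set \<open>nonunits\<close> and needs no parameter of its own.\<close>

locale local_domain = domain +
  assumes nonunit_add: "\<lbrakk>a \<in> carrier R - Units R; b \<in> carrier R - Units R\<rbrakk> \<Longrightarrow> a \<oplus> b \<notin> Units R"
begin

abbreviation nonunits :: "'a set" where
  "nonunits \<equiv> carrier R - Units R"

lemma nonunit_mult: "\<lbrakk>a \<in> nonunits; b \<in> carrier R\<rbrakk> \<Longrightarrow> a \<otimes> b \<in> nonunits"
  using unit_factor[of a b] by auto

lemma nonunits_ideal: "ideal nonunits R"
proof (rule ideal_criterion)
  show "\<zero> \<in> nonunits" using zero_not_unit by simp
  show "x \<oplus> y \<in> nonunits" if "x \<in> nonunits" "y \<in> nonunits" for x y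
    using that nonunit_add[of x y] by simp
  show "r \<otimes> x \<in> nonunits" if "x \<in> nonunits" "r \<in> carrier R" for x r
    using nonunit_mult[OF that] that m_comm[of r x] by simp
qed simp

lemma proper_ideal_subset_nonunits: "\<lbrakk>ideal I R; I \<noteq> carrier R\<rbrakk> \<Longrightarrow> I \<subseteq> nonunits"
  using ideal_unit ideal_subset by auto

lemma maximalideal_iff: "maximalideal N R \<longleftrightarrow> N = nonunits"
proof
  assume N: "maximalideal N R"
  then have "N \<subseteq> nonunits"
    using proper_ideal_subset_nonunits maximalideal.axioms(1) maximalideal.I_notcarr by metis
  then show "N = nonunits"
    using maximal_eq_if_subset[OF N nonunits_ideal] by auto
next
  assume "N = nonunits"
  moreover have "maximalideal nonunits R"
  proof (rule maximalidealI[OF nonunits_ideal])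
    show "carrier R \<noteq> nonunits" by auto
    show "J = nonunits \<or> J = carrier R" if "ideal J R" "nonunits \<subseteq> J" for J
      using proper_ideal_subset_nonunits[OF that(1)] that(2) by auto
  qed
  ultimately show "maximalideal N R" by simp
qed

lemma nonunits_prime: "primeideal nonunits R"
  using maximalideal_prime maximalideal_iff by simp

lemma one_minus_unit:
  assumes "a \<in> nonunits"
  shows "\<one> \<ominus> a \<in> Units R"
proof (rule ccontr)
  assume "\<one> \<ominus> a \<notin> Units R"
  then have "(\<one> \<ominus> a) \<oplus> a \<notin> Units R"
    using assms nonunit_add[of "\<one> \<ominus> a" a] by simp
  then show False
    using assms by (simp add: a_minus_def a_assoc l_neg)
qed

lemma pow_nonunit: "\<lbrakk>t \<in> nonunits; 0 < (n::nat)\<rbrakk> \<Longrightarrow> t [^] n \<in> nonunits"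
  using nonunit_mult[of t "t [^] (n - 1)"] nat_pow_Suc2[of t "n - 1"] by simp

lemma PIdl_nonunit: "z \<in> nonunits \<Longrightarrow> PIdl z \<noteq> carrier R"
  using PIdl_eq_carrier_iff by auto

text \<open>Sums of products collapse to a single multiple of \<open>a\<close>, which makes it
  possible to cancel \<open>a\<close> afterwards.\<close>

lemma ideal_prod_PIdl_nonunits:
  assumes "a \<in> carrier R"
  shows "ideal_prod R (PIdl a) nonunits \<subseteq> {a \<otimes> m | m. m \<in> nonunits}"
proof (rule ideal_prod_least)
  show "ideal {a \<otimes> m |m. m \<in> nonunits} R"
  proof (rule ideal_criterion)
    show "{a \<otimes> m |m. m \<in> nonunits} \<subseteq> carrier R" using assms by auto
    show "\<zero> \<in> {a \<otimes> m |m. m \<in> nonunits}" using assms zero_not_unit by (auto intro!: exI[of _ \<zero>])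
    show "x \<oplus> y \<in> {a \<otimes> m |m. m \<in> nonunits}"
      if xy: "x \<in> {a \<otimes> m |m. m \<in> nonunits}" "y \<in> {a \<otimes> m |m. m \<in> nonunits}" for x y
    proof -
      obtain m m' where m: "x = a \<otimes> m" "y = a \<otimes> m'" "m \<in> nonunits" "m' \<in> nonunits"
        using xy by auto
      then have "x \<oplus> y = a \<otimes> (m \<oplus> m')" "m \<oplus> m' \<in> nonunits"
        using assms r_distr[of m m' a] ideal_add[OF nonunits_ideal, of m m'] by auto
      then show ?thesis by auto
    qed
    show "r \<otimes> x \<in> {a \<otimes> m |m. m \<in> nonunits}"
      if x: "x \<in> {a \<otimes> m |m. m \<in> nonunits}" "r \<in> carrier R" for x r
    proof -
      obtain m where m: "x = a \<otimes> m" "m \<in> nonunits" using x by auto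
      then have "r \<otimes> x = a \<otimes> (m \<otimes> r)" "m \<otimes> r \<in> nonunits"
        using assms x(2) nonunit_mult[of m r] by (auto simp: m_ac)
      then show ?thesis by auto
    qed
  qed
  fix i j assume ij: "i \<in> PIdl a" "j \<in> nonunits"
  then obtain x where "x \<in> carrier R" "i = x \<otimes> a" unfolding PIdl_iff by auto
  then have "i \<otimes> j = a \<otimes> (j \<otimes> x)" "j \<otimes> x \<in> nonunits"
    using assms ij nonunit_mult[of j x] by (auto simp: m_ac)
  then show "i \<otimes> j \<in> {a \<otimes> m |m. m \<in> nonunits}" by auto
qed

text \<open>The factors of a nonzero principal ideal are invertible, hence principal in a local domain.\<close>

lemma principal_prod_factors:
  assumes "ideal I R" "ideal J R" "ideal_prod R I J = PIdl a" "a \<in> carrier R" "a \<noteq> \<zero>"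
  obtains x y where "x \<in> carrier R" "y \<in> carrier R" "I = PIdl x" "J = PIdl y"
proof -
  have aM: "a \<notin> ideal_prod R (PIdl a) nonunits"
  proof
    assume "a \<in> ideal_prod R (PIdl a) nonunits"
    then obtain m where m: "a = a \<otimes> m" "m \<in> nonunits"
      using ideal_prod_PIdl_nonunits[OF assms(4)] by auto
    then have "a \<otimes> m = a \<otimes> \<one>" using assms(4) by simp
    then have "m = \<one>" using m_lcancel[of a m \<one>] assms(4,5) m by auto
    with m show False by simp
  qed
  \<comment> \<open>If all products fell into \<open>(a) M\<close>, then so would \<open>a\<close>
    itself. A product outside \<open>(a) M\<close> generates \<open>(a)\<close>, and its two factors
    will be the generators sought.\<close>
  have "\<exists>i\<in>I. \<exists>j\<in>J. i \<otimes> j \<notin> ideal_prod R (PIdl a) nonunits"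
  proof (rule ccontr)
    assume neg: "\<not> ?thesis"
    then have "ideal_prod R I J \<subseteq> ideal_prod R (PIdl a) nonunits"
      using assms(4) by (intro ideal_prod_least ideal_prod_is_ideal nonunits_ideal cgenideal_ideal) auto
    then show False using assms(3,4) aM cgenideal_self[of a] by auto
  qed
  then obtain i j where ij: "i \<in> I" "j \<in> J" "i \<otimes> j \<notin> ideal_prod R (PIdl a) nonunits" by auto
  have ijc: "i \<in> carrier R" "j \<in> carrier R"
    using ij ideal_subset assms(1,2) by auto
  have "i \<otimes> j \<in> PIdl a" using ideal_prod.prod[OF ij(1,2)] assms(3) by metis
  then obtain u where u: "u \<in> carrier R" "i \<otimes> j = u \<otimes> a" unfolding PIdl_iff by auto
  have uU: "u \<in> Units R"
  proof (rule ccontr)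
    assume "u \<notin> Units R"
    then have "a \<otimes> u \<in> ideal_prod R (PIdl a) nonunits"
      using u(1) assms(4) by (intro ideal_prod.prod cgenideal_self) auto
    then show False using ij(3) u assms(4) m_comm by simp
  qed
  have ne: "i \<noteq> \<zero>" "j \<noteq> \<zero>"
    using u uU assms(4,5) ijc integral[of u a] zero_not_unit by auto
  \<comment> \<open>With \<open>u\<close> a unit, \<open>k \<otimes> l\<close> generates
    \<open>(a)\<close>; so \<open>x \<otimes> l\<close> is a multiple of
    \<open>k \<otimes> l\<close>, and \<open>l\<close> cancels. It is used once for each of the two
    ideals.\<close>
  have key: "x \<in> PIdl k"
    if h: "x \<in> carrier R" "k \<in> carrier R" "l \<in> carrier R" "l \<noteq> \<zero>"
      "k \<otimes> l = u \<otimes> a" "x \<otimes> l \<in> PIdl a" for x k l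
  proof -
    obtain v where v: "v \<in> carrier R" "x \<otimes> l = v \<otimes> a" using h unfolding PIdl_iff by auto
    have "(v \<otimes> inv u) \<otimes> (u \<otimes> a) = v \<otimes> (inv u \<otimes> u) \<otimes> a"
      using v(1) assms(4) u(1) Units_inv_closed[OF uU] by (simp only: m_ac m_closed)
    then have "x \<otimes> l = (v \<otimes> inv u) \<otimes> (u \<otimes> a)"
      using v assms(4) uU by simp
    also have "\<dots> = (v \<otimes> inv u) \<otimes> (k \<otimes> l)"
      using h(5) by simp
    also have "\<dots> = (v \<otimes> inv u \<otimes> k) \<otimes> l"
      using h(2,3) v(1) Units_inv_closed[OF uU] by (simp only: m_assoc m_closed)
    finally have "x = v \<otimes> inv u \<otimes> k"
      using m_rcancel[of l x "v \<otimes> inv u \<otimes> k"] that v uU by simp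
    then show ?thesis unfolding PIdl_iff using v uU by auto
  qed
  have "I \<subseteq> PIdl i"
  proof
    fix x assume x: "x \<in> I"
    then have "x \<otimes> j \<in> PIdl a" using ideal_prod.prod[OF x ij(2)] assms(3) by metis
    then show "x \<in> PIdl i" using key[of x i j] x ideal_subset[OF assms(1)] ijc ne u by auto
  qed
  moreover have "J \<subseteq> PIdl j"
  proof
    fix y assume y: "y \<in> J"
    then have "i \<otimes> y \<in> PIdl a" using ideal_prod.prod[OF ij(1) y] assms(3) by metis
    then show "y \<in> PIdl j"
      using key[of y j i] y ideal_subset[OF assms(2)] ijc ne u m_comm[of i] by auto
  qed
  ultimately have "I = PIdl i" "J = PIdl j"
    using cgenideal_minimal[OF assms(1) ij(1)] cgenideal_minimal[OF assms(2) ij(2)] by auto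
  then show ?thesis using that ijc by auto
qed

lemma iprod_principal_factors:
  assumes "\<And>J. J \<in> set Js \<Longrightarrow> ideal J R" "iprod Js = PIdl a" "a \<in> carrier R" "a \<noteq> \<zero>"
  shows "\<exists>xs. set xs \<subseteq> carrier R - {\<zero>} \<and> Js = map (\<lambda>x. PIdl x) xs"
  using assms
proof (induction Js arbitrary: a)
  case (Cons J Js)
  have J: "ideal J R" "ideal (iprod Js) R"
    using Cons.prems(1) iprod_ideal[of Js] by auto
  obtain x y where xy: "x \<in> carrier R" "y \<in> carrier R" "J = PIdl x" "iprod Js = PIdl y"
    using principal_prod_factors[OF J _ Cons.prems(3,4)] Cons.prems(2) by auto
  have "PIdl (x \<otimes> y) = PIdl a" using Cons.prems(2) xy PIdl_prod by simp
  then have "a \<in> PIdl (x \<otimes> y)" using cgenideal_self Cons.prems(3) by metis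
  then have "x \<noteq> \<zero>" "y \<noteq> \<zero>" using Cons.prems(4) xy unfolding PIdl_iff by auto
  moreover obtain xs where "set xs \<subseteq> carrier R - {\<zero>}" "Js = map (\<lambda>x. PIdl x) xs"
    using Cons.IH[OF _ xy(4,2) \<open>y \<noteq> \<zero>\<close>] Cons.prems(1) by auto
  ultimately show ?case using xy by (intro exI[of _ "x # xs"]) auto
qed simp

end

section \<open>Atoms, associates and ascending chains of principal ideals\<close>

context domain
begin

abbreviation fprod :: "'a list \<Rightarrow> 'a" where
  "fprod ps \<equiv> foldr (\<otimes>) ps \<one>"

lemma fprod_closed: "set ps \<subseteq> carrier R \<Longrightarrow> fprod ps \<in> carrier R"
  by (induction ps) auto

lemma fprod_append:
  "\<lbrakk>set ps \<subseteq> carrier R; set qs \<subseteq> carrier R\<rbrakk> \<Longrightarrow> fprod (ps @ qs) = fprod ps \<otimes> fprod qs"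
  by (induction ps) (auto simp: fprod_closed m_assoc)

lemma Units_nonzero: "u \<in> Units R \<Longrightarrow> u \<noteq> \<zero>"
  using zero_not_unit by auto

lemma unit_divisor: "\<lbrakk>a \<otimes> b \<in> Units R; a \<in> carrier R; b \<in> carrier R\<rbrakk> \<Longrightarrow> a \<in> Units R"
  using unit_factor by blast

lemma inv_mult_cancel: "\<lbrakk>u \<in> Units R; x \<in> carrier R\<rbrakk> \<Longrightarrow> inv u \<otimes> (u \<otimes> x) = x"
  by (simp add: m_assoc[symmetric] Units_closed)

lemma atomD:
  assumes "atom R p"
  shows "p \<in> carrier R" "p \<noteq> \<zero>" "p \<notin> Units R"
    "\<lbrakk>a \<in> carrier R; b \<in> carrier R; p = a \<otimes> b\<rbrakk> \<Longrightarrow> a \<in> Units R \<or> b \<in> Units R"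
  using assms unfolding atom_iff by auto

lemma atomI:
  assumes "p \<in> carrier R" "p \<noteq> \<zero>" "p \<notin> Units R"
    "\<And>a b. \<lbrakk>a \<in> carrier R; b \<in> carrier R; p = a \<otimes> b\<rbrakk> \<Longrightarrow> a \<in> Units R \<or> b \<in> Units R"
  shows "atom R p"
  using assms unfolding atom_iff by auto

lemma atom_unit_mult:
  assumes "atom R p" "u \<in> Units R"
  shows "atom R (u \<otimes> p)"
proof (rule atomI)
  note p = atomD(1-3)[OF assms(1)] and u = Units_closed[OF assms(2)]
  show "u \<otimes> p \<in> carrier R" using p u by simp
  show "u \<otimes> p \<noteq> \<zero>" using p u assms(2) zero_not_unit by (auto simp: integral_iff)
  show "u \<otimes> p \<notin> Units R"
    using p(1,3) assms(2) u unit_divisor[of p u] m_comm[of u p] by auto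
  fix a b assume ab: "a \<in> carrier R" "b \<in> carrier R" "u \<otimes> p = a \<otimes> b"
  have "p = inv u \<otimes> (u \<otimes> p)"
    using p(1) assms(2) u by (simp add: m_assoc[symmetric])
  also have "\<dots> = (inv u \<otimes> a) \<otimes> b"
    using ab assms(2) u by (simp add: m_assoc)
  finally have "inv u \<otimes> a \<in> Units R \<or> b \<in> Units R"
    using atomD(4)[OF assms(1), of "inv u \<otimes> a" b] ab assms(2) u by simp
  then show "a \<in> Units R \<or> b \<in> Units R"
    using ab(1) assms(2) u unit_divisor[of a "inv u"] m_comm[of "inv u" a] by auto
qed

lemma atoms_subset: "\<forall>p\<in>set ps. atom R p \<Longrightarrow> set ps \<subseteq> carrier R"
  using atomD by auto

lemma PIdl_subset_iff:
  assumes "a \<in> carrier R" "b \<in> carrier R"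
  shows "PIdl a \<subseteq> PIdl b \<longleftrightarrow> (\<exists>c\<in>carrier R. a = b \<otimes> c)"
proof -
  have "PIdl a \<subseteq> PIdl b \<longleftrightarrow> a \<in> PIdl b"
    using cgenideal_minimal[OF cgenideal_ideal[OF assms(2)], of a] cgenideal_self[OF assms(1)] by auto
  also have "\<dots> \<longleftrightarrow> (\<exists>c\<in>carrier R. a = b \<otimes> c)"
    unfolding PIdl_iff using m_comm[OF assms(2)] by (metis)
  finally show ?thesis .
qed

lemma PIdl_eq_unit:
  assumes "a \<in> carrier R" "b \<in> carrier R" "a \<noteq> \<zero>" "PIdl a = PIdl b"
  obtains u where "u \<in> Units R" "a = u \<otimes> b"
proof -
  obtain c d where cd: "c \<in> carrier R" "d \<in> carrier R" "a = b \<otimes> c" "b = a \<otimes> d"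
    using PIdl_subset_iff[OF assms(1,2)] PIdl_subset_iff[OF assms(2,1)] assms(4) by auto
  then have "a \<otimes> (d \<otimes> c) = a \<otimes> \<one>"
    using assms(1) by (simp add: m_assoc[symmetric])
  then have "d \<otimes> c = \<one>"
    using m_lcancel[OF assms(3,1), of "d \<otimes> c" \<one>] cd(1,2) by simp
  then have "c \<in> Units R"
    using cd(1,2) unit_divisor[of c d] m_comm[of c d] by simp
  then show ?thesis
    using that[of c] cd(1,3) m_comm[of b c] assms(2) by simp
qed

text \<open>A nonunit needs at least one atom, and the first atom absorbs the unit.\<close>

lemma atomic_if_unit_multiple:
  assumes "\<And>x. \<lbrakk>x \<in> carrier R; x \<noteq> \<zero>; x \<notin> Units R\<rbrakk>
      \<Longrightarrow> \<exists>u ps. u \<in> Units R \<and> (\<forall>p\<in>set ps. atom R p) \<and> x = u \<otimes> fprod ps"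
  shows "atomic R"
  unfolding atomic_def
proof (intro ballI impI)
  fix x assume x: "x \<in> carrier R - {\<zero>}" "x \<notin> Units R"
  then obtain u ps where ps: "u \<in> Units R" "\<forall>p\<in>set ps. atom R p" "x = u \<otimes> fprod ps"
    using assms[of x] by auto
  then obtain p qs where "ps = p # qs"
    using x(2) by (cases ps) auto
  then have "x = fprod ((u \<otimes> p) # qs)" "\<forall>q\<in>set ((u \<otimes> p) # qs). atom R q"
    using ps atom_unit_mult atoms_subset[of qs] fprod_closed[of qs] atomD(1)[of p] Units_closed[of u] by (auto simp: m_assoc)
  then show "\<exists>ps. (\<forall>p\<in>set ps. atom R p) \<and> x = fprod ps" by metis
qed

text \<open>An element without a factorization into atoms is a product of two nonunits, one of which
  again has none. Dependent choice turns this into a strictly ascending chain of principal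
  ideals.\<close>

lemma accp_imp_atomic:
  assumes "accp R"
  shows "atomic R"
proof (rule ccontr)
  define bad where "bad x \<longleftrightarrow> x \<in> carrier R - {\<zero>} \<and> x \<notin> Units R \<and>
      (\<nexists>ps. (\<forall>p\<in>set ps. atom R p) \<and> x = fprod ps)" for x
  assume "\<not> atomic R"
  then obtain x0 where x0: "bad x0" unfolding atomic_def bad_def by auto
  have step: "\<exists>y. bad y \<and> PIdl x \<subset> PIdl y" if bad: "bad x" for x
  proof -
    have x: "x \<in> carrier R" "x \<noteq> \<zero>" "x \<notin> Units R" using bad unfolding bad_def by auto
    have "\<not> atom R x"
    proof
      assume "atom R x"
      then have "\<forall>p\<in>set [x]. atom R p" "x = fprod [x]" using x by auto
      then show False using bad unfolding bad_def by metis
    qed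
    then obtain a b where ab: "a \<in> carrier R" "b \<in> carrier R" "x = a \<otimes> b" "a \<notin> Units R" "b \<notin> Units R"
      using x unfolding atom_iff by auto
    have ne: "a \<noteq> \<zero>" "b \<noteq> \<zero>" using x ab by auto
    have strict: "PIdl x \<subset> PIdl c" if c: "c \<in> carrier R" "d \<in> carrier R" "x = c \<otimes> d" "d \<notin> Units R" for c d
    proof -
      have "PIdl x \<subseteq> PIdl c" using PIdl_subset_iff[of x c] x c by auto
      moreover have "PIdl x \<noteq> PIdl c"
      proof
        assume "PIdl x = PIdl c"
        then obtain u where u: "u \<in> Units R" "x = u \<otimes> c" using PIdl_eq_unit[OF x(1) c(1) x(2)] by auto
        then have "c \<otimes> d = c \<otimes> u" using c m_comm[of u c] Units_closed[of u] by simp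
        moreover have "c \<noteq> \<zero>" using c x(2) by auto
        ultimately have "d = u" using m_lcancel[of c d u] c(1,2) Units_closed[OF u(1)] by simp
        then show False using u c by simp
      qed
      ultimately show ?thesis by auto
    qed
    have "bad a \<or> bad b"
    proof (rule ccontr)
      assume "\<not> ?thesis"
      then obtain ps qs where "\<forall>p\<in>set ps. atom R p" "a = fprod ps" "\<forall>p\<in>set qs. atom R p" "b = fprod qs"
        using ab ne unfolding bad_def by auto
      then have "\<forall>p\<in>set (ps @ qs). atom R p" "x = fprod (ps @ qs)"
        using fprod_append[of ps qs] atoms_subset[of ps] atoms_subset[of qs] ab by auto
      then show False using bad unfolding bad_def by metis
    qed
    then show ?thesis
      using strict[of a b] strict[of b a] ab m_comm[of a b] by auto
  qed
  have "\<exists>f. \<forall>n::nat. bad (f n) \<and> PIdl (f n) \<subset> PIdl (f (Suc n))"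
    by (rule dependent_nat_choice) (use x0 step in auto)
  then obtain f where "\<forall>n::nat. bad (f n) \<and> PIdl (f n) \<subset> PIdl (f (Suc n))" ..
  then have f: "bad (f n)" "PIdl (f n) \<subset> PIdl (f (Suc n))" for n
    by simp_all
  have "\<forall>n. principalideal (PIdl (f n)) R"
    using f(1) cgenideal_is_principalideal unfolding bad_def by auto
  moreover have "\<forall>n. PIdl (f n) \<subseteq> PIdl (f (Suc n))" using f(2) by auto
  ultimately obtain N where N: "\<forall>n\<ge>N. PIdl (f n) = PIdl (f N)"
    using assms[unfolded accp_def, THEN spec, of "\<lambda>n. PIdl (f n)"] by auto
  have "PIdl (f (Suc N)) = PIdl (f N)" by (rule N[rule_format]) simp
  then show False using f(2)[of N] by simp
qed

end

section \<open>Length functions on local domains\<close>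

context local_domain
begin

text \<open>A discrete valuation seen from the smaller ring: it turns out to be the restriction to
  \<open>R\<close> of the valuation belonging to \<open>(M:M)\<close>. Sums are not mentioned;
  divisibility under strict inequality takes their place. Two atoms have equal length but need not
  divide each other.\<close>

definition length_function :: "('a \<Rightarrow> nat) \<Rightarrow> bool" where
  "length_function v \<longleftrightarrow>
     (\<forall>a\<in>carrier R - {\<zero>}. \<forall>b\<in>carrier R - {\<zero>}.
        v (a \<otimes> b) = v a + v b \<and> (v a < v b \<longrightarrow> a divides b)) \<and>
     (\<forall>a\<in>carrier R - {\<zero>}. v a = 0 \<longleftrightarrow> a \<in> Units R) \<and>
     (\<forall>p. atom R p \<longrightarrow> v p = 1)"

text \<open>In terms of ideals, \<open>PIdl p\<close> contains the square of the maximal ideal for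
  every atom \<open>p\<close>; this is the link to TA-ideals.\<close>

definition atoms_divide_products :: bool where
  "atoms_divide_products \<longleftrightarrow>
     (\<forall>p x y. atom R p \<longrightarrow> x \<in> nonunits \<longrightarrow> y \<in> nonunits \<longrightarrow> p divides (x \<otimes> y))"

lemma atomicE:
  assumes "atomic R" "x \<in> carrier R" "x \<noteq> \<zero>" "x \<notin> Units R"
  obtains ps where "\<forall>p\<in>set ps. atom R p" "x = fprod ps" "ps \<noteq> []"
proof -
  obtain ps where ps: "\<forall>p\<in>set ps. atom R p" "x = fprod ps"
    using assms unfolding atomic_def by auto
  moreover from this have "ps \<noteq> []" using assms(4) by auto
  ultimately show ?thesis using that by simp
qed

text \<open>The cofactor of \<open>p\<close> in \<open>q1 \<otimes> q2\<close> cannot be a unit,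
  since otherwise the product of the two nonunits would be associated to \<open>p\<close> and hence
  an atom. So at least one more atom appears beside \<open>p\<close>.\<close>

lemma exchange_atom:
  assumes at: "atomic R" "atoms_divide_products" and p: "atom R p" and q: "atom R q1" "atom R q2"
  obtains ws where "\<forall>p\<in>set ws. atom R p" "ws \<noteq> []" "q1 \<otimes> q2 = p \<otimes> fprod ws"
proof -
  note pD = atomD[OF p] and qD = atomD[OF q(1)] atomD[OF q(2)]
  obtain w where w: "w \<in> carrier R" "q1 \<otimes> q2 = p \<otimes> w"
    using at(2) p qD unfolding atoms_divide_products_def factor_def by (metis DiffI)
  have "w \<noteq> \<zero>" using w qD pD by (auto simp: integral_iff)
  moreover have "w \<notin> Units R"
  proof
    assume wU: "w \<in> Units R"
    then have "atom R (p \<otimes> w)" using atom_unit_mult[OF p wU] m_comm[OF w(1) pD(1)] by simp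
    then have "q1 \<in> Units R \<or> q2 \<in> Units R"
      using atomD(4)[of "p \<otimes> w" q1 q2] w qD by metis
    then show False using qD by auto
  qed
  ultimately show ?thesis
    using atomicE[OF at(1) w(1)] that w by metis
qed

lemma fprod_unit:
  assumes "\<forall>q\<in>set qs. atom R q" "u \<otimes> fprod qs \<in> Units R" "u \<in> carrier R"
  shows "qs = []"
proof (cases qs)
  case (Cons q qs')
  have c: "q \<in> carrier R" "fprod qs' \<in> carrier R"
    using assms(1) Cons atomD(1) fprod_closed[of qs'] by auto
  have "u \<otimes> fprod qs = q \<otimes> (u \<otimes> fprod qs')" using c assms(3) Cons by (simp add: m_ac)
  then have "q \<in> Units R" using unit_divisor[of q "u \<otimes> fprod qs'"] assms(2,3) c by simp
  then show ?thesis using assms(1) Cons atomD(3) by auto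
qed simp

text \<open>The first two atoms of \<open>qs\<close> are exchanged for \<open>p\<close> and a
  nonempty list \<open>ws\<close>; cancelling \<open>p\<close> removes one atom from
  \<open>ps\<close> and at most one from \<open>qs\<close>. The unit \<open>u\<close> makes the
  bound apply to associates, hence in both directions.\<close>

lemma atom_prod_length_le:
  assumes at: "atomic R" "atoms_divide_products"
  shows "\<lbrakk>\<forall>p\<in>set ps. atom R p; \<forall>q\<in>set qs. atom R q; u \<in> Units R; fprod ps = u \<otimes> fprod qs\<rbrakk>
    \<Longrightarrow> length qs \<le> length ps"
proof (induction ps arbitrary: qs u)
  case Nil
  then show ?case using fprod_unit[of qs u] by auto
next
  case (Cons p ps)
  consider "length qs \<le> 1" | q1 q2 qs' where "qs = q1 # q2 # qs'"
    by (cases qs; cases "tl qs") auto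
  then show ?case
  proof cases
    case 1
    then show ?thesis by simp
  next
    case 2
    have p: "atom R p" and q: "atom R q1" "atom R q2" using Cons.prems 2 by auto
    obtain ws where ws: "\<forall>p\<in>set ws. atom R p" "ws \<noteq> []" "q1 \<otimes> q2 = p \<otimes> fprod ws"
      using exchange_atom[OF at p q] .
    have c: "p \<in> carrier R" "q1 \<in> carrier R" "q2 \<in> carrier R" "fprod ps \<in> carrier R" "fprod ws \<in> carrier R"
        "fprod qs' \<in> carrier R" "u \<in> carrier R" "set ws \<subseteq> carrier R" "set qs' \<subseteq> carrier R"
      using p q atomD(1) ws Cons.prems 2 fprod_closed[of ps] fprod_closed[of ws] fprod_closed[of qs'] by auto
    have "p \<otimes> fprod ps = u \<otimes> ((q1 \<otimes> q2) \<otimes> fprod qs')"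
      using Cons.prems(4) 2 c by (simp add: m_assoc)
    also have "\<dots> = u \<otimes> ((p \<otimes> fprod ws) \<otimes> fprod qs')" using ws(3) by simp
    also have "\<dots> = p \<otimes> (u \<otimes> fprod (ws @ qs'))"
      using c fprod_append[of ws qs'] by (simp add: m_ac)
    finally have "fprod ps = u \<otimes> fprod (ws @ qs')"
      using m_lcancel[of p "fprod ps" "u \<otimes> fprod (ws @ qs')"] c atomD(2)[OF p] fprod_append[of ws qs'] by simp
    then have "length (ws @ qs') \<le> length ps"
      using Cons.IH[of "ws @ qs'" u] Cons.prems ws 2 by auto
    moreover have "length ws \<ge> 1" using ws(2) by (cases ws) auto
    ultimately show ?thesis using 2 by simp
  qed
qed

text \<open>The same exchange as for the length bound. Strictness of the inequality guarantees that
  \<open>qs\<close> still has two atoms to exchange whenever \<open>ps\<close> is nonempty.\<close>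

lemma atom_prod_divides:
  assumes at: "atomic R" "atoms_divide_products"
  shows "\<lbrakk>\<forall>p\<in>set ps. atom R p; \<forall>q\<in>set qs. atom R q; length ps < length qs\<rbrakk>
    \<Longrightarrow> fprod ps divides fprod qs"
proof (induction ps arbitrary: qs)
  case Nil
  then have "fprod qs \<in> carrier R"
    using fprod_closed[of qs] atoms_subset[of qs] by simp
  then show ?case unfolding factor_def by (intro bexI[of _ "fprod qs"]) simp_all
next
  case (Cons p ps)
  then obtain q1 q2 qs' where 2: "qs = q1 # q2 # qs'"
    by (cases qs; cases "tl qs") auto
  have p: "atom R p" and q: "atom R q1" "atom R q2" using Cons.prems 2 by auto
  obtain ws where ws: "\<forall>p\<in>set ws. atom R p" "ws \<noteq> []" "q1 \<otimes> q2 = p \<otimes> fprod ws"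
    using exchange_atom[OF at p q] .
  have c: "p \<in> carrier R" "q1 \<in> carrier R" "q2 \<in> carrier R" "fprod ps \<in> carrier R" "fprod ws \<in> carrier R"
      "fprod qs' \<in> carrier R" "set ws \<subseteq> carrier R" "set qs' \<subseteq> carrier R"
    using p q atomD(1) ws Cons.prems 2 fprod_closed[of ps] fprod_closed[of ws] fprod_closed[of qs'] by auto
  have "fprod qs = (q1 \<otimes> q2) \<otimes> fprod qs'"
    using 2 c by (simp add: m_assoc)
  also have "\<dots> = p \<otimes> fprod (ws @ qs')"
    using c ws(3) fprod_append[of ws qs'] by (simp add: m_ac)
  finally have eq: "fprod qs = p \<otimes> fprod (ws @ qs')" .
  have "length ws \<ge> 1" using ws(2) by (cases ws) auto
  then have "fprod ps divides fprod (ws @ qs')"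
    using Cons ws 2 by (intro Cons.IH) auto
  then obtain d where d: "d \<in> carrier R" "fprod (ws @ qs') = fprod ps \<otimes> d"
    unfolding factor_def by auto
  have "fprod qs = fprod (p # ps) \<otimes> d"
    using c d(1) unfolding eq d(2) by (simp add: m_assoc)
  then show ?case unfolding factor_def using d(1) by blast
qed

lemma exists_length_function:
  assumes at: "atomic R" "atoms_divide_products"
  obtains v where "length_function v"
proof -
  \<comment> \<open>The unit factor gives units the empty factorization, hence length 0.\<close>
  define fac where "fac a ps \<longleftrightarrow> (\<forall>p\<in>set ps. atom R p) \<and> (\<exists>u\<in>Units R. a = u \<otimes> fprod ps)" for a ps
  define v where "v a = length (SOME ps. fac a ps)" for a
  \<comment> \<open>One inequality is enough, because the two factorizations may be swapped; the
    choice made by \<open>SOME\<close> is thereby irrelevant.\<close>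
  have uniq: "length ps \<le> length qs" if h: "fac a ps" "fac a qs" for a ps qs
  proof -
    obtain u w where uw: "u \<in> Units R" "w \<in> Units R" "a = u \<otimes> fprod ps" "a = w \<otimes> fprod qs"
      using h unfolding fac_def by auto
    have c: "fprod ps \<in> carrier R" "fprod qs \<in> carrier R"
      using h fprod_closed[of ps] fprod_closed[of qs] atoms_subset[of ps] atoms_subset[of qs]
      unfolding fac_def by auto
    have "fprod qs = inv w \<otimes> (w \<otimes> fprod qs)" using inv_mult_cancel uw(2) c(2) by simp
    also have "\<dots> = inv w \<otimes> (u \<otimes> fprod ps)" using uw(3,4) by simp
    also have "\<dots> = (inv w \<otimes> u) \<otimes> fprod ps" using uw(1,2) c by (simp add: m_assoc Units_closed)
    finally show ?thesis
      using atom_prod_length_le[OF at, of qs ps "inv w \<otimes> u"] h uw unfolding fac_def by simp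
  qed
  have v_eq: "v a = length ps" if "fac a ps" for a ps
    using uniq[of a] that someI[of "fac a" ps] unfolding v_def by (meson le_antisym)
  have ex: "\<exists>ps. fac a ps" if a: "a \<in> carrier R - {\<zero>}" for a
  proof (cases "a \<in> Units R")
    case True
    then have "fac a []" unfolding fac_def using a by (auto intro!: bexI[of _ a])
    then show ?thesis by auto
  next
    case False
    obtain ps where "\<forall>p\<in>set ps. atom R p" "a = fprod ps" "ps \<noteq> []"
      using atomicE[OF at(1) _ _ False] a by auto
    moreover from this have "a = \<one> \<otimes> fprod ps" using a by simp
    ultimately have "fac a ps" unfolding fac_def by blast
    then show ?thesis by auto
  qed
  have "v (a \<otimes> b) = v a + v b \<and> (v a < v b \<longrightarrow> a divides b)"
    if ab: "a \<in> carrier R - {\<zero>}" "b \<in> carrier R - {\<zero>}" for a b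
  proof -
    obtain ps qs where h: "fac a ps" "fac b qs" using ex ab by blast
    then obtain u w where uw: "u \<in> Units R" "w \<in> Units R" "a = u \<otimes> fprod ps" "b = w \<otimes> fprod qs"
      unfolding fac_def by auto
    have c: "set ps \<subseteq> carrier R" "set qs \<subseteq> carrier R" "fprod ps \<in> carrier R" "fprod qs \<in> carrier R"
      using h fprod_closed[of ps] fprod_closed[of qs] atoms_subset[of ps] atoms_subset[of qs]
      unfolding fac_def by auto
    have "a \<otimes> b = (u \<otimes> w) \<otimes> fprod (ps @ qs)"
      using uw c fprod_append[of ps qs] Units_closed by (simp add: m_ac)
    moreover have "u \<otimes> w \<in> Units R" using uw by simp
    ultimately have "fac (a \<otimes> b) (ps @ qs)" using h unfolding fac_def by auto
    then have "v (a \<otimes> b) = v a + v b" using v_eq h by simp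
    moreover have "a divides b" if "v a < v b"
    proof -
      have "fprod ps divides fprod qs"
        using that h v_eq atom_prod_divides[OF at, of ps qs] unfolding fac_def by simp
      then obtain d where d: "d \<in> carrier R" "fprod qs = fprod ps \<otimes> d" unfolding factor_def by auto
      have "fprod ps = inv u \<otimes> a" using uw(1,3) inv_mult_cancel c(3) by simp
      have "b = w \<otimes> ((inv u \<otimes> a) \<otimes> d)"
        using uw(4) d(2) \<open>fprod ps = inv u \<otimes> a\<close> by simp
      also have "\<dots> = a \<otimes> (inv u \<otimes> d \<otimes> w)"
        using uw(1,2) d(1) ab by (simp add: m_ac Units_closed)
      finally have "b = a \<otimes> (inv u \<otimes> d \<otimes> w)" .
      then show ?thesis using uw d unfolding factor_def by auto
    qed
    ultimately show ?thesis by simp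
  qed
  moreover have "v a = 0 \<longleftrightarrow> a \<in> Units R" if a: "a \<in> carrier R - {\<zero>}" for a
  proof
    obtain ps where h: "fac a ps" using ex a by blast
    then obtain u where u: "u \<in> Units R" "a = u \<otimes> fprod ps" "\<forall>p\<in>set ps. atom R p" unfolding fac_def by auto
    { assume "v a = 0"
      then have "ps = []" using v_eq[OF h] by simp
      then show "a \<in> Units R" using u by simp }
    { assume "a \<in> Units R"
      then have "ps = []" using fprod_unit[of ps u] u by auto
      then show "v a = 0" using v_eq[OF h] by simp }
  qed
  moreover have "v p = 1" if p: "atom R p" for p
  proof -
    have "p = \<one> \<otimes> fprod [p]" using atomD(1)[OF p] by simp
    then have "fac p [p]" unfolding fac_def using p by (auto intro!: bexI[of _ \<one>])
    then show ?thesis using v_eq by simp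
  qed
  ultimately have "length_function v" unfolding length_function_def by simp
  then show ?thesis using that by simp
qed

lemma length_functionD:
  assumes "length_function v"
  shows "\<lbrakk>a \<in> carrier R; a \<noteq> \<zero>; b \<in> carrier R; b \<noteq> \<zero>\<rbrakk> \<Longrightarrow> v (a \<otimes> b) = v a + v b"
    and "\<lbrakk>a \<in> carrier R; a \<noteq> \<zero>; b \<in> carrier R; b \<noteq> \<zero>; v a < v b\<rbrakk> \<Longrightarrow> \<exists>c\<in>carrier R. b = a \<otimes> c"
    and "\<lbrakk>a \<in> carrier R; a \<noteq> \<zero>\<rbrakk> \<Longrightarrow> v a = 0 \<longleftrightarrow> a \<in> Units R"
    and "atom R p \<Longrightarrow> v p = 1"
  using assms unfolding length_function_def factor_def by auto

text \<open>From the first nonzero ideal on, the length of the generators cannot increase along the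
  chain. Beyond an index \<open>N\<close> of least length the quotient of two generators has length
  0, so it is a unit.\<close>

lemma length_function_accp:
  assumes v: "length_function v"
  shows "accp R"
  unfolding accp_def
proof (intro allI impI)
  fix I :: "nat \<Rightarrow> 'a set"
  assume I: "(\<forall>n. principalideal (I n) R) \<and> (\<forall>n. I n \<subseteq> I (Suc n))"
  then have "\<forall>n. \<exists>a\<in>carrier R. I n = PIdl a" unfolding principalideal_iff by simp
  then obtain a where a: "\<And>n. a n \<in> carrier R" "\<And>n. I n = PIdl (a n)" by metis
  have mono: "I m \<subseteq> I n" if "m \<le> n" for m n
    using lift_Suc_mono_le[of I] I that by auto
  show "\<exists>N. \<forall>n\<ge>N. I n = I N"
  proof (cases "\<forall>n. a n = \<zero>")
    case True
    then show ?thesis using a by auto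
  next
    case False
    then obtain n0 where n0: "a n0 \<noteq> \<zero>" by auto
    have nz: "a n \<noteq> \<zero>" if "n \<ge> n0" for n
    proof
      assume "a n = \<zero>"
      then have "a n0 \<in> PIdl \<zero>" using mono[OF that] a cgenideal_self[OF a(1)] by auto
      then show False using n0 unfolding PIdl_iff by auto
    qed
    obtain N where N: "n0 \<le> N" "\<And>n. n0 \<le> n \<Longrightarrow> v (a N) \<le> v (a n)"
      using ex_has_least_nat[of "\<lambda>n. n0 \<le> n" n0 "\<lambda>n. v (a n)"] by auto
    have "I n = I N" if n: "n \<ge> N" for n
    proof -
      obtain c where c: "c \<in> carrier R" "a N = a n \<otimes> c"
        using mono[OF n] PIdl_subset_iff[OF a(1) a(1), of N n] a(2) by auto
      have "c \<noteq> \<zero>" using c nz[OF N(1)] a(1) by auto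
      then have "v (a N) = v (a n) + v c"
        using length_functionD(1)[OF v a(1) nz c(1), of n] c N(1) n by simp
      then have "v c = 0" using N(2)[of n] N(1) n by simp
      then have "c \<in> Units R" using length_functionD(3)[OF v c(1) \<open>c \<noteq> \<zero>\<close>] by simp
      then have "a n = a N \<otimes> inv c" using c a(1) by (simp add: m_assoc)
      then have "I n \<subseteq> I N"
        using PIdl_subset_iff[OF a(1) a(1), of n N] a(2) \<open>c \<in> Units R\<close> by auto
      then show ?thesis using mono[OF n] by auto
    qed
    then show ?thesis by auto
  qed
qed

text \<open>A unit among \<open>a\<close> and \<open>b\<close> can be cancelled from the triple
  product; if both are nonunits, their product is in \<open>J\<close> from the start.\<close>

lemma ta_ideal_if_contains_square:
  assumes "ideal J R" "\<And>x y. \<lbrakk>x \<in> nonunits; y \<in> nonunits\<rbrakk> \<Longrightarrow> x \<otimes> y \<in> J"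
  shows "ta_ideal J R"
proof (rule ta_idealI[OF assms(1)])
  fix a b c assume c: "a \<in> carrier R" "b \<in> carrier R" "c \<in> carrier R" and J: "a \<otimes> b \<otimes> c \<in> J"
  have key: "z \<in> J" if h: "x \<in> Units R" "z \<in> carrier R" "x \<otimes> z \<in> J" for x z
  proof -
    have "z = inv x \<otimes> (x \<otimes> z)" using inv_mult_cancel h(1,2) by simp
    then show ?thesis using ideal.I_l_closed[OF assms(1) h(3), of "inv x"] h(1) by simp
  qed
  have "a \<otimes> b \<in> J \<or> a \<otimes> c \<in> J \<or> b \<otimes> c \<in> J" if "a \<in> Units R"
    using key[of a "b \<otimes> c"] that c J by (simp add: m_assoc)
  moreover have "a \<otimes> b \<in> J \<or> a \<otimes> c \<in> J \<or> b \<otimes> c \<in> J" if "b \<in> Units R"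
    using key[of b "a \<otimes> c"] that c J by (simp add: m_ac)
  moreover have "a \<otimes> b \<in> J" if "a \<notin> Units R" "b \<notin> Units R"
    using assms(2) that c by simp
  ultimately show "a \<otimes> b \<in> J \<or> a \<otimes> c \<in> J \<or> b \<otimes> c \<in> J" by auto
qed

end

section \<open>Length functions and TA-factorizations of local domains\<close>

lemma (in domain) nat_pow_nonzero: "\<lbrakk>x \<in> carrier R; x \<noteq> \<zero>\<rbrakk> \<Longrightarrow> x [^] (n::nat) \<noteq> \<zero>"
  by (induction n) (auto simp: integral_iff)

context local_domain
begin

text \<open>The conclusion demands that each factor contain all products of two nonunits, which is
  more than being 2-absorbing: after contraction to the global domain it also keeps the factors out
  of the other maximal ideals.\<close>

lemma length_function_factorization:
  assumes v: "length_function v" and I: "ideal I R" "I \<noteq> {\<zero>}" "I \<noteq> carrier R"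
  obtains Js where "Js \<noteq> []" "\<forall>J\<in>set Js. ideal J R \<and> J \<noteq> carrier R \<and> (\<forall>x\<in>nonunits. \<forall>y\<in>nonunits. x \<otimes> y \<in> J)"
    "I = iprod Js"
proof -
  note vD = length_functionD[OF v]
  obtain x where x: "x \<in> I" "x \<noteq> \<zero>" using I(2) ideal_zero[OF I(1)] by auto
  have Inon: "I \<subseteq> nonunits" using proper_ideal_subset_nonunits I by simp
  obtain a where a: "a \<in> I" "a \<noteq> \<zero>" and min: "\<And>b. \<lbrakk>b \<in> I; b \<noteq> \<zero>\<rbrakk> \<Longrightarrow> v a \<le> v b"
    using ex_has_least_nat[of "\<lambda>b. b \<in> I \<and> b \<noteq> \<zero>" x v] x by auto
  \<comment> \<open>Existence of an atom comes from minimality: in a product of two nonunits each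
    factor would be strictly shorter. The element \<open>x\<close> of \<open>I\<close> shows that
    there are candidates.\<close>
  obtain p where p: "p \<in> nonunits" "p \<noteq> \<zero>" and pmin: "\<And>b. \<lbrakk>b \<in> nonunits; b \<noteq> \<zero>\<rbrakk> \<Longrightarrow> v p \<le> v b"
    using ex_has_least_nat[of "\<lambda>b. b \<in> nonunits \<and> b \<noteq> \<zero>" x v] x Inon by auto
  have "atom R p"
  proof (rule atomI)
    fix c d assume cd: "c \<in> carrier R" "d \<in> carrier R" "p = c \<otimes> d"
    then have ne: "c \<noteq> \<zero>" "d \<noteq> \<zero>" using p by auto
    have "v p = v c + v d" using vD(1) cd ne by simp
    then show "c \<in> Units R \<or> d \<in> Units R"
      using pmin[of c] vD(3)[of d] cd ne by auto
  qed (use p in auto)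
  then have vp: "v p = 1" using vD(4) by simp
  have pc: "p \<in> carrier R" "\<And>n::nat. p [^] n \<in> carrier R" "\<And>n::nat. p [^] n \<noteq> \<zero>"
    using p nat_pow_nonzero by auto
  have vpow: "v (p [^] n) = n" for n :: nat
  proof (induction n)
    case 0
    then show ?case using vD(3)[of \<one>] by simp
  next
    case (Suc n)
    then show ?case using vD(1)[OF pc(2) pc(3) pc(1) p(2), of n] vp by simp
  qed
  have ac: "a \<in> carrier R" and aU: "a \<notin> Units R" using a Inon by auto
  \<comment> \<open>The exponent \<open>n\<close> is one below the least length on \<open>I\<close>:
    only then is \<open>p [^] n\<close> strictly shorter than every nonzero element of
    \<open>I\<close>, as divisibility requires.\<close>
  then obtain n where n: "v a = Suc n" using vD(3)[OF ac a(2)] by (cases "v a") auto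
  let ?q = "p [^] n"
  have div: "\<exists>c\<in>carrier R. b = ?q \<otimes> c" if "b \<in> I" for b
  proof (cases "b = \<zero>")
    case True
    then show ?thesis using pc by (intro bexI[of _ \<zero>]) auto
  next
    case False
    then show ?thesis using vD(2)[OF pc(2,3), of b n] vpow[of n] min[OF that] n that ideal_subset[OF I(1)] by auto
  qed
  \<comment> \<open>The quotient ideal of \<open>I\<close> by \<open>p [^] n\<close>. It is proper
    because \<open>p [^] n\<close> is too short to be in \<open>I\<close>, and it contains an
    element of length 1, namely the cofactor of \<open>a\<close>.\<close>
  define J where "J = {y \<in> carrier R. ?q \<otimes> y \<in> I}"
  have J: "ideal J R"
    unfolding J_def using ideal.helper_max_prime[OF I(1) is_cring] pc by simp
  have oneJ: "\<one> \<notin> J"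
  proof
    assume "\<one> \<in> J"
    then have "?q \<in> I" unfolding J_def using pc by simp
    then show False using min[OF _ pc(3), of n] vpow[of n] n by simp
  qed
  obtain y0 where y0: "y0 \<in> carrier R" "a = ?q \<otimes> y0" using div a by auto
  have y0n: "y0 \<noteq> \<zero>" using y0 a pc by auto
  have "v a = n + v y0" using y0 vD(1)[OF pc(2,3) y0(1) y0n, of n] vpow[of n] by simp
  then have vy0: "v y0 = 1" using n by simp
  have "y0 \<in> J" unfolding J_def using y0 a by auto
  \<comment> \<open>A nonzero product of two nonunits has length at least 2, so an element of length
    1 divides it. This applies to \<open>p\<close> in \<open>PIdl p\<close> and to \<open>y0\<close>
    in \<open>J\<close>.\<close>
  have PI: "y \<otimes> z \<in> K" if h: "ideal K R" "k \<in> K" "k \<noteq> \<zero>" "v k = 1" "y \<in> nonunits" "z \<in> nonunits" for K k y z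
  proof (cases "y \<otimes> z = \<zero>")
    case True
    then show ?thesis using ideal_zero h by simp
  next
    case False
    then have ne: "y \<noteq> \<zero>" "z \<noteq> \<zero>" using h by auto
    then have "v y \<noteq> 0" "v z \<noteq> 0" using vD(3) h by auto
    moreover have "v (y \<otimes> z) = v y + v z" using vD(1) h ne by simp
    ultimately have "v k < v (y \<otimes> z)" using h(4) by simp
    then obtain c where "c \<in> carrier R" "y \<otimes> z = k \<otimes> c"
      using vD(2)[of k "y \<otimes> z"] h False ideal.Icarr[OF h(1,2)] by auto
    then show ?thesis using ideal.I_r_closed[OF h(1,2)] by simp
  qed
  let ?Js = "replicate n (PIdl p) @ [J]"
  have pI: "ideal (PIdl p) R" using cgenideal_ideal pc by simp
  have rep: "iprod (replicate n (PIdl p)) = PIdl ?q"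
  proof (induction n)
    case 0
    then show ?case using PIdl_eq_carrier_iff[of \<one>] by simp
  next
    case (Suc n)
    then show ?case using PIdl_prod[OF pc(1) pc(2), of n] nat_pow_Suc2[OF pc(1), of n] by (simp del: foldr_replicate)
  qed
  have "iprod ?Js = ideal_prod R (PIdl ?q) J"
    using iprod_append[of "replicate n (PIdl p)" "[J]"] pI J rep ideal_prod_one[OF J] by (auto simp del: foldr_replicate foldr_append)
  also have "\<dots> = I"
  proof
    show "ideal_prod R (PIdl ?q) J \<subseteq> I"
    proof (rule ideal_prod_least[OF I(1)])
      fix i j assume "i \<in> PIdl ?q" "j \<in> J"
      then obtain c where "c \<in> carrier R" "i = c \<otimes> ?q" "j \<in> carrier R" "?q \<otimes> j \<in> I"
        unfolding PIdl_iff J_def by auto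
      then show "i \<otimes> j \<in> I" using ideal.I_l_closed[OF I(1)] pc by (simp add: m_assoc)
    qed
    show "I \<subseteq> ideal_prod R (PIdl ?q) J"
    proof
      fix b assume b: "b \<in> I"
      then obtain c where c: "c \<in> carrier R" "b = ?q \<otimes> c" using div by auto
      then have "c \<in> J" unfolding J_def using b by auto
      then show "b \<in> ideal_prod R (PIdl ?q) J"
        using c(2) ideal_prod.prod[OF cgenideal_self[OF pc(2)], of c J R n] by simp
    qed
  qed
  finally have "I = iprod ?Js" by simp
  moreover have "\<forall>K\<in>set ?Js. ideal K R \<and> K \<noteq> carrier R \<and> (\<forall>x\<in>nonunits. \<forall>y\<in>nonunits. x \<otimes> y \<in> K)"
    using pI J oneJ PI[OF J \<open>y0 \<in> J\<close> y0n vy0] PI[OF pI cgenideal_self[OF pc(1)] p(2) vp] PIdl_nonunit[OF p(1)]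
    by auto
  ultimately show ?thesis using that[of ?Js] by simp
qed

lemma length_function_taf:
  assumes v: "length_function v"
  shows "taf_domain R"
  unfolding taf_domain_def
proof (intro conjI allI impI)
  show "domain R" by (rule domain_axioms)
  fix I assume I: "ideal I R \<and> I \<noteq> carrier R"
  show "has_ta_factorization R I"
  proof (cases "I = {\<zero>}")
    case True
    have "ta_ideal I R"
      unfolding True by (rule ta_idealI[OF zeroideal]) (auto simp: integral_iff)
    then show ?thesis
      using I ideal_prod_one by (intro has_ta_factorizationI[of "[I]"]) auto
  next
    case False
    obtain Js where Js: "Js \<noteq> []" "\<forall>J\<in>set Js. ideal J R \<and> J \<noteq> carrier R \<and> (\<forall>x\<in>nonunits. \<forall>y\<in>nonunits. x \<otimes> y \<in> J)"
      "I = iprod Js"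
      using length_function_factorization[OF v _ False] I by blast
    then show ?thesis
      by (intro has_ta_factorizationI[of Js] ta_ideal_if_contains_square) auto
  qed
qed

text \<open>The factors of a nonzero principal ideal are principal, and their generators are
  \<open>good\<close>. A good element is an atom or a product of two atoms, and every atom is
  associated to a good element; the first fact gives atomicity, the second the divisibility.\<close>

lemma principal_ta_imp_length:
  assumes dim: "\<And>P. \<lbrakk>primeideal P R; P \<noteq> {\<zero>}\<rbrakk> \<Longrightarrow> P = nonunits"
    and ta: "\<And>a. \<lbrakk>a \<in> nonunits; a \<noteq> \<zero>\<rbrakk> \<Longrightarrow> has_ta_factorization R (PIdl a)"
  shows "atomic R" "atoms_divide_products"
proof -
  define good where "good x \<longleftrightarrow> x \<in> nonunits \<and> x \<noteq> \<zero> \<and>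
      (\<forall>y\<in>nonunits. \<forall>z\<in>nonunits. y \<otimes> z \<in> PIdl x)" for x
  \<comment> \<open>A prime minimal over \<open>PIdl x\<close> is nonzero, hence equal to
    \<open>nonunits\<close>. Since the elements outside it are units, every nonunit has a power in
    \<open>PIdl x\<close>.\<close>
  have good_ta: "good x" if x: "x \<in> nonunits" "x \<noteq> \<zero>" "ta_ideal (PIdl x) R" for x
  proof -
    have xc: "x \<in> carrier R" using x by simp
    obtain Q where Q: "primeideal Q R" "PIdl x \<subseteq> Q"
      "\<And>a. a \<in> Q \<Longrightarrow> \<exists>s\<in>carrier R - Q. \<exists>n::nat. s \<otimes> a [^] n \<in> PIdl x"
      using exists_minimal_prime_below[OF cgenideal_ideal[OF xc] cgenideal_minimal[OF nonunits_ideal x(1)] nonunits_prime]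
      by metis
    have "x \<in> Q" using Q(2) cgenideal_self xc by auto
    then have Qn: "Q = nonunits" using dim[OF Q(1)] x(2) by auto
    have rad: "\<exists>n::nat. y [^] n \<in> PIdl x" if y: "y \<in> nonunits" for y
    proof -
      obtain s and n :: nat where s: "s \<in> Units R" "s \<otimes> y [^] n \<in> PIdl x"
        using Q(3)[of y] Qn y by auto
      have "y [^] n = inv s \<otimes> (s \<otimes> y [^] n)" using inv_mult_cancel s(1) y by simp
      then have "y [^] n \<in> PIdl x"
        using ideal.I_l_closed[OF cgenideal_ideal[OF xc] s(2), of "inv s"] s(1) by simp
      then show ?thesis by auto
    qed
    have "y \<otimes> z \<in> PIdl x" if yz: "y \<in> nonunits" "z \<in> nonunits" for y z
    proof -
      obtain n m :: nat where "y [^] n \<in> PIdl x" "z [^] m \<in> PIdl x" using rad yz by blast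
      then show ?thesis using ta_ideal_radical_prod[OF x(3)] yz by auto
    qed
    then show ?thesis unfolding good_def using x by auto
  qed
  have prod: "\<exists>u xs. u \<in> Units R \<and> (\<forall>x\<in>set xs. good x) \<and> a = u \<otimes> fprod xs"
    if a: "a \<in> nonunits" "a \<noteq> \<zero>" for a
  proof -
    obtain Js where Js: "Js \<noteq> []" "\<forall>J\<in>set Js. ta_ideal J R \<and> ideal J R \<and> J \<noteq> carrier R" "PIdl a = iprod Js"
      using ta[OF a] by (elim has_ta_factorizationE)
    obtain xs where xs: "set xs \<subseteq> carrier R - {\<zero>}" "Js = map (\<lambda>x. PIdl x) xs"
      using iprod_principal_factors[of Js a] Js a by auto
    have "good x" if "x \<in> set xs" for x
    proof -
      have "ta_ideal (PIdl x) R" "PIdl x \<noteq> carrier R" "x \<in> carrier R" "x \<noteq> \<zero>"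
        using that xs Js by auto
      then show ?thesis using good_ta[of x] PIdl_eq_carrier_iff by auto
    qed
    moreover have "PIdl a = PIdl (fprod xs)" "fprod xs \<in> carrier R"
      using iprod_PIdl[of xs] xs Js(3) by auto
    then obtain u where "u \<in> Units R" "a = u \<otimes> fprod xs"
      using PIdl_eq_unit[of a "fprod xs"] a by auto
    ultimately show ?thesis by blast
  qed
  \<comment> \<open>If \<open>x = c \<otimes> d\<close> and \<open>c\<close> were a product of two
    nonunits, then \<open>x\<close> would divide \<open>c\<close>, which forces \<open>d\<close> to
    be a unit.\<close>
  have good_atoms: "\<exists>ps. (\<forall>p\<in>set ps. atom R p) \<and> x = fprod ps" if x: "good x" for x
  proof (cases "atom R x")
    case True
    then show ?thesis using atomD(1) by (intro exI[of _ "[x]"]) auto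
  next
    case False
    have xn: "x \<in> carrier R" "x \<noteq> \<zero>" "x \<notin> Units R" using x unfolding good_def by auto
    then obtain y z where yz: "y \<in> nonunits" "z \<in> nonunits" "x = y \<otimes> z"
      using False unfolding atom_iff by auto
    have fac: "atom R c" if h: "c \<in> nonunits" "d \<in> nonunits" "x = c \<otimes> d" for c d
    proof (rule atomI)
      show "c \<noteq> \<zero>" using h xn by auto
      fix e f assume ef: "e \<in> carrier R" "f \<in> carrier R" "c = e \<otimes> f"
      show "e \<in> Units R \<or> f \<in> Units R"
      proof (rule ccontr)
        assume "\<not> ?thesis"
        then have "e \<otimes> f \<in> PIdl x" using x ef unfolding good_def by auto
        then obtain t where t: "t \<in> carrier R" "c = t \<otimes> (c \<otimes> d)" using h(3) ef unfolding PIdl_iff by auto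
        then have "c \<otimes> (t \<otimes> d) = c \<otimes> \<one>" using h by (simp add: m_ac)
        then have "d \<otimes> t = \<one>" using m_comm[of t d] m_lcancel[OF \<open>c \<noteq> \<zero>\<close>, of "t \<otimes> d" \<one>] h t by simp
        then have "d \<in> Units R" using unit_divisor[of d t] h(2) t(1) by simp
        then show False using h by simp
      qed
    qed (use h in auto)
    have "\<forall>p\<in>set [y, z]. atom R p" using fac[of y z] fac[of z y] yz m_comm[of y z] by auto
    moreover have "x = fprod [y, z]" using yz by simp
    ultimately show ?thesis by blast
  qed
  have good_list: "\<exists>ps. (\<forall>p\<in>set ps. atom R p) \<and> fprod xs = fprod ps" if "\<forall>x\<in>set xs. good x" for xs
    using that
  proof (induction xs)
    case Nil
    then show ?case by (intro exI[of _ "[]"]) simp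
  next
    case (Cons x xs)
    then obtain ps qs where "\<forall>p\<in>set ps. atom R p" "x = fprod ps" "\<forall>p\<in>set qs. atom R p" "fprod xs = fprod qs"
      using good_atoms[of x] by auto
    then show ?case
      using fprod_append[of ps qs] atoms_subset[of ps] atoms_subset[of qs] by (intro exI[of _ "ps @ qs"]) auto
  qed
  show "atomic R"
    using prod good_list by (intro atomic_if_unit_multiple) (metis DiffI)
  show "atoms_divide_products"
    unfolding atoms_divide_products_def
  proof (intro allI impI)
    fix p y z assume p: "atom R p" and yz: "y \<in> nonunits" "z \<in> nonunits"
    note pD = atomD[OF p]
    obtain u xs where xs: "u \<in> Units R" "\<forall>x\<in>set xs. good x" "p = u \<otimes> fprod xs"
      using prod[of p] pD by auto
    \<comment> \<open>The atom \<open>p\<close> is a product with the nonunit \<open>x\<close> as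
      one factor, so the remaining factor is a unit and \<open>p\<close> is associated to
      \<open>x\<close>.\<close>
    obtain x xs' where x: "xs = x # xs'" using xs pD by (cases xs) auto
    have c: "x \<in> nonunits" "fprod xs' \<in> carrier R" "u \<in> carrier R"
      using xs x fprod_closed[of xs'] unfolding good_def by auto
    have p_eq: "p = x \<otimes> (u \<otimes> fprod xs')" using xs x c by (simp add: m_ac)
    then have U: "u \<otimes> fprod xs' \<in> Units R" using pD(4)[OF _ _ p_eq] c by auto
    have "y \<otimes> z \<in> PIdl x" using xs(2) x yz unfolding good_def by simp
    then obtain t where t: "t \<in> carrier R" "y \<otimes> z = t \<otimes> x" unfolding PIdl_iff by auto
    have "x = p \<otimes> inv (u \<otimes> fprod xs')" using p_eq U c by (simp add: m_assoc)
    then have "y \<otimes> z = p \<otimes> (inv (u \<otimes> fprod xs') \<otimes> t)"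
      using t U pD(1) by (simp add: m_ac)
    then show "p divides (y \<otimes> z)" unfolding factor_def using U t by auto
  qed
qed

end

section \<open>Localization of a domain\<close>

text \<open>Keeping zero out of \<open>S\<close> makes the auxiliary factor in
  \<open>loc_rel\<close> cancel, so that fractions are compared by plain
  cross-multiplication.\<close>

locale mult_set = domain +
  fixes S :: "'a set"
  assumes S_subset: "S \<subseteq> carrier R - {\<zero>}"
    and one_S: "\<one> \<in> S"
    and mult_S: "\<lbrakk>s \<in> S; t \<in> S\<rbrakk> \<Longrightarrow> s \<otimes> t \<in> S"
begin

lemma S_carrier: "s \<in> S \<Longrightarrow> s \<in> carrier R" and S_nonzero: "s \<in> S \<Longrightarrow> s \<noteq> \<zero>"
  using S_subset by auto

lemma loc_rel_iff:
  "((a, s), (b, t)) \<in> loc_rel R S \<longleftrightarrow>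
     a \<in> carrier R \<and> b \<in> carrier R \<and> s \<in> S \<and> t \<in> S \<and> a \<otimes> t = b \<otimes> s"
proof -
  have "u \<otimes> (a \<otimes> t) = u \<otimes> (b \<otimes> s) \<longleftrightarrow> a \<otimes> t = b \<otimes> s"
    if "u \<in> S" "a \<in> carrier R" "b \<in> carrier R" "s \<in> S" "t \<in> S" for u
    using that m_lcancel[of u "a \<otimes> t" "b \<otimes> s"] S_carrier S_nonzero by simp
  then show ?thesis
    unfolding loc_rel_def using one_S by auto
qed

lemma equiv_loc_rel: "equiv (carrier R \<times> S) (loc_rel R S)"
proof (rule equivI)
  show "loc_rel R S \<subseteq> (carrier R \<times> S) \<times> (carrier R \<times> S)"
    by (auto simp: loc_rel_iff)
  show "refl_on (carrier R \<times> S) (loc_rel R S)"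
    by (auto simp: refl_on_def loc_rel_iff)
  show "sym (loc_rel R S)"
    by (auto simp: sym_def loc_rel_iff)
  have key: "a \<otimes> w = c \<otimes> s"
    if h: "a \<in> carrier R" "b \<in> carrier R" "c \<in> carrier R" "s \<in> S" "t \<in> S" "w \<in> S"
      "a \<otimes> t = b \<otimes> s" "b \<otimes> w = c \<otimes> t" for a b c s t w
  proof -
    note cs = h(4-6)[THEN S_carrier]
    have "t \<otimes> (a \<otimes> w) = (a \<otimes> t) \<otimes> w" using h(1-3) cs by (simp add: m_ac)
    also have "\<dots> = (b \<otimes> w) \<otimes> s" using h(1-3) cs unfolding h(7) by (simp add: m_ac)
    also have "\<dots> = t \<otimes> (c \<otimes> s)" using h(1-3) cs unfolding h(8) by (simp add: m_ac)
    finally show ?thesis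
      using m_lcancel[of t "a \<otimes> w" "c \<otimes> s"] h(1-3) cs S_nonzero[OF h(5)] by simp
  qed
  show "trans (loc_rel R S)"
  proof (rule transI)
    fix x y z assume "(x, y) \<in> loc_rel R S" "(y, z) \<in> loc_rel R S"
    moreover obtain a s b t c w where "x = (a, s)" "y = (b, t)" "z = (c, w)"
      by (cases x, cases y, cases z)
    ultimately show "(x, z) \<in> loc_rel R S"
      using key[of a b c s t w] by (auto simp only: loc_rel_iff)
  qed
qed

lemma mem_fraction:
  "(b, t) \<in> fraction R S a s \<longleftrightarrow>
     a \<in> carrier R \<and> b \<in> carrier R \<and> s \<in> S \<and> t \<in> S \<and> a \<otimes> t = b \<otimes> s"
  unfolding fraction_def by (simp add: loc_rel_iff)

lemma fraction_eq_iff: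
  "\<lbrakk>a \<in> carrier R; b \<in> carrier R; s \<in> S; t \<in> S\<rbrakk>
    \<Longrightarrow> fraction R S a s = fraction R S b t \<longleftrightarrow> a \<otimes> t = b \<otimes> s"
  unfolding fraction_def using eq_equiv_class_iff[OF equiv_loc_rel, of "(a, s)" "(b, t)"]
  by (simp add: loc_rel_iff)

abbreviation L where "L \<equiv> localization R S"

lemma carrier_L: "x \<in> carrier L \<longleftrightarrow> (\<exists>a\<in>carrier R. \<exists>s\<in>S. x = fraction R S a s)"
  by (auto simp: localization_def fraction_def quotient_def)

lemma fraction_closed: "\<lbrakk>a \<in> carrier R; s \<in> S\<rbrakk> \<Longrightarrow> fraction R S a s \<in> carrier L"
  by (auto simp: carrier_L)

lemma mult_fraction:
  assumes "a \<in> carrier R" "b \<in> carrier R" "s \<in> S" "t \<in> S"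
  shows "fraction R S a s \<otimes>\<^bsub>L\<^esub> fraction R S b t = fraction R S (a \<otimes> b) (s \<otimes> t)"
proof -
  have *: "fraction R S (a' \<otimes> b') (s' \<otimes> t') = fraction R S (a \<otimes> b) (s \<otimes> t)"
    if h: "(a', s') \<in> fraction R S a s" "(b', t') \<in> fraction R S b t" for a' s' b' t'
  proof -
    have m: "a' \<in> carrier R" "b' \<in> carrier R" "s' \<in> S" "t' \<in> S" "a \<otimes> s' = a' \<otimes> s" "b \<otimes> t' = b' \<otimes> t"
      using h by (auto simp: mem_fraction)
    note c = assms(1,2) m(1,2) assms(3,4)[THEN S_carrier] m(3,4)[THEN S_carrier]
    have "(a' \<otimes> b') \<otimes> (s \<otimes> t) = (a' \<otimes> s) \<otimes> (b' \<otimes> t)" using c by (simp add: m_ac)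
    also have "\<dots> = (a \<otimes> s') \<otimes> (b \<otimes> t')" using m by simp
    also have "\<dots> = (a \<otimes> b) \<otimes> (s' \<otimes> t')" using c by (simp add: m_ac)
    finally show ?thesis
      using fraction_eq_iff[of "a' \<otimes> b'" "a \<otimes> b" "s' \<otimes> t'" "s \<otimes> t"] c assms m mult_S by simp
  qed
  have "(a, s) \<in> fraction R S a s" "(b, t) \<in> fraction R S b t"
    using assms by (auto simp: mem_fraction)
  then have "{fraction R S (a' \<otimes> b') (s' \<otimes> t') | a' s' b' t'.
      (a', s') \<in> fraction R S a s \<and> (b', t') \<in> fraction R S b t} = {fraction R S (a \<otimes> b) (s \<otimes> t)}"
    using * by blast
  then show ?thesis by (simp add: localization_def)
qed

lemma add_fraction:
  assumes "a \<in> carrier R" "b \<in> carrier R" "s \<in> S" "t \<in> S"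
  shows "fraction R S a s \<oplus>\<^bsub>L\<^esub> fraction R S b t = fraction R S (a \<otimes> t \<oplus> b \<otimes> s) (s \<otimes> t)"
proof -
  have *: "fraction R S (a' \<otimes> t' \<oplus> b' \<otimes> s') (s' \<otimes> t') = fraction R S (a \<otimes> t \<oplus> b \<otimes> s) (s \<otimes> t)"
    if h: "(a', s') \<in> fraction R S a s" "(b', t') \<in> fraction R S b t" for a' s' b' t'
  proof -
    have m: "a' \<in> carrier R" "b' \<in> carrier R" "s' \<in> S" "t' \<in> S" "a \<otimes> s' = a' \<otimes> s" "b \<otimes> t' = b' \<otimes> t"
      using h by (auto simp: mem_fraction)
    note c = assms(1,2) m(1,2) assms(3,4)[THEN S_carrier] m(3,4)[THEN S_carrier]
    have "(a' \<otimes> t' \<oplus> b' \<otimes> s') \<otimes> (s \<otimes> t) = (a' \<otimes> s) \<otimes> (t' \<otimes> t) \<oplus> (b' \<otimes> t) \<otimes> (s' \<otimes> s)"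
      using c by (simp add: m_ac l_distr r_distr)
    also have "\<dots> = (a \<otimes> s') \<otimes> (t' \<otimes> t) \<oplus> (b \<otimes> t') \<otimes> (s' \<otimes> s)" using m by simp
    also have "\<dots> = (a \<otimes> t \<oplus> b \<otimes> s) \<otimes> (s' \<otimes> t')" using c by (simp add: m_ac l_distr r_distr)
    finally show ?thesis
      using fraction_eq_iff[of "a' \<otimes> t' \<oplus> b' \<otimes> s'" "a \<otimes> t \<oplus> b \<otimes> s" "s' \<otimes> t'" "s \<otimes> t"] c assms m mult_S
      by simp
  qed
  have "(a, s) \<in> fraction R S a s" "(b, t) \<in> fraction R S b t"
    using assms by (auto simp: mem_fraction)
  then have "{fraction R S (a' \<otimes> t' \<oplus> b' \<otimes> s') (s' \<otimes> t') | a' s' b' t'.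
      (a', s') \<in> fraction R S a s \<and> (b', t') \<in> fraction R S b t}
      = {fraction R S (a \<otimes> t \<oplus> b \<otimes> s) (s \<otimes> t)}"
    using * by blast
  then show ?thesis by (simp add: localization_def)
qed

lemma one_L: "\<one>\<^bsub>L\<^esub> = fraction R S \<one> \<one>" and zero_L: "\<zero>\<^bsub>L\<^esub> = fraction R S \<zero> \<one>"
  by (simp_all add: localization_def)

lemma fraction_eqI:
  "\<lbrakk>a \<in> carrier R; b \<in> carrier R; s \<in> S; t \<in> S; a \<otimes> t = b \<otimes> s\<rbrakk>
    \<Longrightarrow> fraction R S a s = fraction R S b t"
  using fraction_eq_iff by simp

lemma fraction_eq_zero_iff:
  "\<lbrakk>a \<in> carrier R; s \<in> S\<rbrakk> \<Longrightarrow> fraction R S a s = \<zero>\<^bsub>L\<^esub> \<longleftrightarrow> a = \<zero>"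
  unfolding zero_L using fraction_eq_iff[of a \<zero> s \<one>] one_S S_carrier by simp

lemma domain_L: "domain L"
proof -
  have "abelian_group L"
  proof (rule abelian_groupI)
    fix x y assume "x \<in> carrier L" "y \<in> carrier L"
    then obtain a s b t where x: "a \<in> carrier R" "s \<in> S" "x = fraction R S a s"
      and y: "b \<in> carrier R" "t \<in> S" "y = fraction R S b t"
      unfolding carrier_L by auto
    note c = x(1) y(1) x(2)[THEN S_carrier] y(2)[THEN S_carrier]
    show "x \<oplus>\<^bsub>L\<^esub> y \<in> carrier L"
      using x y c mult_S by (simp add: add_fraction fraction_closed)
    show "x \<oplus>\<^bsub>L\<^esub> y = y \<oplus>\<^bsub>L\<^esub> x"
      using x y c by (simp add: add_fraction m_comm a_comm)
    fix z assume "z \<in> carrier L"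
    then obtain d w where z: "d \<in> carrier R" "w \<in> S" "z = fraction R S d w"
      unfolding carrier_L by auto
    note c = c z(1) z(2)[THEN S_carrier]
    show "x \<oplus>\<^bsub>L\<^esub> y \<oplus>\<^bsub>L\<^esub> z = x \<oplus>\<^bsub>L\<^esub> (y \<oplus>\<^bsub>L\<^esub> z)"
      using x y z c mult_S by (simp add: add_fraction) (simp add: l_distr r_distr m_ac a_ac)
  next
    show "\<zero>\<^bsub>L\<^esub> \<in> carrier L"
      using one_S by (simp add: zero_L fraction_closed)
    fix x assume "x \<in> carrier L"
    then obtain a s where x: "a \<in> carrier R" "s \<in> S" "x = fraction R S a s"
      unfolding carrier_L by auto
    note c = x(1) x(2)[THEN S_carrier]
    show "\<zero>\<^bsub>L\<^esub> \<oplus>\<^bsub>L\<^esub> x = x"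
      using x c one_S by (simp add: add_fraction zero_L)
    have "fraction R S (\<ominus> a) s \<oplus>\<^bsub>L\<^esub> x = fraction R S \<zero> (s \<otimes> s)"
      using x c by (simp add: add_fraction l_minus l_neg)
    also have "\<dots> = \<zero>\<^bsub>L\<^esub>"
      unfolding zero_L using x c one_S mult_S by (intro fraction_eqI) simp_all
    finally show "\<exists>y\<in>carrier L. y \<oplus>\<^bsub>L\<^esub> x = \<zero>\<^bsub>L\<^esub>"
      using x fraction_closed[of "\<ominus> a" s] by auto
  qed
  moreover have "comm_monoid L"
  proof (rule comm_monoidI)
    fix x y assume "x \<in> carrier L" "y \<in> carrier L"
    then obtain a s b t where x: "a \<in> carrier R" "s \<in> S" "x = fraction R S a s"
      and y: "b \<in> carrier R" "t \<in> S" "y = fraction R S b t"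
      unfolding carrier_L by auto
    note c = x(1) y(1) x(2)[THEN S_carrier] y(2)[THEN S_carrier]
    show "x \<otimes>\<^bsub>L\<^esub> y \<in> carrier L"
      using x y mult_S by (simp add: mult_fraction fraction_closed)
    show "x \<otimes>\<^bsub>L\<^esub> y = y \<otimes>\<^bsub>L\<^esub> x"
      using x y c by (simp add: mult_fraction m_comm)
    fix z assume "z \<in> carrier L"
    then obtain d w where z: "d \<in> carrier R" "w \<in> S" "z = fraction R S d w"
      unfolding carrier_L by auto
    note c = c z(1) z(2)[THEN S_carrier]
    show "x \<otimes>\<^bsub>L\<^esub> y \<otimes>\<^bsub>L\<^esub> z = x \<otimes>\<^bsub>L\<^esub> (y \<otimes>\<^bsub>L\<^esub> z)"
      using x y z c mult_S by (simp add: mult_fraction m_assoc)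
  next
    show "\<one>\<^bsub>L\<^esub> \<in> carrier L"
      using one_S by (simp add: one_L fraction_closed)
    fix x assume "x \<in> carrier L"
    then obtain a s where x: "a \<in> carrier R" "s \<in> S" "x = fraction R S a s"
      unfolding carrier_L by auto
    then show "\<one>\<^bsub>L\<^esub> \<otimes>\<^bsub>L\<^esub> x = x"
      using one_S S_carrier by (simp add: mult_fraction one_L)
  qed
  moreover have "(x \<oplus>\<^bsub>L\<^esub> y) \<otimes>\<^bsub>L\<^esub> z = x \<otimes>\<^bsub>L\<^esub> z \<oplus>\<^bsub>L\<^esub> y \<otimes>\<^bsub>L\<^esub> z"
    if xyz: "x \<in> carrier L" "y \<in> carrier L" "z \<in> carrier L" for x y z
  proof -
    obtain a s b t d w where x: "a \<in> carrier R" "s \<in> S" "x = fraction R S a s"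
      and y: "b \<in> carrier R" "t \<in> S" "y = fraction R S b t"
      and z: "d \<in> carrier R" "w \<in> S" "z = fraction R S d w"
      using xyz unfolding carrier_L by auto
    note c = x(1) y(1) z(1) x(2)[THEN S_carrier] y(2)[THEN S_carrier] z(2)[THEN S_carrier]
    have "(x \<oplus>\<^bsub>L\<^esub> y) \<otimes>\<^bsub>L\<^esub> z = fraction R S ((a \<otimes> t \<oplus> b \<otimes> s) \<otimes> d) (s \<otimes> t \<otimes> w)"
      using x y z c mult_S by (simp add: mult_fraction add_fraction)
    also have "\<dots> = fraction R S (a \<otimes> d \<otimes> (t \<otimes> w) \<oplus> b \<otimes> d \<otimes> (s \<otimes> w)) (s \<otimes> w \<otimes> (t \<otimes> w))"
      using x y z c mult_S by (intro fraction_eqI) (simp_all add: l_distr r_distr m_ac)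
    also have "\<dots> = x \<otimes>\<^bsub>L\<^esub> z \<oplus>\<^bsub>L\<^esub> y \<otimes>\<^bsub>L\<^esub> z"
      using x y z c mult_S by (simp add: mult_fraction add_fraction)
    finally show ?thesis .
  qed
  ultimately have "cring L" by (rule cringI)
  moreover have "\<one>\<^bsub>L\<^esub> \<noteq> \<zero>\<^bsub>L\<^esub>"
    unfolding one_L zero_L using fraction_eq_iff[of \<one> \<zero> \<one> \<one>] one_S by simp
  moreover have "x = \<zero>\<^bsub>L\<^esub> \<or> y = \<zero>\<^bsub>L\<^esub>"
    if xy: "x \<otimes>\<^bsub>L\<^esub> y = \<zero>\<^bsub>L\<^esub>" "x \<in> carrier L" "y \<in> carrier L" for x y
  proof -
    obtain a s b t where x: "a \<in> carrier R" "s \<in> S" "x = fraction R S a s"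
      and y: "b \<in> carrier R" "t \<in> S" "y = fraction R S b t"
      using xy unfolding carrier_L by auto
    then have "a \<otimes> b = \<zero>"
      using xy(1) mult_S fraction_eq_zero_iff[of "a \<otimes> b" "s \<otimes> t"] by (simp add: mult_fraction)
    then show ?thesis
      using x y fraction_eq_zero_iff integral[of a b] by auto
  qed
  ultimately show ?thesis
    by (simp add: domain_def domain_axioms_def)
qed

end

text \<open>Only the following properties of the localization \<open>D \<rightarrow> S\<inverse>D = E\<close> are used.\<close>

locale localization_map = D: domain D + E: domain E
  for D :: "('a, 'm) ring_scheme" (structure) and E :: "('b, 'n) ring_scheme"
    and S :: "'a set" and \<phi> :: "'a \<Rightarrow> 'b" +
  assumes S_subset: "S \<subseteq> carrier D"
    and one_S: "\<one> \<in> S"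
    and mult_S: "\<lbrakk>s \<in> S; t \<in> S\<rbrakk> \<Longrightarrow> s \<otimes> t \<in> S"
    and hom: "\<phi> \<in> ring_hom D E"
    and inj: "inj_on \<phi> (carrier D)"
    and units: "s \<in> S \<Longrightarrow> \<phi> s \<in> Units E"
    and surj: "x \<in> carrier E \<Longrightarrow> \<exists>a\<in>carrier D. \<exists>s\<in>S. x \<otimes>\<^bsub>E\<^esub> \<phi> s = \<phi> a"

lemma (in mult_set) localization_map: "localization_map R L S (\<lambda>a. fraction R S a \<one>)"
proof -
  interpret L: domain L by (rule domain_L)
  show ?thesis
  proof (unfold_locales)
    show "S \<subseteq> carrier R" "\<one> \<in> S" "\<And>s t. \<lbrakk>s \<in> S; t \<in> S\<rbrakk> \<Longrightarrow> s \<otimes> t \<in> S"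
      using S_subset one_S mult_S by auto
    show "(\<lambda>a. fraction R S a \<one>) \<in> ring_hom R L"
      using one_S by (intro ring_hom_memI) (simp_all add: fraction_closed mult_fraction add_fraction one_L)
    show "inj_on (\<lambda>a. fraction R S a \<one>) (carrier R)"
      using one_S by (auto simp: inj_on_def fraction_eq_iff)
    show "fraction R S s \<one> \<in> Units L" if s: "s \<in> S" for s
    proof -
      have "fraction R S s \<one> \<otimes>\<^bsub>L\<^esub> fraction R S \<one> s = \<one>\<^bsub>L\<^esub>"
        using s one_S S_carrier by (simp add: mult_fraction one_L fraction_eq_iff)
      then show ?thesis
        using s one_S S_carrier L.unit_factor[of "fraction R S s \<one>" "fraction R S \<one> s"]
        by (simp add: fraction_closed)
    qed
    fix x assume "x \<in> carrier L"
    then obtain a s where x: "a \<in> carrier R" "s \<in> S" "x = fraction R S a s"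
      unfolding carrier_L by auto
    then have "x \<otimes>\<^bsub>L\<^esub> fraction R S s \<one> = fraction R S a \<one>"
      using one_S S_carrier by (simp add: mult_fraction fraction_eq_iff)
    then show "\<exists>a\<in>carrier R. \<exists>s\<in>S. x \<otimes>\<^bsub>L\<^esub> fraction R S s \<one> = fraction R S a \<one>"
      using x by auto
  qed
qed

section \<open>Extension and contraction of ideals\<close>

context localization_map
begin

text \<open>The extended ideal \<open>I E\<close>. A common denominator can always be found, so
  single fractions suffice, and clearing it avoids inverses in \<open>E\<close>.\<close>

definition ext :: "'a set \<Rightarrow> 'b set" where
  "ext I = {x \<in> carrier E. \<exists>a\<in>I. \<exists>s\<in>S. x \<otimes>\<^bsub>E\<^esub> \<phi> s = \<phi> a}"

definition contr :: "'b set \<Rightarrow> 'a set" where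
  "contr K = {a \<in> carrier D. \<phi> a \<in> K}"

lemma S_carrier: "s \<in> S \<Longrightarrow> s \<in> carrier D"
  using S_subset by auto

lemma phi_closed [simp]: "a \<in> carrier D \<Longrightarrow> \<phi> a \<in> carrier E"
  using hom by (rule ring_hom_closed)

lemma phi_mult: "\<lbrakk>a \<in> carrier D; b \<in> carrier D\<rbrakk> \<Longrightarrow> \<phi> (a \<otimes> b) = \<phi> a \<otimes>\<^bsub>E\<^esub> \<phi> b"
  using hom by (rule ring_hom_mult)

lemma phi_add: "\<lbrakk>a \<in> carrier D; b \<in> carrier D\<rbrakk> \<Longrightarrow> \<phi> (a \<oplus> b) = \<phi> a \<oplus>\<^bsub>E\<^esub> \<phi> b"
  using hom by (rule ring_hom_add)

lemma phi_one: "\<phi> \<one> = \<one>\<^bsub>E\<^esub>"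
  using hom by (rule ring_hom_one)

lemma phi_zero: "\<phi> \<zero> = \<zero>\<^bsub>E\<^esub>"
  using ring_hom_zero[OF hom D.ring_axioms E.ring_axioms] .

lemma phi_minus: "a \<in> carrier D \<Longrightarrow> \<phi> (\<ominus> a) = \<ominus>\<^bsub>E\<^esub> \<phi> a"
  using E.minus_equality[of "\<phi> (\<ominus> a)" "\<phi> a"] phi_add[of "\<ominus> a" a] phi_zero by (simp add: D.l_neg)

lemma phi_pow: "a \<in> carrier D \<Longrightarrow> \<phi> (a [^] (n::nat)) = \<phi> a [^]\<^bsub>E\<^esub> n"
  by (induction n) (simp_all add: phi_one phi_mult)

lemma phi_eq_iff: "\<lbrakk>a \<in> carrier D; b \<in> carrier D\<rbrakk> \<Longrightarrow> \<phi> a = \<phi> b \<longleftrightarrow> a = b"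
  using inj by (auto simp: inj_on_def)

lemma phi_S: "s \<in> S \<Longrightarrow> \<phi> s \<in> carrier E" "s \<in> S \<Longrightarrow> \<phi> s \<noteq> \<zero>\<^bsub>E\<^esub>"
  using units[of s] E.Units_nonzero[of "\<phi> s"] by auto

lemma surjE:
  assumes "x \<in> carrier E"
  obtains a s where "a \<in> carrier D" "s \<in> S" "x \<otimes>\<^bsub>E\<^esub> \<phi> s = \<phi> a"
  using surj[OF assms] by auto

lemma cancel_S:
  assumes "x \<in> carrier E" "y \<in> carrier E" "s \<in> S" "x \<otimes>\<^bsub>E\<^esub> \<phi> s = y \<otimes>\<^bsub>E\<^esub> \<phi> s"
  shows "x = y"
  using E.m_rcancel[of "\<phi> s" x y] phi_S[OF assms(3)] assms by simp

lemma ideal_cancel_unit: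
  assumes "ideal K E" "x \<in> carrier E" "u \<in> Units E" "x \<otimes>\<^bsub>E\<^esub> u \<in> K"
  shows "x \<in> K"
proof -
  have "x = x \<otimes>\<^bsub>E\<^esub> u \<otimes>\<^bsub>E\<^esub> inv\<^bsub>E\<^esub> u"
    using assms(2,3) by (simp add: E.m_assoc E.Units_closed)
  then show ?thesis
    using ideal.I_r_closed[OF assms(1,4), of "inv\<^bsub>E\<^esub> u"] assms(3) by simp
qed

lemma extI: "\<lbrakk>x \<in> carrier E; a \<in> I; s \<in> S; x \<otimes>\<^bsub>E\<^esub> \<phi> s = \<phi> a\<rbrakk> \<Longrightarrow> x \<in> ext I"
  unfolding ext_def by blast

lemma extE:
  assumes "x \<in> ext I" obtains a s where "x \<in> carrier E" "a \<in> I" "s \<in> S" "x \<otimes>\<^bsub>E\<^esub> \<phi> s = \<phi> a"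
  using assms unfolding ext_def by blast

lemma phi_ext: "\<lbrakk>a \<in> I; I \<subseteq> carrier D\<rbrakk> \<Longrightarrow> \<phi> a \<in> ext I"
  using one_S phi_one by (intro extI[of _ a I \<one>]) auto

lemma ext_mono: "I \<subseteq> J \<Longrightarrow> ext I \<subseteq> ext J"
  unfolding ext_def by blast

lemma ext_ideal:
  assumes I: "ideal I D"
  shows "ideal (ext I) E"
proof (rule E.ideal_criterion)
  note Ic = ideal.Icarr[OF I]
  show "ext I \<subseteq> carrier E" by (auto simp: ext_def)
  show "\<zero>\<^bsub>E\<^esub> \<in> ext I"
    using phi_ext[OF D.ideal_zero[OF I] D.ideal_subset[OF I]] phi_zero by simp
  fix x assume "x \<in> ext I"
  then obtain a s where x: "x \<in> carrier E" "a \<in> I" "s \<in> S" "x \<otimes>\<^bsub>E\<^esub> \<phi> s = \<phi> a"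
    by (rule extE)
  note c = x(1) Ic[OF x(2)] S_carrier[OF x(3)]
  {
    fix y assume "y \<in> ext I"
    then obtain b t where y: "y \<in> carrier E" "b \<in> I" "t \<in> S" "y \<otimes>\<^bsub>E\<^esub> \<phi> t = \<phi> b"
      by (rule extE)
    note c = c y(1) Ic[OF y(2)] S_carrier[OF y(3)]
    have "(x \<oplus>\<^bsub>E\<^esub> y) \<otimes>\<^bsub>E\<^esub> \<phi> (s \<otimes> t)
        = (x \<otimes>\<^bsub>E\<^esub> \<phi> s) \<otimes>\<^bsub>E\<^esub> \<phi> t \<oplus>\<^bsub>E\<^esub> (y \<otimes>\<^bsub>E\<^esub> \<phi> t) \<otimes>\<^bsub>E\<^esub> \<phi> s"
      using c by (simp add: phi_mult E.l_distr E.r_distr E.m_ac)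
    also have "\<dots> = \<phi> (a \<otimes> t \<oplus> b \<otimes> s)"
      unfolding x(4) y(4) using c by (simp add: phi_mult phi_add)
    finally show "x \<oplus>\<^bsub>E\<^esub> y \<in> ext I"
      using c x y mult_S I
      by (intro extI[of _ "a \<otimes> t \<oplus> b \<otimes> s" I "s \<otimes> t"]) (simp_all add: D.ideal_add ideal.I_r_closed)
  }
  fix r assume r: "r \<in> carrier E"
  then obtain b t where b: "b \<in> carrier D" "t \<in> S" "r \<otimes>\<^bsub>E\<^esub> \<phi> t = \<phi> b"
    by (rule surjE)
  note c = c r b(1) S_carrier[OF b(2)]
  have "(r \<otimes>\<^bsub>E\<^esub> x) \<otimes>\<^bsub>E\<^esub> \<phi> (t \<otimes> s) = (r \<otimes>\<^bsub>E\<^esub> \<phi> t) \<otimes>\<^bsub>E\<^esub> (x \<otimes>\<^bsub>E\<^esub> \<phi> s)"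
    using c by (simp add: phi_mult E.m_ac)
  also have "\<dots> = \<phi> (b \<otimes> a)"
    unfolding x(4) b(3) using c by (simp add: phi_mult)
  finally show "r \<otimes>\<^bsub>E\<^esub> x \<in> ext I"
    using c x b mult_S I by (intro extI[of _ "b \<otimes> a" I "t \<otimes> s"]) (simp_all add: ideal.I_l_closed)
qed

text \<open>The way back to \<open>D\<close>: by injectivity of \<open>\<phi>\<close>, local
  membership becomes a condition on elements of \<open>D\<close> alone, in the form that the
  local-global principle for ideals takes as input.\<close>

lemma phi_mem_ext:
  assumes I: "ideal I D" and a: "a \<in> carrier D"
  shows "\<phi> a \<in> ext I \<longleftrightarrow> (\<exists>s\<in>S. s \<otimes> a \<in> I)"
proof
  assume "\<phi> a \<in> ext I"
  then obtain b s where b: "b \<in> I" "s \<in> S" "\<phi> a \<otimes>\<^bsub>E\<^esub> \<phi> s = \<phi> b"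
    by (rule extE)
  have "\<phi> (a \<otimes> s) = \<phi> b"
    using b a S_carrier by (simp add: phi_mult)
  then have "s \<otimes> a = b"
    using phi_eq_iff[of "a \<otimes> s" b] a S_carrier[OF b(2)] ideal.Icarr[OF I b(1)] D.m_comm[of a s] by simp
  with b show "\<exists>s\<in>S. s \<otimes> a \<in> I" by auto
next
  assume "\<exists>s\<in>S. s \<otimes> a \<in> I"
  then obtain s where s: "s \<in> S" "s \<otimes> a \<in> I" by auto
  then show "\<phi> a \<in> ext I"
    using a S_carrier[OF s(1)] E.m_comm by (intro extI[of _ "s \<otimes> a" I s]) (simp_all add: phi_mult)
qed

lemma mem_ext_iff:
  assumes "ideal I D" "x \<in> carrier E" "s \<in> S" "x \<otimes>\<^bsub>E\<^esub> \<phi> s = \<phi> a" "a \<in> carrier D"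
  shows "x \<in> ext I \<longleftrightarrow> \<phi> a \<in> ext I"
  using ideal.I_r_closed[OF ext_ideal[OF assms(1)], of x "\<phi> s"]
    ideal_cancel_unit[OF ext_ideal[OF assms(1)] assms(2) units[OF assms(3)]] assms(4) phi_S[OF assms(3)]
  by auto

lemma ext_proper_iff:
  assumes "ideal I D"
  shows "ext I \<noteq> carrier E \<longleftrightarrow> S \<inter> I = {}"
proof -
  have "ext I \<noteq> carrier E \<longleftrightarrow> \<phi> \<one> \<notin> ext I"
    using E.ideal_proper_iff[OF ext_ideal[OF assms]] phi_one by simp
  also have "\<dots> \<longleftrightarrow> S \<inter> I = {}"
    using phi_mem_ext[OF assms D.one_closed] S_carrier by auto
  finally show ?thesis .
qed

lemma contr_ideal:
  assumes "ideal K E"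
  shows "ideal (contr K) D"
  using assms
  by (intro D.ideal_criterion)
    (auto simp: contr_def phi_zero phi_add phi_mult E.ideal_zero E.ideal_add ideal.I_l_closed)

lemma ext_contr:
  assumes K: "ideal K E"
  shows "ext (contr K) = K"
proof
  show "ext (contr K) \<subseteq> K"
  proof
    fix x assume "x \<in> ext (contr K)"
    then obtain a s where x: "x \<in> carrier E" "a \<in> contr K" "s \<in> S" "x \<otimes>\<^bsub>E\<^esub> \<phi> s = \<phi> a"
      by (rule extE)
    then show "x \<in> K"
      using ideal_cancel_unit[OF K x(1) units[OF x(3)]] by (auto simp: contr_def)
  qed
  show "K \<subseteq> ext (contr K)"
  proof
    fix x assume x: "x \<in> K"
    then have xc: "x \<in> carrier E" using ideal.Icarr[OF K] by simp
    then obtain a s where a: "a \<in> carrier D" "s \<in> S" "x \<otimes>\<^bsub>E\<^esub> \<phi> s = \<phi> a"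
      by (rule surjE)
    have "\<phi> a \<in> K" using ideal.I_r_closed[OF K x phi_S(1)[OF a(2)]] a(3) by simp
    then show "x \<in> ext (contr K)"
      using a xc by (intro extI[of _ a _ s]) (auto simp: contr_def)
  qed
qed

lemma contr_proper: "ideal K E \<Longrightarrow> K \<noteq> carrier E \<Longrightarrow> contr K \<noteq> carrier D"
  using E.ideal_proper_iff D.ideal_proper_iff contr_ideal phi_one by (auto simp: contr_def)

lemma ext_prod:
  assumes I: "ideal I D" and J: "ideal J D"
  shows "ext (ideal_prod D I J) = ideal_prod E (ext I) (ext J)"
proof
  have IJ: "ideal (ideal_prod E (ext I) (ext J)) E"
    using E.ideal_prod_is_ideal ext_ideal I J by simp
  have *: "\<phi> a \<in> ideal_prod E (ext I) (ext J)" if "a \<in> ideal_prod D I J" for a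
    using that
  proof induction
    case (prod i j)
    then show ?case
      using ideal_prod.prod[of "\<phi> i" "ext I" "\<phi> j" "ext J" E] ideal.Icarr[OF I] ideal.Icarr[OF J]
        phi_ext[of i I] phi_ext[of j J] D.ideal_subset[OF I] D.ideal_subset[OF J]
      by (simp add: phi_mult)
  next
    case (sum x y)
    then show ?case
      using D.ideal_prod_in_carrier[OF I J] by (simp add: phi_add subset_iff E.ideal_add[OF IJ])
  qed
  show "ext (ideal_prod D I J) \<subseteq> ideal_prod E (ext I) (ext J)"
  proof
    fix x assume "x \<in> ext (ideal_prod D I J)"
    then obtain a s where x: "x \<in> carrier E" "a \<in> ideal_prod D I J" "s \<in> S" "x \<otimes>\<^bsub>E\<^esub> \<phi> s = \<phi> a"
      by (rule extE)
    then show "x \<in> ideal_prod E (ext I) (ext J)"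
      using ideal_cancel_unit[OF IJ x(1) units[OF x(3)]] * by simp
  qed
  show "ideal_prod E (ext I) (ext J) \<subseteq> ext (ideal_prod D I J)"
  proof (rule E.ideal_prod_least)
    show "ideal (ext (ideal_prod D I J)) E"
      using ext_ideal D.ideal_prod_is_ideal I J by simp
    fix x y assume "x \<in> ext I" "y \<in> ext J"
    then obtain a s b t where x: "x \<in> carrier E" "a \<in> I" "s \<in> S" "x \<otimes>\<^bsub>E\<^esub> \<phi> s = \<phi> a"
      and y: "y \<in> carrier E" "b \<in> J" "t \<in> S" "y \<otimes>\<^bsub>E\<^esub> \<phi> t = \<phi> b"
      by (elim extE)
    note c = x(1) y(1) S_carrier[OF x(3)] S_carrier[OF y(3)] ideal.Icarr[OF I x(2)] ideal.Icarr[OF J y(2)]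
    have "(x \<otimes>\<^bsub>E\<^esub> y) \<otimes>\<^bsub>E\<^esub> \<phi> (s \<otimes> t) = (x \<otimes>\<^bsub>E\<^esub> \<phi> s) \<otimes>\<^bsub>E\<^esub> (y \<otimes>\<^bsub>E\<^esub> \<phi> t)"
      using c by (simp add: phi_mult E.m_ac)
    also have "\<dots> = \<phi> (a \<otimes> b)"
      unfolding x(4) y(4) using c by (simp add: phi_mult)
    finally show "x \<otimes>\<^bsub>E\<^esub> y \<in> ext (ideal_prod D I J)"
      using c x y mult_S by (intro extI[of _ "a \<otimes> b" _ "s \<otimes> t"] ideal_prod.prod) simp_all
  qed
qed

lemma ext_carrier: "ext (carrier D) = carrier E"
  using ext_proper_iff[OF D.oneideal] one_S S_carrier by auto

lemma ext_iprod:
  "(\<And>J. J \<in> set Js \<Longrightarrow> ideal J D) \<Longrightarrow> ext (D.iprod Js) = E.iprod (map ext Js)"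
proof (induction Js)
  case Nil
  then show ?case by (simp add: ext_carrier)
next
  case (Cons J Js)
  then show ?case using ext_prod[of J "D.iprod Js"] D.iprod_ideal[of Js] by simp
qed

lemma ext_PIdl:
  assumes a: "a \<in> carrier D"
  shows "ext (PIdl a) = PIdl\<^bsub>E\<^esub> (\<phi> a)"
proof
  have K: "ideal (PIdl\<^bsub>E\<^esub> (\<phi> a)) E" using E.cgenideal_ideal a by simp
  show "ext (PIdl a) \<subseteq> PIdl\<^bsub>E\<^esub> (\<phi> a)"
  proof
    fix x assume "x \<in> ext (PIdl a)"
    then obtain b s where x: "x \<in> carrier E" "b \<in> PIdl a" "s \<in> S" "x \<otimes>\<^bsub>E\<^esub> \<phi> s = \<phi> b"
      by (rule extE)
    then obtain c where c: "c \<in> carrier D" "b = c \<otimes> a" unfolding D.PIdl_iff by auto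
    then have "\<phi> b = \<phi> c \<otimes>\<^bsub>E\<^esub> \<phi> a" using a by (simp add: phi_mult)
    then have "\<phi> b \<in> PIdl\<^bsub>E\<^esub> (\<phi> a)" unfolding E.PIdl_iff using c(1) by auto
    then show "x \<in> PIdl\<^bsub>E\<^esub> (\<phi> a)"
      using ideal_cancel_unit[OF K x(1) units[OF x(3)]] x(4) by simp
  qed
  show "PIdl\<^bsub>E\<^esub> (\<phi> a) \<subseteq> ext (PIdl a)"
    using E.cgenideal_minimal[OF ext_ideal[OF D.cgenideal_ideal[OF a]]]
      phi_ext[OF D.cgenideal_self[OF a] D.ideal_subset[OF D.cgenideal_ideal[OF a]]] by simp
qed

section \<open>Two-absorbing ideals, primes and TA-factorizations under localization\<close>

lemma ta_contr:
  assumes "ta_ideal K E"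
  shows "ta_ideal (contr K) D"
proof (rule D.ta_idealI)
  show "ideal (contr K) D" using contr_ideal E.ta_idealD(1)[OF assms] by simp
  fix a b c assume "a \<in> carrier D" "b \<in> carrier D" "c \<in> carrier D" "a \<otimes> b \<otimes> c \<in> contr K"
  then show "a \<otimes> b \<in> contr K \<or> a \<otimes> c \<in> contr K \<or> b \<otimes> c \<in> contr K"
    using E.ta_idealD(2)[OF assms, of "\<phi> a" "\<phi> b" "\<phi> c"] by (simp add: contr_def phi_mult)
qed

text \<open>Clearing denominators leaves a multiplier \<open>r\<close> in \<open>S\<close> with
  \<open>r \<otimes> (a \<otimes> b \<otimes> c)\<close> in \<open>J\<close>. It is merged with
  \<open>a\<close>, so that the 2-absorbing property can be applied to \<open>r \<otimes> a\<close>,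
  \<open>b\<close>, \<open>c\<close>; afterwards it is a unit in \<open>E\<close>.\<close>

lemma ta_ext:
  assumes J: "ta_ideal J D"
  shows "ta_ideal (ext J) E"
proof (rule E.ta_idealI)
  note iJ = D.ta_idealD(1)[OF J]
  show iE: "ideal (ext J) E" using ext_ideal iJ by simp
  fix x y z assume xyz: "x \<in> carrier E" "y \<in> carrier E" "z \<in> carrier E" "x \<otimes>\<^bsub>E\<^esub> y \<otimes>\<^bsub>E\<^esub> z \<in> ext J"
  obtain a s where a: "a \<in> carrier D" "s \<in> S" "x \<otimes>\<^bsub>E\<^esub> \<phi> s = \<phi> a" using surjE[OF xyz(1)] .
  obtain b t where b: "b \<in> carrier D" "t \<in> S" "y \<otimes>\<^bsub>E\<^esub> \<phi> t = \<phi> b" using surjE[OF xyz(2)] .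
  obtain c w where c: "c \<in> carrier D" "w \<in> S" "z \<otimes>\<^bsub>E\<^esub> \<phi> w = \<phi> c" using surjE[OF xyz(3)] .
  note cs = xyz(1-3) a(1) b(1) c(1) a(2)[THEN S_carrier] b(2)[THEN S_carrier] c(2)[THEN S_carrier]
  have two: "p \<otimes>\<^bsub>E\<^esub> q \<in> ext J"
    if h: "p \<in> carrier E" "q \<in> carrier E" "d \<in> carrier D" "e \<in> carrier D" "u \<in> S" "v \<in> S"
      "p \<otimes>\<^bsub>E\<^esub> \<phi> u = \<phi> d" "q \<otimes>\<^bsub>E\<^esub> \<phi> v = \<phi> e" "\<phi> (d \<otimes> e) \<in> ext J" for p q d e u v
  proof -
    have "(p \<otimes>\<^bsub>E\<^esub> q) \<otimes>\<^bsub>E\<^esub> \<phi> (u \<otimes> v) = (p \<otimes>\<^bsub>E\<^esub> \<phi> u) \<otimes>\<^bsub>E\<^esub> (q \<otimes>\<^bsub>E\<^esub> \<phi> v)"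
      using h(1-4) h(5,6)[THEN S_carrier] by (simp add: phi_mult E.m_ac)
    also have "\<dots> = \<phi> (d \<otimes> e)" unfolding h(7,8) using h(3,4) by (simp add: phi_mult)
    finally show ?thesis
      using mem_ext_iff[OF iJ, of "p \<otimes>\<^bsub>E\<^esub> q" "u \<otimes> v" "d \<otimes> e"] h(1-6,9) mult_S by simp
  qed
  have "\<phi> (a \<otimes> b \<otimes> c) = (x \<otimes>\<^bsub>E\<^esub> y \<otimes>\<^bsub>E\<^esub> z) \<otimes>\<^bsub>E\<^esub> (\<phi> s \<otimes>\<^bsub>E\<^esub> \<phi> t \<otimes>\<^bsub>E\<^esub> \<phi> w)"
    using cs a(3)[symmetric] b(3)[symmetric] c(3)[symmetric] by (simp add: phi_mult E.m_ac)
  then have "\<phi> (a \<otimes> b \<otimes> c) \<in> ext J"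
    using ideal.I_r_closed[OF iE xyz(4)] cs by simp
  then obtain r where r: "r \<in> S" "r \<otimes> (a \<otimes> b \<otimes> c) \<in> J"
    using phi_mem_ext[OF iJ] cs by auto
  have rc: "r \<in> carrier D" using r S_carrier by simp
  have one: "\<phi> d \<in> ext J" if "d \<in> carrier D" "r \<otimes> d \<in> J" for d
    using phi_mem_ext[OF iJ that(1)] r(1) that(2) by auto
  have "(r \<otimes> a) \<otimes> b \<otimes> c \<in> J" using r(2) rc cs by (simp add: D.m_assoc)
  then consider "r \<otimes> (a \<otimes> b) \<in> J" | "r \<otimes> (a \<otimes> c) \<in> J" | "b \<otimes> c \<in> J"
    using D.ta_idealD(2)[OF J, of "r \<otimes> a" b c] rc cs by (auto simp: D.m_assoc)
  then show "x \<otimes>\<^bsub>E\<^esub> y \<in> ext J \<or> x \<otimes>\<^bsub>E\<^esub> z \<in> ext J \<or> y \<otimes>\<^bsub>E\<^esub> z \<in> ext J"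
  proof cases
    case 1
    then have "x \<otimes>\<^bsub>E\<^esub> y \<in> ext J"
      using two[OF xyz(1,2) a(1) b(1) a(2) b(2) a(3) b(3)] one[of "a \<otimes> b"] cs by simp
    then show ?thesis by simp
  next
    case 2
    then have "x \<otimes>\<^bsub>E\<^esub> z \<in> ext J"
      using two[OF xyz(1,3) a(1) c(1) a(2) c(2) a(3) c(3)] one[of "a \<otimes> c"] cs by simp
    then show ?thesis by simp
  next
    case 3
    then have "\<phi> (b \<otimes> c) \<in> ext J"
      using phi_ext[of "b \<otimes> c" J] D.ideal_subset[OF iJ] by simp
    then have "y \<otimes>\<^bsub>E\<^esub> z \<in> ext J"
      using two[OF xyz(2,3) b(1) c(1) b(2) c(2) b(3) c(3)] by simp
    then show ?thesis by simp
  qed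
qed

lemma prime_contr:
  assumes P: "primeideal P E"
  shows "primeideal (contr P) D"
proof (rule primeidealI)
  note iP = primeideal.axioms(1)[OF P]
  show "ideal (contr P) D" using contr_ideal iP by simp
  show "cring D" by (rule D.is_cring)
  show "carrier D \<noteq> contr P" using contr_proper[OF iP] primeideal.I_notcarr[OF P] by auto
  show "a \<in> contr P \<or> b \<in> contr P" if "a \<in> carrier D" "b \<in> carrier D" "a \<otimes> b \<in> contr P" for a b
    using primeideal.I_prime[OF P, of "\<phi> a" "\<phi> b"] that by (auto simp: contr_def phi_mult)
qed

lemma prime_phi_mem_ext:
  assumes P: "primeideal P D" "P \<inter> S = {}" and a: "a \<in> carrier D"
  shows "\<phi> a \<in> ext P \<longleftrightarrow> a \<in> P"
proof
  assume "\<phi> a \<in> ext P"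
  then obtain s where s: "s \<in> S" "s \<otimes> a \<in> P"
    using phi_mem_ext[OF primeideal.axioms(1)[OF P(1)] a] by auto
  then show "a \<in> P" using primeideal.I_prime[OF P(1), of s a] P(2) a S_carrier by auto
next
  assume "a \<in> P"
  then show "\<phi> a \<in> ext P" using phi_ext D.ideal_subset primeideal.axioms(1)[OF P(1)] by simp
qed

lemma prime_ext:
  assumes P: "primeideal P D" "P \<inter> S = {}"
  shows "primeideal (ext P) E"
proof (rule primeidealI)
  note iP = primeideal.axioms(1)[OF P(1)]
  show "ideal (ext P) E" using ext_ideal iP by simp
  show "cring E" by (rule E.is_cring)
  show "carrier E \<noteq> ext P" using ext_proper_iff[OF iP] P(2) by auto
  fix x y assume xy: "x \<in> carrier E" "y \<in> carrier E" "x \<otimes>\<^bsub>E\<^esub> y \<in> ext P"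
  obtain a s where a: "a \<in> carrier D" "s \<in> S" "x \<otimes>\<^bsub>E\<^esub> \<phi> s = \<phi> a" using surjE[OF xy(1)] .
  obtain b t where b: "b \<in> carrier D" "t \<in> S" "y \<otimes>\<^bsub>E\<^esub> \<phi> t = \<phi> b" using surjE[OF xy(2)] .
  note cs = xy(1-2) a(1) b(1) a(2)[THEN S_carrier] b(2)[THEN S_carrier]
  have "\<phi> (a \<otimes> b) = (x \<otimes>\<^bsub>E\<^esub> y) \<otimes>\<^bsub>E\<^esub> (\<phi> s \<otimes>\<^bsub>E\<^esub> \<phi> t)"
    using cs a(3)[symmetric] b(3)[symmetric] by (simp add: phi_mult E.m_ac)
  then have "\<phi> (a \<otimes> b) \<in> ext P"
    using ideal.I_r_closed[OF ext_ideal[OF iP] xy(3)] cs by simp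
  then have "a \<otimes> b \<in> P" using prime_phi_mem_ext[OF P] cs by simp
  then have "\<phi> a \<in> ext P \<or> \<phi> b \<in> ext P"
    using primeideal.I_prime[OF P(1)] cs prime_phi_mem_ext[OF P] by auto
  then show "x \<in> ext P \<or> y \<in> ext P"
    using mem_ext_iff[OF iP xy(1) a(2,3,1)] mem_ext_iff[OF iP xy(2) b(2,3,1)] by auto
qed

text \<open>Factors that meet \<open>S\<close> extend to the unit ideal and are dropped. At least
  one survives because \<open>ext I\<close> is proper.\<close>

lemma has_ta_factorization_ext:
  assumes "has_ta_factorization D I" "ext I \<noteq> carrier E"
  shows "has_ta_factorization E (ext I)"
proof -
  obtain Js where Js: "\<forall>J\<in>set Js. ta_ideal J D \<and> ideal J D \<and> J \<noteq> carrier D" "I = D.iprod Js"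
    using assms(1) by (elim D.has_ta_factorizationE)
  have drop: "E.iprod Ks = E.iprod (filter (\<lambda>K. K \<noteq> carrier E) Ks)"
    if "\<forall>K\<in>set Ks. ideal K E" for Ks
    using that
  proof (induction Ks)
    case (Cons K Ks)
    then show ?case
      using E.ideal_prod_one_left[OF E.iprod_ideal[of "filter (\<lambda>K. K \<noteq> carrier E) Ks"]] by auto
  qed simp
  let ?Ks = "filter (\<lambda>K. K \<noteq> carrier E) (map ext Js)"
  have eq: "ext I = E.iprod ?Ks"
    using ext_iprod[of Js] drop[of "map ext Js"] Js ext_ideal by auto
  moreover have "?Ks \<noteq> []" using assms(2) unfolding eq by (intro notI) simp
  ultimately show ?thesis
    using Js(1) ta_ext by (intro E.has_ta_factorizationI[of ?Ks]) auto
qed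

lemma taf_domain_ext:
  assumes "taf_domain D"
  shows "taf_domain E"
  unfolding taf_domain_def
proof (intro conjI allI impI)
  show "domain E" by (rule E.domain_axioms)
  fix K assume K: "ideal K E \<and> K \<noteq> carrier E"
  then have "has_ta_factorization D (contr K)"
    using assms contr_ideal contr_proper unfolding taf_domain_def by blast
  then show "has_ta_factorization E K"
    using has_ta_factorization_ext[of "contr K"] ext_contr[of K] K by simp
qed

lemma PIdl_of_numerator:
  assumes x: "x \<in> carrier E"
  obtains a where "a \<in> carrier D" "PIdl\<^bsub>E\<^esub> x = PIdl\<^bsub>E\<^esub> (\<phi> a)" "x \<noteq> \<zero>\<^bsub>E\<^esub> \<Longrightarrow> a \<noteq> \<zero>"
proof -
  obtain a s where a: "a \<in> carrier D" "s \<in> S" "x \<otimes>\<^bsub>E\<^esub> \<phi> s = \<phi> a" using surjE[OF x] .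
  have "\<phi> a \<in> PIdl\<^bsub>E\<^esub> x"
    unfolding E.PIdl_iff using a(3) x phi_S(1)[OF a(2)] E.m_comm[of x "\<phi> s"]
    by (intro bexI[of _ "\<phi> s"]) simp_all
  moreover have "x \<in> PIdl\<^bsub>E\<^esub> (\<phi> a)"
    using ideal_cancel_unit[OF E.cgenideal_ideal x units[OF a(2)], of "\<phi> a"] a E.cgenideal_self[of "\<phi> a"] by simp
  ultimately have "PIdl\<^bsub>E\<^esub> x = PIdl\<^bsub>E\<^esub> (\<phi> a)"
    using E.cgenideal_minimal E.cgenideal_ideal x a(1) by (intro equalityI) simp_all
  moreover have "a \<noteq> \<zero>" if "x \<noteq> \<zero>\<^bsub>E\<^esub>"
    using a(3) that x phi_S[OF a(2)] phi_zero E.integral_iff[of x "\<phi> s"] by auto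
  ultimately show ?thesis using that a(1) by blast
qed

section \<open>Localization at a prime and the quotient field\<close>

lemma local_domain_at_prime:
  assumes P: "primeideal P D" and S: "S = carrier D - P"
  shows "local_domain E" and "carrier E - Units E = ext P"
proof -
  note iP = primeideal.axioms(1)[OF P]
  have PS: "P \<inter> S = {}" using S by auto
  have "x \<in> Units E \<longleftrightarrow> x \<notin> ext P" if x: "x \<in> carrier E" for x
  proof
    show "x \<notin> ext P" if "x \<in> Units E"
      using E.ideal_unit[OF ext_ideal[OF iP] _ that] ext_proper_iff[OF iP] PS by auto
    assume nx: "x \<notin> ext P"
    obtain a s where a: "a \<in> carrier D" "s \<in> S" "x \<otimes>\<^bsub>E\<^esub> \<phi> s = \<phi> a" using surjE[OF x] .
    then have "a \<in> S"
      using nx mem_ext_iff[OF iP x a(2,3,1)] prime_phi_mem_ext[OF P PS a(1)] S by simp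
    then show "x \<in> Units E"
      using E.unit_divisor[of x "\<phi> s"] x a units phi_S(1) by simp
  qed
  then show eq: "carrier E - Units E = ext P"
    using D.ideal_subset E.ideal_subset[OF ext_ideal[OF iP]] by auto
  show "local_domain E"
  proof (unfold_locales, unfold eq)
    fix x y assume "x \<in> ext P" "y \<in> ext P"
    then have "x \<oplus>\<^bsub>E\<^esub> y \<in> carrier E - Units E"
      unfolding eq using E.ideal_add[OF ext_ideal[OF iP]] by simp
    then show "x \<oplus>\<^bsub>E\<^esub> y \<notin> Units E" by simp
  qed
qed

end

lemma (in domain) localization_at_map:
  assumes P: "primeideal P R"
  shows "localization_map R (localization_at R P) (carrier R - P) (\<lambda>a. fraction R (carrier R - P) a \<one>)"
proof -
  have "mult_set R (carrier R - P)"
  proof unfold_locales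
    show "carrier R - P \<subseteq> carrier R - {\<zero>}"
      using ideal_zero[OF primeideal.axioms(1)[OF P]] by auto
    show "\<one> \<in> carrier R - P" using one_notin_prime[OF P] by simp
    show "s \<otimes> t \<in> carrier R - P" if "s \<in> carrier R - P" "t \<in> carrier R - P" for s t
      using primeideal.I_prime[OF P, of s t] that by auto
  qed
  then show ?thesis
    unfolding localization_at_def by (rule mult_set.localization_map)
qed

lemma (in domain) quotient_field_map:
  "localization_map R (quotient_field R) (carrier R - {\<zero>}) (to_quotient_field R)"
proof -
  have "mult_set R (carrier R - {\<zero>})"
    by unfold_locales (auto simp: integral_iff)
  then show ?thesis
    unfolding quotient_field_def to_quotient_field_def by (rule mult_set.localization_map)
qed

section \<open>Pseudo-valuation domains\<close>

context local_domain
begin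

abbreviation Q where "Q \<equiv> quotient_field R"
abbreviation q where "q \<equiv> to_quotient_field R"
abbreviation V where "V \<equiv> colon_ring R nonunits"

lemma pvd_iff: "pvd R \<longleftrightarrow> field R \<or> valuation_domain V \<and> maximalideal (q ` nonunits) V"
proof -
  have "{N. maximalideal N R} = {nonunits}" using maximalideal_iff by auto
  then show ?thesis unfolding pvd_def using domain_axioms by auto
qed

lemma colon_ring_simps [simp]:
  "x \<otimes>\<^bsub>V\<^esub> y = x \<otimes>\<^bsub>Q\<^esub> y" "x \<oplus>\<^bsub>V\<^esub> y = x \<oplus>\<^bsub>Q\<^esub> y" "\<one>\<^bsub>V\<^esub> = \<one>\<^bsub>Q\<^esub>" "\<zero>\<^bsub>V\<^esub> = \<zero>\<^bsub>Q\<^esub>"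
  by (simp_all add: colon_ring_def)

lemma carrier_V: "x \<in> carrier V \<longleftrightarrow> x \<in> carrier Q \<and> (\<forall>m\<in>nonunits. \<exists>m'\<in>nonunits. x \<otimes>\<^bsub>Q\<^esub> q m = q m')"
  by (auto simp: colon_ring_def image_iff)

lemma V_mult_nonunit:
  assumes "x \<in> carrier V" "m \<in> nonunits"
  obtains m' where "m' \<in> nonunits" "x \<otimes>\<^bsub>Q\<^esub> q m = q m'"
  using assms unfolding carrier_V by auto

lemma q_in_V:
  assumes "a \<in> carrier R"
  shows "q a \<in> carrier V"
proof -
  interpret K: localization_map R Q "carrier R - {\<zero>}" q by (rule quotient_field_map)
  show ?thesis
    unfolding carrier_V
  proof (intro conjI ballI)
    show "q a \<in> carrier Q" using assms by simp
    show "\<exists>m'\<in>nonunits. q a \<otimes>\<^bsub>Q\<^esub> q m = q m'" if "m \<in> nonunits" for m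
      using K.phi_mult[of a m] assms that ideal.I_l_closed[OF nonunits_ideal that assms]
      by (intro bexI[of _ "a \<otimes> m"]) simp_all
  qed
qed

text \<open>In the valuation ring \<open>V\<close>, one of \<open>p\<close> and \<open>x\<close>
  divides the other. The quotient of \<open>x\<close> by \<open>p\<close>, if it lies in
  \<open>V\<close>, carries \<open>y\<close> into the maximal ideal, which is the claim. In the
  other case the quotient of \<open>p\<close> by \<open>x\<close> is a unit of \<open>V\<close>,
  because \<open>p\<close> is an atom, and the first case applies again.\<close>

lemma pvd_imp_atoms_divide_products:
  assumes "pvd R"
  shows "atoms_divide_products"
  unfolding atoms_divide_products_def
proof (intro allI impI)
  fix p x y assume p: "atom R p" and x: "x \<in> nonunits" and y: "y \<in> nonunits"
  note pD = atomD(1-3)[OF p]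
  interpret K: localization_map R Q "carrier R - {\<zero>}" q by (rule quotient_field_map)
  \<comment> \<open>A field has no atoms, so the second alternative of \<open>pvd_iff\<close> must
    hold.\<close>
  have "\<not> field R" using pD field.field_Units by auto
  then have val: "valuation_domain V" and max: "maximalideal (q ` nonunits) V"
    using assms pvd_iff by auto
  interpret V: domain V using val unfolding valuation_domain_def by simp
  have key: "p divides (x \<otimes> y)" if z: "z \<in> carrier V" "q x = q p \<otimes>\<^bsub>Q\<^esub> z" for z
  proof -
    obtain m where m: "m \<in> nonunits" "z \<otimes>\<^bsub>Q\<^esub> q y = q m" using V_mult_nonunit[OF z(1) y] .
    have zc: "z \<in> carrier Q" using z(1) unfolding carrier_V by simp
    have "q (x \<otimes> y) = q p \<otimes>\<^bsub>Q\<^esub> (z \<otimes>\<^bsub>Q\<^esub> q y)"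
      using x y pD zc unfolding K.E.m_assoc[OF K.phi_closed[OF pD(1)] zc K.phi_closed, of y, symmetric]
      by (simp add: K.phi_mult z(2) K.E.m_assoc)
    also have "\<dots> = q (p \<otimes> m)" using m pD by (simp add: K.phi_mult)
    finally have "x \<otimes> y = p \<otimes> m" using K.phi_eq_iff[of "x \<otimes> y" "p \<otimes> m"] x y pD m by simp
    then show ?thesis unfolding factor_def using m by auto
  qed
  have "q p divides\<^bsub>V\<^esub> q x \<or> q x divides\<^bsub>V\<^esub> q p"
    using val q_in_V[of p] q_in_V[of x] pD x unfolding valuation_domain_def by auto
  then show "p divides (x \<otimes> y)"
  proof
    assume "q p divides\<^bsub>V\<^esub> q x"
    then show ?thesis using key unfolding factor_def by auto
  next
    assume "q x divides\<^bsub>V\<^esub> q p"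
    then obtain z where z: "z \<in> carrier V" "q p = q x \<otimes>\<^bsub>Q\<^esub> z" unfolding factor_def by auto
    have zc: "z \<in> carrier Q" using z(1) unfolding carrier_V by simp
    \<comment> \<open>Otherwise \<open>p\<close> would be the product of \<open>x\<close> and
      another nonunit of \<open>R\<close>.\<close>
    have "z \<notin> q ` nonunits"
    proof
      assume "z \<in> q ` nonunits"
      then obtain m where m: "m \<in> nonunits" "z = q m" by auto
      then have "q p = q (x \<otimes> m)" using z(2) x by (simp add: K.phi_mult)
      then have "p = x \<otimes> m" using K.phi_eq_iff[of p "x \<otimes> m"] pD x m by simp
      then show False using atomD(4)[OF p, of x m] x m by auto
    qed
    then obtain r n where r: "r \<in> carrier V" "n \<in> q ` nonunits" "r \<otimes>\<^bsub>V\<^esub> z \<oplus>\<^bsub>V\<^esub> n = \<one>\<^bsub>V\<^esub>"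
      using V.maximalideal_inverse[OF max z(1)] by metis
    then obtain m where m: "m \<in> nonunits" "n = q m" by auto
    have rc: "r \<in> carrier Q" using r(1) unfolding carrier_V by simp
    let ?u = "\<one> \<ominus> m"
    have u: "?u \<in> Units R" "?u \<in> carrier R" using one_minus_unit[OF m(1)] by auto
    have "r \<otimes>\<^bsub>Q\<^esub> z \<oplus>\<^bsub>Q\<^esub> q m = q ?u \<oplus>\<^bsub>Q\<^esub> q m"
      using r(3) m K.phi_add[of ?u m] K.phi_one u by (simp add: a_minus_def a_assoc l_neg)
    then have rz: "r \<otimes>\<^bsub>Q\<^esub> z = q ?u"
      using K.E.add.r_cancel[of "q m" "r \<otimes>\<^bsub>Q\<^esub> z" "q ?u"] rc zc m u by simp
    \<comment> \<open>From \<open>r z + m = 1\<close> one gets \<open>r z = 1 - m\<close>, a unit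
      already in \<open>R\<close>; dividing by it turns \<open>r\<close> into an inverse of
      \<open>z\<close> inside \<open>V\<close>.\<close>
    let ?w = "r \<otimes>\<^bsub>V\<^esub> q (inv ?u)"
    have w: "?w \<in> carrier V" using V.m_closed[OF r(1) q_in_V] u by simp
    have "z \<otimes>\<^bsub>Q\<^esub> ?w = (r \<otimes>\<^bsub>Q\<^esub> z) \<otimes>\<^bsub>Q\<^esub> q (inv ?u)"
      using rc zc u by (simp add: K.E.m_ac)
    also have "\<dots> = \<one>\<^bsub>Q\<^esub>"
      unfolding rz using K.phi_mult[of ?u "inv ?u"] u K.phi_one by simp
    finally have zw: "z \<otimes>\<^bsub>Q\<^esub> ?w = \<one>\<^bsub>Q\<^esub>" .
    have wc: "?w \<in> carrier Q" using w unfolding carrier_V by simp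
    have "q p \<otimes>\<^bsub>Q\<^esub> ?w = q x \<otimes>\<^bsub>Q\<^esub> (z \<otimes>\<^bsub>Q\<^esub> ?w)"
      unfolding z(2) using x zc wc by (intro K.E.m_assoc) simp_all
    then have "q x = q p \<otimes>\<^bsub>Q\<^esub> ?w" unfolding zw using x by simp
    then show ?thesis using key[OF w] by simp
  qed
qed

text \<open>So \<open>V\<close> consists of zero and the fractions of nonnegative length
  \<open>v a - v b\<close>. Multiplying by a nonzero nonunit raises the length strictly, which turns
  the weak inequality into the strict one needed for divisibility and leaves a nonunit
  cofactor.\<close>

lemma length_function_in_V_iff:
  assumes v: "length_function v" and x: "x \<in> carrier Q" "x \<otimes>\<^bsub>Q\<^esub> q b = q a"
    and ab: "a \<in> carrier R" "a \<noteq> \<zero>" "b \<in> carrier R" "b \<noteq> \<zero>"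
  shows "x \<in> carrier V \<longleftrightarrow> v b \<le> v a"
proof
  interpret K: localization_map R Q "carrier R - {\<zero>}" q by (rule quotient_field_map)
  note vD = length_functionD[OF v]
  have pos: "v c \<noteq> 0 \<longleftrightarrow> c \<in> nonunits" if "c \<in> carrier R" "c \<noteq> \<zero>" for c
    using vD(3)[OF that] that by auto
  show "v b \<le> v a" if xV: "x \<in> carrier V"
  proof (rule ccontr)
    assume neg: "\<not> v b \<le> v a"
    \<comment> \<open>Here \<open>x\<close> is the inverse of the nonunit \<open>c\<close>, so
      multiplication by \<open>x\<close> would carry \<open>c\<close> to 1, out of the maximal
      ideal.\<close>
    then obtain c where c: "c \<in> carrier R" "b = a \<otimes> c" using vD(2)[OF ab] by auto
    then have cn: "c \<noteq> \<zero>" using ab by auto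
    have "v b = v a + v c" using vD(1)[OF ab(1,2) c(1) cn] c(2) by simp
    then have "c \<in> nonunits" using neg pos[OF c(1) cn] by simp
    then obtain m where m: "m \<in> nonunits" "x \<otimes>\<^bsub>Q\<^esub> q c = q m" using V_mult_nonunit[OF xV] by blast
    have "q a = (x \<otimes>\<^bsub>Q\<^esub> q c) \<otimes>\<^bsub>Q\<^esub> q a"
      using x ab c by (simp add: K.phi_mult K.E.m_ac)
    also have "\<dots> = q (m \<otimes> a)" unfolding m(2) using m ab by (simp add: K.phi_mult)
    finally have "m \<otimes> a = \<one> \<otimes> a" using K.phi_eq_iff[of a "m \<otimes> a"] ab m by simp
    then have "m = \<one>" using m_rcancel[of a m \<one>] ab m by simp
    then show False using m by simp
  qed
  show "x \<in> carrier V" if le: "v b \<le> v a"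
    unfolding carrier_V
  proof (intro conjI ballI)
    show "x \<in> carrier Q" by fact
    fix m assume m: "m \<in> nonunits"
    show "\<exists>m'\<in>nonunits. x \<otimes>\<^bsub>Q\<^esub> q m = q m'"
    proof (cases "m = \<zero>")
      case True
      then show ?thesis using x(1) m K.phi_zero by (intro bexI[of _ \<zero>]) simp_all
    next
      case False
      have mc: "m \<in> carrier R" using m by simp
      have am: "a \<otimes> m \<in> carrier R" "a \<otimes> m \<noteq> \<zero>" using ab mc False by (auto simp: integral_iff)
      have vam: "v (a \<otimes> m) = v a + v m" using vD(1)[OF ab(1,2) mc False] .
      then have "v b < v (a \<otimes> m)" using le pos[OF mc False] m by simp
      then obtain c where c: "c \<in> carrier R" "a \<otimes> m = b \<otimes> c" using vD(2)[OF ab(3,4) am] by auto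
      then have cn: "c \<noteq> \<zero>" using am ab by auto
      have "v (a \<otimes> m) = v b + v c" using vD(1)[OF ab(3,4) c(1) cn] c(2) by simp
      then have cM: "c \<in> nonunits" using \<open>v b < v (a \<otimes> m)\<close> pos[OF c(1) cn] by simp
      have "(x \<otimes>\<^bsub>Q\<^esub> q m) \<otimes>\<^bsub>Q\<^esub> q b = (x \<otimes>\<^bsub>Q\<^esub> q b) \<otimes>\<^bsub>Q\<^esub> q m"
        using x(1) mc ab by (simp add: K.E.m_ac)
      also have "\<dots> = q (a \<otimes> m)" unfolding x(2) using ab mc by (simp add: K.phi_mult)
      also have "\<dots> = q c \<otimes>\<^bsub>Q\<^esub> q b" unfolding c(2) using ab c(1) by (simp add: K.phi_mult K.E.m_comm)
      finally have "x \<otimes>\<^bsub>Q\<^esub> q m = q c"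
        using K.cancel_S[of "x \<otimes>\<^bsub>Q\<^esub> q m" "q c" b] x(1) mc c(1) ab by simp
      then show ?thesis using cM by auto
    qed
  qed
qed

lemma domain_V: "domain V"
proof -
  interpret K: localization_map R Q "carrier R - {\<zero>}" q by (rule quotient_field_map)
  have "subring {x \<in> carrier Q. \<forall>m\<in>nonunits. x \<otimes>\<^bsub>Q\<^esub> q m \<in> q ` nonunits} Q" (is "subring ?H Q")
  proof (rule K.E.subringI)
    show "?H \<subseteq> carrier Q" by auto
    show "\<one>\<^bsub>Q\<^esub> \<in> ?H" by auto
    fix x assume x: "x \<in> ?H"
    show "\<ominus>\<^bsub>Q\<^esub> x \<in> ?H"
    proof (intro CollectI conjI ballI)
      show "\<ominus>\<^bsub>Q\<^esub> x \<in> carrier Q" using x by simp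
      fix m assume m: "m \<in> nonunits"
      then obtain m' where m': "m' \<in> nonunits" "x \<otimes>\<^bsub>Q\<^esub> q m = q m'" using x by auto
      have "(\<ominus>\<^bsub>Q\<^esub> x) \<otimes>\<^bsub>Q\<^esub> q m = q (\<ominus> m')"
        using x m m' by (simp add: K.E.l_minus K.phi_minus)
      moreover have "\<ominus> m' \<in> nonunits"
        using m' nonunit_mult[of m' "\<ominus> \<one>"] by (simp add: r_minus)
      ultimately show "(\<ominus>\<^bsub>Q\<^esub> x) \<otimes>\<^bsub>Q\<^esub> q m \<in> q ` nonunits" by (rule image_eqI)
    qed
    fix y assume y: "y \<in> ?H"
    show "x \<otimes>\<^bsub>Q\<^esub> y \<in> ?H"
    proof (intro CollectI conjI ballI)
      show "x \<otimes>\<^bsub>Q\<^esub> y \<in> carrier Q" using x y by simp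
      fix m assume m: "m \<in> nonunits"
      then obtain m' where m': "m' \<in> nonunits" "y \<otimes>\<^bsub>Q\<^esub> q m = q m'" using y by auto
      then have "(x \<otimes>\<^bsub>Q\<^esub> y) \<otimes>\<^bsub>Q\<^esub> q m = x \<otimes>\<^bsub>Q\<^esub> q m'"
        using x y m by (simp add: K.E.m_assoc)
      then show "(x \<otimes>\<^bsub>Q\<^esub> y) \<otimes>\<^bsub>Q\<^esub> q m \<in> q ` nonunits" using x m'(1) by simp
    qed
    show "x \<oplus>\<^bsub>Q\<^esub> y \<in> ?H"
    proof (intro CollectI conjI ballI)
      show "x \<oplus>\<^bsub>Q\<^esub> y \<in> carrier Q" using x y by simp
      fix m assume m: "m \<in> nonunits"
      then obtain m1 m2 where m': "m1 \<in> nonunits" "x \<otimes>\<^bsub>Q\<^esub> q m = q m1" "m2 \<in> nonunits" "y \<otimes>\<^bsub>Q\<^esub> q m = q m2"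
        using x y by blast
      then have "(x \<oplus>\<^bsub>Q\<^esub> y) \<otimes>\<^bsub>Q\<^esub> q m = q (m1 \<oplus> m2)"
        using x y m by (simp add: K.E.l_distr K.phi_add)
      then show "(x \<oplus>\<^bsub>Q\<^esub> y) \<otimes>\<^bsub>Q\<^esub> q m \<in> q ` nonunits"
        using ideal_add[OF nonunits_ideal m'(1,3)] by (rule image_eqI)
    qed
  qed
  then show ?thesis unfolding colon_ring_def by (rule K.E.subring_is_domain)
qed

text \<open>Elements of \<open>V\<close> of positive length are images of nonunits of
  \<open>R\<close>, and those of length 0 are units of \<open>V\<close>. This gives both the
  comparability of any two elements and the maximality of the image of
  \<open>nonunits\<close>.\<close>

lemma length_function_imp_pvd:
  assumes v: "length_function v"
  shows "pvd R"
proof -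
  interpret K: localization_map R Q "carrier R - {\<zero>}" q by (rule quotient_field_map)
  interpret V: domain V by (rule domain_V)
  note vD = length_functionD[OF v]
  have VQ: "x \<in> carrier Q" if "x \<in> carrier V" for x using that unfolding carrier_V by simp
  have rep: "\<exists>a b. a \<in> carrier R \<and> a \<noteq> \<zero> \<and> b \<in> carrier R \<and> b \<noteq> \<zero> \<and> x \<otimes>\<^bsub>Q\<^esub> q b = q a"
    if x: "x \<in> carrier Q" "x \<noteq> \<zero>\<^bsub>Q\<^esub>" for x
  proof -
    obtain a b where ab: "a \<in> carrier R" "b \<in> carrier R - {\<zero>}" "x \<otimes>\<^bsub>Q\<^esub> q b = q a"
      using K.surjE[OF x(1)] .
    moreover have "a \<noteq> \<zero>"
      using ab x K.phi_S[OF ab(2)] K.phi_zero K.E.integral_iff[of x "q b"] by auto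
    ultimately show ?thesis by auto
  qed
  have quot: "\<exists>z\<in>carrier Q. z \<otimes>\<^bsub>Q\<^esub> q b = q a"
    if h: "a \<in> carrier R" "b \<in> carrier R" "b \<noteq> \<zero>" for a b
  proof -
    have U: "q b \<in> Units Q" using K.units h by simp
    have "(q a \<otimes>\<^bsub>Q\<^esub> inv\<^bsub>Q\<^esub> q b) \<otimes>\<^bsub>Q\<^esub> q b = q a"
      using h U by (simp add: K.E.m_assoc)
    then show ?thesis using h U by (intro bexI[of _ "q a \<otimes>\<^bsub>Q\<^esub> inv\<^bsub>Q\<^esub> q b"]) simp_all
  qed
  \<comment> \<open>With \<open>x = a / b\<close> and \<open>y = c / d\<close>, the quotient of
    \<open>x\<close> by \<open>y\<close> is \<open>(a d) / (b c)\<close>, and the inequality says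
    that its length is nonnegative.\<close>
  have divides: "y divides\<^bsub>V\<^esub> x"
    if xy: "x \<in> carrier Q" "y \<in> carrier Q" "x \<otimes>\<^bsub>Q\<^esub> q b = q a" "y \<otimes>\<^bsub>Q\<^esub> q d = q c"
      "a \<in> carrier R" "a \<noteq> \<zero>" "b \<in> carrier R" "b \<noteq> \<zero>" "c \<in> carrier R" "c \<noteq> \<zero>" "d \<in> carrier R" "d \<noteq> \<zero>"
      and le: "v (b \<otimes> c) \<le> v (a \<otimes> d)" for x y a b c d
  proof -
    have ne: "b \<otimes> c \<noteq> \<zero>" "a \<otimes> d \<noteq> \<zero>" using xy by (auto simp: integral_iff)
    obtain z where z: "z \<in> carrier Q" "z \<otimes>\<^bsub>Q\<^esub> q (b \<otimes> c) = q (a \<otimes> d)"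
      using quot[of "a \<otimes> d" "b \<otimes> c"] xy ne by auto
    have zV: "z \<in> carrier V"
      using length_function_in_V_iff[OF v z] xy ne le by simp
    have "(y \<otimes>\<^bsub>Q\<^esub> z) \<otimes>\<^bsub>Q\<^esub> q (b \<otimes> c \<otimes> d) = (z \<otimes>\<^bsub>Q\<^esub> q (b \<otimes> c)) \<otimes>\<^bsub>Q\<^esub> (y \<otimes>\<^bsub>Q\<^esub> q d)"
      using xy(1,2,5,7,9,11) z(1) by (simp add: K.phi_mult K.E.m_ac)
    also have "\<dots> = q a \<otimes>\<^bsub>Q\<^esub> (q c \<otimes>\<^bsub>Q\<^esub> q d)"
      unfolding z(2) xy(4) using xy(5,7,9,11) by (simp add: K.phi_mult K.E.m_ac)
    also have "\<dots> = x \<otimes>\<^bsub>Q\<^esub> q (b \<otimes> c \<otimes> d)"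
      unfolding xy(3)[symmetric] using xy(1,5,7,9,11) by (simp add: K.phi_mult K.E.m_ac)
    finally have "y \<otimes>\<^bsub>Q\<^esub> z = x"
      using K.cancel_S[of "y \<otimes>\<^bsub>Q\<^esub> z" x "b \<otimes> c \<otimes> d"] xy z(1) ne by (simp add: integral_iff)
    then show ?thesis unfolding factor_def using zV by auto
  qed
  have val: "valuation_domain V"
    unfolding valuation_domain_def
  proof (intro conjI ballI)
    show "domain V" by (rule domain_V)
    fix x y assume xyV: "x \<in> carrier V" "y \<in> carrier V"
    show "x divides\<^bsub>V\<^esub> y \<or> y divides\<^bsub>V\<^esub> x"
    proof (cases "x = \<zero>\<^bsub>Q\<^esub> \<or> y = \<zero>\<^bsub>Q\<^esub>")
      case True
      then show ?thesis
        using xyV V.zero_closed VQ unfolding factor_def by (auto intro!: bexI[of _ "\<zero>\<^bsub>Q\<^esub>"])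
    next
      case False
      obtain a b where ab: "a \<in> carrier R" "a \<noteq> \<zero>" "b \<in> carrier R" "b \<noteq> \<zero>" "x \<otimes>\<^bsub>Q\<^esub> q b = q a"
        using rep[OF VQ[OF xyV(1)]] False by blast
      obtain c d where cd: "c \<in> carrier R" "c \<noteq> \<zero>" "d \<in> carrier R" "d \<noteq> \<zero>" "y \<otimes>\<^bsub>Q\<^esub> q d = q c"
        using rep[OF VQ[OF xyV(2)]] False by blast
      have "v (b \<otimes> c) \<le> v (a \<otimes> d) \<or> v (d \<otimes> a) \<le> v (c \<otimes> b)"
        using m_comm[OF ab(1) cd(3)] m_comm[OF ab(3) cd(1)] by auto
      then show ?thesis
        using divides[OF VQ[OF xyV(1)] VQ[OF xyV(2)] ab(5) cd(5) ab(1-4) cd(1-4)]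
          divides[OF VQ[OF xyV(2)] VQ[OF xyV(1)] cd(5) ab(5) cd(1-4) ab(1-4)] by auto
    qed
  qed
  have qM: "ideal (q ` nonunits) V"
  proof (rule V.ideal_criterion)
    show "q ` nonunits \<subseteq> carrier V" using q_in_V by auto
    show "\<zero>\<^bsub>V\<^esub> \<in> q ` nonunits" using K.phi_zero zero_not_unit by (auto intro!: image_eqI[of _ _ \<zero>])
    show "x \<oplus>\<^bsub>V\<^esub> y \<in> q ` nonunits" if xy: "x \<in> q ` nonunits" "y \<in> q ` nonunits" for x y
    proof -
      obtain m n where mn: "m \<in> nonunits" "n \<in> nonunits" "x = q m" "y = q n" using xy by auto
      then have "x \<oplus>\<^bsub>V\<^esub> y = q (m \<oplus> n)" by (simp add: K.phi_add)
      then show ?thesis using ideal_add[OF nonunits_ideal mn(1,2)] by (rule image_eqI)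
    qed
    show "r \<otimes>\<^bsub>V\<^esub> x \<in> q ` nonunits" if xr: "x \<in> q ` nonunits" "r \<in> carrier V" for x r
    proof -
      obtain m where m: "m \<in> nonunits" "x = q m" using xr by auto
      obtain m' where "m' \<in> nonunits" "r \<otimes>\<^bsub>Q\<^esub> q m = q m'" using V_mult_nonunit[OF xr(2) m(1)] .
      then show ?thesis using m by simp
    qed
  qed
  have max: "maximalideal (q ` nonunits) V"
  proof (rule maximalidealI[OF qM])
    have "\<one>\<^bsub>Q\<^esub> \<notin> q ` nonunits"
    proof
      assume "\<one>\<^bsub>Q\<^esub> \<in> q ` nonunits"
      then obtain m where "m \<in> nonunits" "q \<one> = q m" using K.phi_one by auto
      then show False using K.phi_eq_iff[of \<one> m] by auto
    qed
    then show "carrier V \<noteq> q ` nonunits" using V.one_closed by auto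
    fix J assume J: "ideal J V" "q ` nonunits \<subseteq> J" "J \<subseteq> carrier V"
    show "J = q ` nonunits \<or> J = carrier V"
    proof (rule disjCI)
      assume "J \<noteq> carrier V"
      then have oneJ: "\<one>\<^bsub>Q\<^esub> \<notin> J" using ideal.one_imp_carrier[OF J(1)] by auto
      have "J \<subseteq> q ` nonunits"
      proof
        fix x assume xJ: "x \<in> J"
        then have xV: "x \<in> carrier V" using J by auto
        show "x \<in> q ` nonunits"
        proof (cases "x = \<zero>\<^bsub>Q\<^esub>")
          case True
          then show ?thesis using ideal.axioms(1)[OF qM] additive_subgroup.zero_closed by fastforce
        next
          case False
          then obtain a b where ab: "a \<in> carrier R" "a \<noteq> \<zero>" "b \<in> carrier R" "b \<noteq> \<zero>" "x \<otimes>\<^bsub>Q\<^esub> q b = q a"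
            using rep[OF VQ[OF xV]] by blast
          then have le: "v b \<le> v a" using length_function_in_V_iff[OF v VQ[OF xV]] xV by simp
          show ?thesis
          proof (cases "v b < v a")
            case True
            then obtain c where c: "c \<in> carrier R" "a = b \<otimes> c" using vD(2)[OF ab(3,4,1,2)] by auto
            then have cn: "c \<noteq> \<zero>" using ab by auto
            have "v a = v b + v c" using vD(1)[OF ab(3,4) c(1) cn] c(2) by simp
            then have cM: "c \<in> nonunits" using True vD(3)[OF c(1) cn] c(1) by auto
            have "x \<otimes>\<^bsub>Q\<^esub> q b = q c \<otimes>\<^bsub>Q\<^esub> q b"
              unfolding ab(5) c(2) using ab c(1) by (simp add: K.phi_mult K.E.m_comm)
            then have "x = q c"
              using K.cancel_S[OF VQ[OF xV], of "q c" b] c(1) ab by simp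
            then show ?thesis using cM by simp
          next
            case False
            \<comment> \<open>Equal lengths: the inverse fraction \<open>b / a\<close> lies in
              \<open>V\<close> as well, so \<open>J\<close> would contain a unit.\<close>
            obtain z where z: "z \<in> carrier Q" "z \<otimes>\<^bsub>Q\<^esub> q a = q b" using quot[OF ab(3,1,2)] by auto
            have zV: "z \<in> carrier V"
              using length_function_in_V_iff[OF v z ab(3,4,1,2)] False by simp
            have "(z \<otimes>\<^bsub>Q\<^esub> x) \<otimes>\<^bsub>Q\<^esub> q b = z \<otimes>\<^bsub>Q\<^esub> (x \<otimes>\<^bsub>Q\<^esub> q b)"
              using z(1) VQ[OF xV] ab(3) by (simp add: K.E.m_assoc)
            also have "\<dots> = \<one>\<^bsub>Q\<^esub> \<otimes>\<^bsub>Q\<^esub> q b" unfolding ab(5) z(2) using ab by simp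
            finally have "z \<otimes>\<^bsub>Q\<^esub> x = \<one>\<^bsub>Q\<^esub>"
              using K.cancel_S[of "z \<otimes>\<^bsub>Q\<^esub> x" "\<one>\<^bsub>Q\<^esub>" b] z(1) VQ[OF xV] ab by simp
            then show ?thesis using ideal.I_l_closed[OF J(1) xJ zV] oneJ by simp
          qed
        qed
      qed
      then show "J = q ` nonunits" using J by auto
    qed
  qed
  show ?thesis using pvd_iff val max by simp
qed

end

section \<open>Domains with TA-factorization are at most one-dimensional\<close>

lemma (in cring) pow_mem_iprod:
  assumes "t \<in> carrier R" "\<And>J. J \<in> set Js \<Longrightarrow> t \<otimes> t \<in> J"
  shows "t [^] (2 * length Js) \<in> iprod Js"
  using assms(2)
proof (induction Js)
  case (Cons J Js)
  have "t [^] (2 * length (J # Js)) = (t \<otimes> t) \<otimes> t [^] (2 * length Js)"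
    using assms(1) nat_pow_Suc2 by (simp add: m_assoc)
  then show ?case using Cons by (auto intro: ideal_prod.prod)
qed simp

context local_domain
begin

text \<open>Nakayama's lemma for the cyclic module \<open>(J + (x)) / J\<close>.\<close>

lemma mem_of_eq_add_mult:
  assumes "ideal J R" "c \<in> J" "w \<in> nonunits" "x \<in> carrier R" "x = c \<oplus> w \<otimes> x"
  shows "x \<in> J"
proof -
  have c: "c \<in> carrier R" using ideal.Icarr assms(1,2) by metis
  have wx: "w \<otimes> x \<in> carrier R" using assms(3,4) by simp
  have "(\<one> \<ominus> w) \<otimes> x = x \<ominus> w \<otimes> x"
    using assms(3,4) by (simp add: a_minus_def l_distr l_minus)
  also have "\<dots> = (c \<oplus> w \<otimes> x) \<ominus> w \<otimes> x" using assms(5) by simp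
  also have "\<dots> = c" using c wx by (simp add: a_minus_def a_assoc r_neg)
  finally have eq: "(\<one> \<ominus> w) \<otimes> x = c" .
  have u: "\<one> \<ominus> w \<in> Units R" using one_minus_unit assms(3) .
  have "x = inv (\<one> \<ominus> w) \<otimes> c"
    using inv_mult_cancel[OF u assms(4)] eq by simp
  then show ?thesis using ideal.I_l_closed[OF assms(1,2)] u by simp
qed

lemma taf_factorizationE:
  assumes "taf_domain R" "ideal I R" "I \<subseteq> nonunits"
  obtains Js where "Js \<noteq> []" "\<And>J. J \<in> set Js \<Longrightarrow> ta_ideal J R" "\<And>J. J \<in> set Js \<Longrightarrow> ideal J R"
    "\<And>J. J \<in> set Js \<Longrightarrow> J \<subseteq> nonunits" "\<And>J. J \<in> set Js \<Longrightarrow> I \<subseteq> J" "I = iprod Js"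
proof -
  have "I \<noteq> carrier R" using assms(3) by auto
  then have "has_ta_factorization R I" using assms(1,2) unfolding taf_domain_def by blast
  then obtain Js where Js: "Js \<noteq> []" "\<forall>J\<in>set Js. ta_ideal J R \<and> ideal J R \<and> J \<noteq> carrier R" "I = iprod Js"
    by (elim has_ta_factorizationE)
  then show ?thesis
    using that[of Js] proper_ideal_subset_nonunits iprod_subset[of Js] by simp
qed

lemma PIdl_subset_nonunits: "z \<in> nonunits \<Longrightarrow> PIdl z \<subseteq> nonunits"
  using cgenideal_minimal[OF nonunits_ideal] .

text \<open>The ideal \<open>(z, t\<^sup>n)\<close> has fewer than \<open>k\<close> factors for every \<open>n\<close>, and each of them contains
  \<open>t\<^sup>2\<close>; hence \<open>t\<^sup>2\<^sup>k \<in> (z, t\<^sup>n)\<close> with \<open>n > 2 k\<close>.\<close>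

lemma taf_pow_mem_PIdl:
  assumes taf: "taf_domain R" and z: "z \<in> nonunits" "z \<notin> ideal_pow nonunits k" and t: "t \<in> nonunits"
  shows "t [^] (2 * k) \<in> PIdl z"
proof -
  let ?n = "2 * k + 1"
  let ?T = "t [^] (2 * k)"
  have tc: "t \<in> carrier R" "z \<in> carrier R" "?T \<in> carrier R" using t z by auto
  have tn: "t [^] ?n \<in> nonunits" using pow_nonunit[OF t, of ?n] by simp
  have id: "ideal (PIdl z) R" "ideal (PIdl (t [^] ?n)) R"
    using cgenideal_ideal z(1) tn by auto
  let ?I = "PIdl z <+>\<^bsub>R\<^esub> PIdl (t [^] ?n)"
  have I: "ideal ?I R" "?I \<subseteq> nonunits"
    using add_ideals[OF id] sum_ideals_least[OF nonunits_ideal] PIdl_subset_nonunits[OF z(1)] PIdl_subset_nonunits[OF tn] by simp_all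
  have zI: "z \<in> ?I" and tI: "t [^] ?n \<in> ?I"
    using sum_ideals_contain[OF id] cgenideal_self[of z] cgenideal_self[of "t [^] ?n"] tc by auto
  obtain Js where Js: "\<And>J. J \<in> set Js \<Longrightarrow> ta_ideal J R"
    "\<And>J. J \<in> set Js \<Longrightarrow> J \<subseteq> nonunits" "\<And>J. J \<in> set Js \<Longrightarrow> ?I \<subseteq> J" "?I = iprod Js"
    using taf_factorizationE[OF taf I] by metis
  have "length Js < k"
  proof (rule ccontr)
    assume "\<not> length Js < k"
    then have "ideal_pow nonunits (length Js) \<subseteq> ideal_pow nonunits k"
      using ideal_pow_antimono[OF nonunits_ideal] by simp
    moreover have "?I \<subseteq> ideal_pow nonunits (length Js)"
      unfolding Js(4) using Js(2) by (rule iprod_subset_ideal_pow)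
    ultimately show False using zI z(2) by auto
  qed
  have "t \<otimes> t \<in> J" if "J \<in> set Js" for J
    using ta_ideal_square[OF Js(1)[OF that] tc(1), of ?n] Js(3)[OF that] tI by auto
  then have "t [^] (2 * length Js) \<in> ?I"
    unfolding Js(4) using pow_mem_iprod[OF tc(1)] by simp
  then have "?T \<in> ?I"
    using ideal_pow_ge[OF I(1) tc(1)] \<open>length Js < k\<close> by simp
  then obtain a b where ab: "a \<in> PIdl z" "b \<in> PIdl (t [^] ?n)" "?T = a \<oplus> b"
    unfolding ideal_sum_iff by auto
  obtain w where w: "w \<in> carrier R" "b = w \<otimes> t [^] ?n" using ab(2) unfolding PIdl_iff by auto
  \<comment> \<open>The surplus of \<open>?n\<close> over \<open>2 * k\<close> leaves one factor
    \<open>t\<close>, which makes the coefficient of \<open>?T\<close> a nonunit.\<close>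
  have "b = (t \<otimes> w) \<otimes> ?T" unfolding w(2) using w(1) tc by (simp add: m_ac)
  then have "?T = a \<oplus> (t \<otimes> w) \<otimes> ?T" using ab(3) by simp
  then show ?thesis
    using mem_of_eq_add_mult[OF id(1) ab(1) nonunit_mult[OF t w(1)] tc(3)] by simp
qed

text \<open>By Nakayama \<open>(z, t\<^sup>2) = (t\<^sup>2)\<close>, so \<open>z = t\<^sup>2 w\<close>, and \<open>t w \<in> (z)\<close> is impossible.\<close>

lemma taf_square_mem_PIdl:
  assumes taf: "taf_domain R" and z: "z \<in> nonunits" "z \<noteq> \<zero>" "ta_ideal (PIdl z) R"
    and t: "t \<in> nonunits" and rad: "\<And>m. m \<in> nonunits \<Longrightarrow> \<exists>j::nat. m [^] j \<in> PIdl t"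
    and pow: "\<And>k. z \<in> ideal_pow nonunits k"
  shows "t \<otimes> t \<in> PIdl z"
proof -
  have c: "z \<in> carrier R" "t \<in> carrier R" "t \<otimes> t \<in> nonunits" using z t nonunit_mult[OF t] by auto
  have id: "ideal (PIdl z) R" "ideal (PIdl (t \<otimes> t)) R"
    using cgenideal_ideal c by auto
  let ?I = "PIdl z <+>\<^bsub>R\<^esub> PIdl (t \<otimes> t)"
  have I: "ideal ?I R" "?I \<subseteq> nonunits"
    using add_ideals[OF id] sum_ideals_least[OF nonunits_ideal] PIdl_subset_nonunits[OF z(1)] PIdl_subset_nonunits[OF c(3)] by simp_all
  obtain Js where Js: "\<And>J. J \<in> set Js \<Longrightarrow> ta_ideal J R" "\<And>J. J \<in> set Js \<Longrightarrow> ideal J R"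
    "\<And>J. J \<in> set Js \<Longrightarrow> ?I \<subseteq> J" "?I = iprod Js"
    using taf_factorizationE[OF taf I] by metis
  have radI: "\<exists>j::nat. m [^] j \<in> ?I" if m: "m \<in> nonunits" for m
  proof -
    obtain j :: nat where "m [^] j \<in> PIdl t" using rad[OF m] by auto
    then obtain y where y: "y \<in> carrier R" "m [^] j = y \<otimes> t" unfolding PIdl_iff by auto
    have "m [^] (j + j) = (y \<otimes> t) \<otimes> (y \<otimes> t)"
      using m nat_pow_mult[of m j j] y(2) by simp
    also have "\<dots> = (y \<otimes> y) \<otimes> (t \<otimes> t)" using y(1) c by (simp add: m_ac)
    finally have "m [^] (j + j) \<in> PIdl (t \<otimes> t)" unfolding PIdl_iff using y(1) by auto
    then show ?thesis using sum_ideals_contain(2)[OF id] by blast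
  qed
  have "x \<otimes> y \<in> J" if J: "J \<in> set Js" and xy: "x \<in> nonunits" "y \<in> nonunits" for J x y
  proof -
    obtain i j :: nat where "x [^] i \<in> ?I" "y [^] j \<in> ?I" using radI xy by blast
    then show ?thesis
      using ta_ideal_radical_prod[OF Js(1)[OF J], of x i y j] Js(3)[OF J] xy by auto
  qed
  then have "ideal_pow nonunits (2 * length Js) \<subseteq> ?I"
    unfolding Js(4) using Js(2) by (intro ideal_pow_double_subset nonunits_ideal)
  \<comment> \<open>One power beyond \<open>2 * length Js\<close> places \<open>z\<close> in
    \<open>M I\<close>, that is, in \<open>z M\<close> plus \<open>t^2 M\<close>; the first summand
    is then a nonunit multiple of \<open>z\<close>, as Nakayama's lemma wants it.\<close>
  then have "ideal_pow nonunits (Suc (2 * length Js)) \<subseteq> ideal_prod R nonunits ?I"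
    by (simp add: ideal_prod_mono)
  then have "z \<in> ideal_prod R nonunits (PIdl z) <+>\<^bsub>R\<^esub> ideal_prod R nonunits (PIdl (t \<otimes> t))"
    using pow[of "Suc (2 * length Js)"] ideal_prod_distr(1)[OF nonunits_ideal id] by blast
  then obtain a b where ab: "a \<in> ideal_prod R nonunits (PIdl z)"
    "b \<in> ideal_prod R nonunits (PIdl (t \<otimes> t))" "z = a \<oplus> b"
    unfolding ideal_sum_iff by auto
  obtain m where m: "m \<in> nonunits" "a = z \<otimes> m"
    using ab(1) ideal_prod_PIdl_nonunits[OF c(1)] ideal_prod_commute[OF nonunits_ideal id(1)] by auto
  have b: "b \<in> PIdl (t \<otimes> t)" using ab(2) ideal_prod_inter[OF nonunits_ideal id(2)] by auto
  have "z = b \<oplus> m \<otimes> z"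
    using ab(3) m c(1) ideal.Icarr[OF id(2) b] a_comm[of a b] m_comm[of z m] by simp
  then have "z \<in> PIdl (t \<otimes> t)" using mem_of_eq_add_mult[OF id(2) b m(1) c(1)] by simp
  then obtain w where w: "w \<in> carrier R" "z = w \<otimes> (t \<otimes> t)" unfolding PIdl_iff by auto
  have "t \<otimes> w \<notin> PIdl z"
  proof
    assume "t \<otimes> w \<in> PIdl z"
    then obtain y where y: "y \<in> carrier R" "t \<otimes> w = y \<otimes> z" unfolding PIdl_iff by auto
    have ne: "t \<otimes> w \<noteq> \<zero>" using w z(2) c by (auto simp: integral_iff)
    have "(t \<otimes> w) \<otimes> (y \<otimes> t) = y \<otimes> z" unfolding w(2) using w(1) y(1) c by (simp add: m_ac)
    also have "\<dots> = (t \<otimes> w) \<otimes> \<one>" using y(2)[symmetric] w(1) c by simp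
    finally have "y \<otimes> t = \<one>" using m_lcancel[OF ne, of "y \<otimes> t" \<one>] w(1) y(1) c by simp
    then have "t \<otimes> y = \<one>" using m_comm[OF y(1) c(2)] by simp
    then show False using unit_divisor[of t y] y(1) t by simp
  qed
  moreover have "t \<otimes> t \<otimes> w \<in> PIdl z"
    using cgenideal_self[OF c(1)] w c m_comm[of w "t \<otimes> t"] by simp
  ultimately show ?thesis
    using ta_idealD(2)[OF z(3) c(2) c(2) w(1)] by auto
qed

text \<open>As \<open>t\<close> is outside \<open>M^2\<close>, the case \<open>k = 2\<close> of
  \<open>taf_pow_mem_PIdl\<close> puts the fourth power of every nonunit into \<open>PIdl t\<close>;
  hence \<open>t\<close> is not in \<open>P\<close>. A nonzero principal ideal inside
  \<open>P\<close> has a factor \<open>PIdl z\<close> inside \<open>P\<close>, which contains no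
  power of \<open>t\<close>. The same lemma then forces \<open>z\<close> into all powers of
  \<open>M\<close>, and \<open>taf_square_mem_PIdl\<close> gives the contradiction that
  \<open>t^2\<close> is in \<open>PIdl z\<close>.\<close>

lemma taf_nonidempotent_prime:
  assumes taf: "taf_domain R" and P: "primeideal P R" "P \<noteq> {\<zero>}" "P \<noteq> nonunits"
    and t: "t \<in> nonunits" "t \<notin> ideal_pow nonunits 2"
  shows False
proof -
  note iP = primeideal.axioms(1)[OF P(1)]
  have Pn: "P \<subseteq> nonunits"
    using proper_ideal_subset_nonunits[OF iP] primeideal.I_notcarr[OF P(1)] by auto
  have rad: "\<exists>j::nat. m [^] j \<in> PIdl t" if "m \<in> nonunits" for m
    using taf_pow_mem_PIdl[OF taf t that] by auto
  have tP: "t \<notin> P"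
  proof
    assume "t \<in> P"
    have "m \<in> P" if m: "m \<in> nonunits" for m
    proof -
      obtain j :: nat where "m [^] j \<in> P"
        using rad[OF m] cgenideal_minimal[OF iP \<open>t \<in> P\<close>] by auto
      then show ?thesis using prime_pow[OF P(1)] m by auto
    qed
    then show False using Pn P(3) by auto
  qed
  obtain x where x: "x \<in> P" "x \<noteq> \<zero>" using P(2) ideal_zero[OF iP] by auto
  then have xn: "x \<in> nonunits" using Pn by auto
  obtain Js where Js: "\<And>J. J \<in> set Js \<Longrightarrow> ta_ideal J R" "\<And>J. J \<in> set Js \<Longrightarrow> ideal J R" "PIdl x = iprod Js"
    "\<And>J. J \<in> set Js \<Longrightarrow> PIdl x \<subseteq> J"
    using taf_factorizationE[OF taf cgenideal_ideal PIdl_subset_nonunits[OF xn]] xn by (metis DiffD1)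
  obtain xs where xs: "set xs \<subseteq> carrier R - {\<zero>}" "Js = map (\<lambda>x. PIdl x) xs"
    using iprod_principal_factors[of Js x] Js(2,3) xn x(2) by auto
  have "iprod Js \<subseteq> P" using Js(3) cgenideal_minimal[OF iP x(1)] by simp
  then obtain J where J: "J \<in> set Js" "J \<subseteq> P" using prime_iprod[OF P(1), of Js] Js(2) by blast
  then obtain z where z: "z \<in> carrier R" "z \<noteq> \<zero>" "J = PIdl z" using xs by auto
  have zP: "z \<in> P" using J(2) z cgenideal_self[of z] by auto
  then have zn: "z \<in> nonunits" using Pn by auto
  have no_pow: "t [^] (j::nat) \<notin> PIdl z" for j
    using prime_pow[OF P(1), of t j] J(2) z(3) tP t(1) by auto
  have "z \<in> ideal_pow nonunits k" for k
    using taf_pow_mem_PIdl[OF taf zn _ t(1), of k] no_pow by auto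
  then have "t \<otimes> t \<in> PIdl z"
    using taf_square_mem_PIdl[OF taf zn z(2) _ t(1) rad] Js(1)[OF J(1)] z(3) by auto
  then show False using no_pow[of 2] t(1) by (simp add: numeral_2_eq_2)
qed

text \<open>Each TA-factor of the ideal generated by \<open>P\<close> and \<open>t^2\<close> has
  radical \<open>M\<close>, so it contains \<open>M^2 = M\<close>, and the product of the factors is
  \<open>M\<close> itself. Thus \<open>t\<close> lies in that ideal, and Nakayama's lemma modulo
  \<open>P\<close> yields that \<open>t\<close> is in \<open>P\<close>.\<close>

lemma taf_idempotent_prime:
  assumes taf: "taf_domain R" and P: "primeideal P R" and t: "t \<in> nonunits" "t \<notin> P"
    and rad: "\<And>m. m \<in> nonunits \<Longrightarrow> \<exists>j::nat. m [^] j \<in> P <+>\<^bsub>R\<^esub> PIdl t"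
    and idem: "nonunits \<subseteq> ideal_pow nonunits 2"
  shows False
proof -
  note iP = primeideal.axioms(1)[OF P(1)]
  have Pn: "P \<subseteq> nonunits"
    using proper_ideal_subset_nonunits[OF iP] primeideal.I_notcarr[OF P(1)] by auto
  have c: "t \<in> carrier R" "t \<otimes> t \<in> nonunits" using t nonunit_mult[OF t(1)] by auto
  have id: "ideal (PIdl (t \<otimes> t)) R" using cgenideal_ideal c by auto
  let ?I = "P <+>\<^bsub>R\<^esub> PIdl (t \<otimes> t)"
  have I: "ideal ?I R" "?I \<subseteq> nonunits"
    using add_ideals[OF iP id] sum_ideals_least[OF nonunits_ideal] Pn PIdl_subset_nonunits[OF c(2)] by simp_all
  obtain Js where Js: "\<And>J. J \<in> set Js \<Longrightarrow> ta_ideal J R" "\<And>J. J \<in> set Js \<Longrightarrow> ideal J R"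
    "\<And>J. J \<in> set Js \<Longrightarrow> J \<subseteq> nonunits" "\<And>J. J \<in> set Js \<Longrightarrow> ?I \<subseteq> J" "?I = iprod Js" "Js \<noteq> []"
    using taf_factorizationE[OF taf I] by metis
  \<comment> \<open>Squaring \<open>p \<oplus> y \<otimes> t\<close> gives an element of
    \<open>P\<close> plus a multiple of \<open>t \<otimes> t\<close>.\<close>
  have radI: "\<exists>j::nat. m [^] j \<in> ?I" if m: "m \<in> nonunits" for m
  proof -
    obtain j :: nat where "m [^] j \<in> P <+>\<^bsub>R\<^esub> PIdl t" using rad[OF m] by auto
    then obtain p y where y: "p \<in> P" "y \<in> carrier R" "m [^] j = p \<oplus> y \<otimes> t"
      unfolding mem_sum_PIdl_iff by auto
    have pc: "p \<in> carrier R" using ideal.Icarr[OF iP y(1)] .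
    have "m [^] (j + j) = (p \<oplus> y \<otimes> t) \<otimes> (p \<oplus> y \<otimes> t)"
      using m nat_pow_mult[of m j j] y(3) by simp
    also have "\<dots> = p \<otimes> (p \<oplus> y \<otimes> t \<oplus> y \<otimes> t) \<oplus> (y \<otimes> y) \<otimes> (t \<otimes> t)"
      using pc y(2) c(1) by (simp add: l_distr r_distr m_ac a_ac)
    finally have "m [^] (j + j) = p \<otimes> (p \<oplus> y \<otimes> t \<oplus> y \<otimes> t) \<oplus> (y \<otimes> y) \<otimes> (t \<otimes> t)" .
    moreover have "p \<otimes> (p \<oplus> y \<otimes> t \<oplus> y \<otimes> t) \<in> P"
      using ideal.I_r_closed[OF iP y(1)] pc y(2) c(1) by simp
    moreover have "(y \<otimes> y) \<otimes> (t \<otimes> t) \<in> PIdl (t \<otimes> t)"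
      unfolding PIdl_iff using y(2) by auto
    ultimately have "m [^] (j + j) \<in> ?I" unfolding ideal_sum_iff by blast
    then show ?thesis by blast
  qed
  have NN: "ideal_prod R nonunits nonunits = nonunits"
    using idem ideal_prod_one[OF nonunits_ideal] ideal_prod_inter[OF nonunits_ideal nonunits_ideal]
    by (auto simp: numeral_2_eq_2)
  have J_eq: "J = nonunits" if J: "J \<in> set Js" for J
  proof -
    have "ideal_prod R nonunits nonunits \<subseteq> J"
    proof (rule ideal_prod_least[OF Js(2)[OF J]])
      fix x y assume xy: "x \<in> nonunits" "y \<in> nonunits"
      obtain i j :: nat where "x [^] i \<in> ?I" "y [^] j \<in> ?I" using radI xy by blast
      then show "x \<otimes> y \<in> J"
        using ta_ideal_radical_prod[OF Js(1)[OF J], of x i y j] Js(4)[OF J] xy by auto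
    qed
    then show ?thesis using NN Js(3)[OF J] by auto
  qed
  have prod_eq: "iprod Ks = nonunits" if "\<forall>K\<in>set Ks. K = nonunits" "Ks \<noteq> []" for Ks
    using that
  proof (induction Ks)
    case (Cons K Ks)
    then show ?case
      using NN ideal_prod_one[OF nonunits_ideal] by (cases "Ks = []") auto
  qed simp
  have "t \<in> ?I" unfolding Js(5) using prod_eq[of Js] J_eq Js(6) t(1) by auto
  then obtain p y where y: "p \<in> P" "y \<in> carrier R" "t = p \<oplus> y \<otimes> (t \<otimes> t)"
    unfolding mem_sum_PIdl_iff by auto
  have "t = p \<oplus> (t \<otimes> y) \<otimes> t"
    using y c(1) by (simp add: m_ac)
  then show False
    using mem_of_eq_add_mult[OF iP y(1) nonunit_mult[OF t(1) y(2)] c(1)] t(2) by simp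
qed

end

context domain
begin

text \<open>Both local contradictions need a nonzero prime strictly below the maximal ideal;
  \<open>t\<close> separates the two after localization as well.\<close>

lemma taf_primes_maximal:
  assumes taf: "taf_domain R" and P: "primeideal P R" "P \<noteq> {\<zero>}"
  shows "maximalideal P R"
proof (rule ccontr)
  assume nonmax: "\<not> maximalideal P R"
  note iP = primeideal.axioms(1)[OF P(1)]
  obtain M where M: "maximalideal M R" "P \<subseteq> M"
    using exists_maximalideal[OF iP] primeideal.I_notcarr[OF P(1)] by metis
  then have "P \<noteq> M" using nonmax by auto
  then obtain t where t: "t \<in> M" "t \<notin> P" using M(2) by auto
  note pM = maximalideal_prime[OF M(1)]
  note iM = primeideal.axioms(1)[OF pM]
  have tc: "t \<in> carrier R" using t ideal.Icarr[OF iM] by simp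
  have id: "ideal (PIdl t) R" using cgenideal_ideal tc by simp
  let ?I = "P <+>\<^bsub>R\<^esub> PIdl t"
  have IM: "?I \<subseteq> M"
    using sum_ideals_least[OF iM M(2) cgenideal_minimal[OF iM t(1)]] .
  \<comment> \<open>Localizing at \<open>Q\<close> instead of \<open>M\<close> makes the new maximal
    ideal the radical of the extension of \<open>?I\<close>, which the idempotent case
    requires.\<close>
  obtain Q where Q: "primeideal Q R" "?I \<subseteq> Q"
    "\<And>a. a \<in> Q \<Longrightarrow> \<exists>s\<in>carrier R - Q. \<exists>n::nat. s \<otimes> a [^] n \<in> ?I"
    using exists_minimal_prime_below[OF add_ideals[OF iP id] IM pM] by metis
  have PQ: "P \<subseteq> Q" and tQ: "t \<in> Q"
    using Q(2) sum_ideals_contain[OF iP id] cgenideal_self[OF tc] by auto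
  let ?E = "localization_at R Q" and ?f = "\<lambda>a. fraction R (carrier R - Q) a \<one>"
  interpret loc: localization_map R ?E "carrier R - Q" ?f by (rule localization_at_map[OF Q(1)])
  interpret E: local_domain ?E by (rule loc.local_domain_at_prime[OF Q(1) refl])
  have non: "E.nonunits = loc.ext Q" by (rule loc.local_domain_at_prime[OF Q(1) refl])
  have tafE: "taf_domain ?E" by (rule loc.taf_domain_ext[OF taf])
  have disj: "P \<inter> (carrier R - Q) = {}" "Q \<inter> (carrier R - Q) = {}" using PQ by auto
  let ?P = "loc.ext P"
  have prP: "primeideal ?P ?E" by (rule loc.prime_ext[OF P(1) disj(1)])
  note iPE = primeideal.axioms(1)[OF prP]
  obtain p where p: "p \<in> P" "p \<noteq> \<zero>" using P(2) ideal_zero[OF iP] by auto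
  then have pc: "p \<in> carrier R" using ideal.Icarr[OF iP] by simp
  have "?f p \<in> ?P" using loc.prime_phi_mem_ext[OF P(1) disj(1) pc] p by simp
  moreover have "?f p \<noteq> \<zero>\<^bsub>?E\<^esub>" using loc.phi_eq_iff[OF pc zero_closed] p(2) loc.phi_zero by simp
  ultimately have ne: "?P \<noteq> {\<zero>\<^bsub>?E\<^esub>}" by auto
  have ft: "?f t \<in> E.nonunits" "?f t \<notin> ?P"
    unfolding non using loc.prime_phi_mem_ext[OF P(1) disj(1) tc] loc.prime_phi_mem_ext[OF Q(1) disj(2) tc] t tQ
    by auto
  have idE: "ideal (PIdl\<^bsub>?E\<^esub> (?f t)) ?E" using loc.E.cgenideal_ideal tc by simp
  let ?K = "?P <+>\<^bsub>?E\<^esub> PIdl\<^bsub>?E\<^esub> (?f t)"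
  have K: "ideal ?K ?E" using loc.E.add_ideals[OF iPE idE] .
  have inK: "?f a \<in> ?K" if a: "a \<in> ?I" for a
  proof -
    obtain b y where b: "b \<in> P" "y \<in> carrier R" "a = b \<oplus> y \<otimes> t"
      using a unfolding mem_sum_PIdl_iff by auto
    have bc: "b \<in> carrier R" using ideal.Icarr[OF iP b(1)] .
    have "?f a = ?f b \<oplus>\<^bsub>?E\<^esub> ?f y \<otimes>\<^bsub>?E\<^esub> ?f t"
      unfolding b(3) using bc b(2) tc by (simp add: loc.phi_add loc.phi_mult)
    moreover have "?f b \<in> ?P" using loc.phi_ext[OF b(1) ideal_subset[OF iP]] .
    moreover have "?f y \<otimes>\<^bsub>?E\<^esub> ?f t \<in> PIdl\<^bsub>?E\<^esub> (?f t)"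
      unfolding loc.E.PIdl_iff using b(2) loc.phi_closed by blast
    ultimately show ?thesis unfolding loc.E.ideal_sum_iff by blast
  qed
  \<comment> \<open>Minimality of \<open>Q\<close> gives a power of the numerator in
    \<open>?I\<close> up to a multiplier outside \<open>Q\<close>; this multiplier and the
    denominators are units of the localization and cancel.\<close>
  have rad: "\<exists>j::nat. m [^]\<^bsub>?E\<^esub> j \<in> ?K" if m: "m \<in> E.nonunits" for m
  proof -
    have "m \<in> loc.ext Q" using m non by simp
    then obtain a s where a: "m \<in> carrier ?E" "a \<in> Q" "s \<in> carrier R - Q" "m \<otimes>\<^bsub>?E\<^esub> ?f s = ?f a"
      by (rule loc.extE)
    obtain s' and n :: nat where s': "s' \<in> carrier R - Q" "s' \<otimes> a [^] n \<in> ?I"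
      using Q(3)[OF a(2)] by auto
    have ac: "a \<in> carrier R" using a(2) ideal.Icarr[OF primeideal.axioms(1)[OF Q(1)]] by simp
    have "?f (s' \<otimes> a [^] n) = ?f s' \<otimes>\<^bsub>?E\<^esub> (m \<otimes>\<^bsub>?E\<^esub> ?f s) [^]\<^bsub>?E\<^esub> n"
      unfolding a(4) using s' ac by (simp add: loc.phi_mult loc.phi_pow)
    also have "\<dots> = m [^]\<^bsub>?E\<^esub> n \<otimes>\<^bsub>?E\<^esub> (?f s' \<otimes>\<^bsub>?E\<^esub> ?f s [^]\<^bsub>?E\<^esub> n)"
      using s' a(1,3) by (simp add: loc.E.nat_pow_distrib loc.E.m_ac)
    finally have "m [^]\<^bsub>?E\<^esub> n \<otimes>\<^bsub>?E\<^esub> (?f s' \<otimes>\<^bsub>?E\<^esub> ?f s [^]\<^bsub>?E\<^esub> n) \<in> ?K"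
      using inK[OF s'(2)] by simp
    moreover have "?f s' \<otimes>\<^bsub>?E\<^esub> ?f s [^]\<^bsub>?E\<^esub> n \<in> Units ?E"
      using loc.units[OF s'(1)] loc.units[OF a(3)] loc.E.Units_pow_closed by simp
    ultimately show ?thesis
      using loc.ideal_cancel_unit[OF K] a(1) by blast
  qed
  show False
  proof (cases "E.nonunits \<subseteq> loc.E.ideal_pow E.nonunits 2")
    case True
    then show False using E.taf_idempotent_prime[OF tafE prP ft rad] by simp
  next
    case False
    then obtain x where "x \<in> E.nonunits" "x \<notin> loc.E.ideal_pow E.nonunits 2" by auto
    then show False using E.taf_nonidempotent_prime[OF tafE prP ne] ft by auto
  qed
qed

end

section \<open>Global results\<close>

context domain
begin

lemma zero_ta_ideal: "ta_ideal {\<zero>} R"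
  by (rule ta_idealI[OF zeroideal]) (auto simp: integral_iff)

lemma zero_has_ta_factorization: "has_ta_factorization R {\<zero>}"
  using zero_ta_ideal ideal_prod_one[OF zeroideal] carrier_one_not_zero
  by (intro has_ta_factorizationI[of "[{\<zero>}]"]) auto

lemma maximal_eq_iff:
  assumes "maximalideal M R" "maximalideal N R" "M \<subseteq> N"
  shows "M = N"
  using maximal_eq_if_subset[OF assms(1) maximalideal.axioms(1)[OF assms(2)] assms(3)]
    maximalideal.I_notcarr[OF assms(2)] by simp

text \<open>The elements that multiply \<open>b\<close> into \<open>I\<close> form an ideal that
  lies in no maximal ideal, so it contains \<open>\<one>\<close>.\<close>

lemma ideal_local_global:
  assumes I: "ideal I R" and b: "b \<in> carrier R"
    and loc: "\<And>M. maximalideal M R \<Longrightarrow> \<exists>s\<in>carrier R - M. s \<otimes> b \<in> I"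
  shows "b \<in> I"
proof -
  let ?J = "{x \<in> carrier R. b \<otimes> x \<in> I}"
  have J: "ideal ?J R" using ideal.helper_max_prime[OF I is_cring b] .
  have "?J = carrier R"
  proof (rule ccontr)
    assume "?J \<noteq> carrier R"
    then obtain M where M: "maximalideal M R" "?J \<subseteq> M" using exists_maximalideal[OF J] by metis
    obtain s where s: "s \<in> carrier R - M" "s \<otimes> b \<in> I" using loc[OF M(1)] by auto
    then have "s \<in> ?J" using b m_comm[of s b] by simp
    then show False using s(1) M(2) by auto
  qed
  then have "\<one> \<in> ?J" by simp
  then show ?thesis using b by simp
qed

text \<open>Replaces chains of primes by a condition that passes easily to localizations and covers
  fields, which have no nonzero prime. In a domain every prime chain can start at zero, so a nonzero
  prime that is not maximal amounts to a chain of length 2.\<close>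

lemma one_dimensional_iff:
  "field R \<or> krull_dim R = 1 \<longleftrightarrow> (\<forall>P. primeideal P R \<longrightarrow> P \<noteq> {\<zero>} \<longrightarrow> maximalideal P R)"
proof
  let ?C = "{n :: nat. \<exists>P. (\<forall>i\<le>n. primeideal (P i) R) \<and> (\<forall>i<n. P i \<subset> P (Suc i))}"
  assume A: "field R \<or> krull_dim R = 1"
  show "\<forall>P. primeideal P R \<longrightarrow> P \<noteq> {\<zero>} \<longrightarrow> maximalideal P R"
  proof (intro allI impI)
    fix P assume P: "primeideal P R" "P \<noteq> {\<zero>}"
    note iP = primeideal.axioms(1)[OF P(1)]
    obtain M where M: "maximalideal M R" "P \<subseteq> M"
      using exists_maximalideal[OF iP] primeideal.I_notcarr[OF P(1)] by metis
    show "maximalideal P R"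
    proof (cases "P = M")
      case True
      then show ?thesis using M by simp
    next
      case False
      obtain p where p: "p \<in> P" "p \<noteq> \<zero>" using P(2) ideal_zero[OF iP] by auto
      have "\<not> field R"
      proof
        assume "field R"
        then have "p \<in> Units R" using p ideal.Icarr[OF iP] field.field_Units by blast
        then show False
          using ideal_unit[OF iP p(1)] primeideal.I_notcarr[OF P(1)] by simp
      qed
      then have dim: "krull_dim R = 1" using A by simp
      define F where "F i = (if i = 0 then {\<zero>} else if i = 1 then P else M)" for i :: nat
      have "{\<zero>} \<subset> P" using P(2) ideal_zero[OF iP] by auto
      then have "\<forall>i\<le>2. primeideal (F i) R" "\<forall>i<2. F i \<subset> F (Suc i)"
        using P(1) zeroprimeideal maximalideal_prime[OF M(1)] M(2) False
        unfolding F_def by (auto simp: less_2_cases_iff)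
      then have "2 \<in> ?C" by blast
      then have "enat 2 \<le> krull_dim R" unfolding krull_dim_def by (rule SUP_upper)
      then show ?thesis unfolding dim by (simp add: one_enat_def)
    qed
  qed
next
  let ?C = "{n :: nat. \<exists>P. (\<forall>i\<le>n. primeideal (P i) R) \<and> (\<forall>i<n. P i \<subset> P (Suc i))}"
  assume max: "\<forall>P. primeideal P R \<longrightarrow> P \<noteq> {\<zero>} \<longrightarrow> maximalideal P R"
  show "field R \<or> krull_dim R = 1"
  proof (rule disjCI)
    assume dim: "krull_dim R \<noteq> 1"
    show "field R"
    proof (rule ccontr)
      assume nf: "\<not> field R"
      have "{\<zero>} \<noteq> carrier R" using carrier_one_not_zero by auto
      then obtain M where M: "maximalideal M R" "{\<zero>} \<subseteq> M"
        using exists_maximalideal[OF zeroideal] by metis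
      then have ne: "{\<zero>} \<subset> M" using nf zeromaximalideal_eq_field by auto
      define F where "F i = (if i = 0 then {\<zero>} else M)" for i :: nat
      have "\<forall>i\<le>1. primeideal (F i) R" "\<forall>i<1. F i \<subset> F (Suc i)"
        using ne zeroprimeideal maximalideal_prime[OF M(1)] unfolding F_def by auto
      then have "1 \<in> ?C" by blast
      then have "enat 1 \<le> krull_dim R" unfolding krull_dim_def by (rule SUP_upper)
      moreover have "krull_dim R \<le> enat 1"
        unfolding krull_dim_def
      proof (rule SUP_least)
        fix n assume "n \<in> ?C"
        then obtain P where P: "\<And>i. i \<le> n \<Longrightarrow> primeideal (P i) R" "\<And>i. i < n \<Longrightarrow> P i \<subset> P (Suc i)"
          by auto
        have "n \<le> 1"
        proof (rule ccontr)
          assume "\<not> n \<le> 1"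
          then have n: "0 \<le> n" "1 \<le> n" "2 \<le> n" "0 < n" "1 < n" by auto
          have sub: "P 0 \<subset> P 1" "P 1 \<subset> P 2"
            using P(2)[OF n(4)] P(2)[OF n(5)] by (simp_all add: numeral_2_eq_2)
          then have "P 1 \<noteq> {\<zero>}"
            using ideal_zero[OF primeideal.axioms(1)[OF P(1)[OF n(1)]]] by auto
          then have "maximalideal (P 1) R" using max P(1)[OF n(2)] by simp
          then have "P 2 = P 1"
            using maximal_eq_if_subset[of "P 1" "P 2"] primeideal.axioms(1)[OF P(1)[OF n(3)]]
              primeideal.I_notcarr[OF P(1)[OF n(3)]] sub by auto
          then show False using sub by simp
        qed
        then show "enat n \<le> enat 1" by simp
      qed
      ultimately show False using dim by (simp add: one_enat_def)
    qed
  qed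
qed

text \<open>A maximal ideal containing \<open>x\<close> contains one of the finitely many TA-factors
  of \<open>PIdl x\<close>, and no factor lies in three maximal ideals.\<close>

lemma ta_finite_character:
  assumes max: "\<And>P. \<lbrakk>primeideal P R; P \<noteq> {\<zero>}\<rbrakk> \<Longrightarrow> maximalideal P R"
    and ta: "\<And>x. \<lbrakk>x \<in> carrier R; x \<noteq> \<zero>; x \<notin> Units R\<rbrakk> \<Longrightarrow> has_ta_factorization R (PIdl x)"
  shows "finite_character R"
  unfolding finite_character_def
proof
  fix x assume x: "x \<in> carrier R - {\<zero>}"
  have one_J: "finite {M. maximalideal M R \<and> J \<subseteq> M}" if J: "ta_ideal J R" "x \<in> J" for J
  proof (rule ccontr)
    let ?F = "{M. maximalideal M R \<and> J \<subseteq> M}"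
    note iJ = ta_idealD(1)[OF J(1)]
    assume "infinite ?F"
    then obtain B where B: "B \<subseteq> ?F" "card B = 3" using infinite_arbitrarily_large[of ?F 3] by metis
    obtain M1 M2 M3 where "B = {M1, M2, M3}" and neq: "M1 \<noteq> M2" "M1 \<noteq> M3" "M2 \<noteq> M3"
      using card_3_iff[THEN iffD1, OF B(2)] by (elim exE conjE)
    then have M: "M1 \<in> ?F" "M2 \<in> ?F" "M3 \<in> ?F" using B(1) by simp_all
    \<comment> \<open>A prime between \<open>J\<close> and \<open>M\<close> contains the nonzero
      \<open>x\<close>, so it is maximal and equals \<open>M\<close>; hence every maximal ideal over
      \<open>J\<close> is a minimal prime over \<open>J\<close>.\<close>
    have min: "\<exists>s\<in>carrier R - M. \<exists>n::nat. s \<otimes> a [^] n \<in> J" if MF: "M \<in> ?F" and a: "a \<in> M" for M a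
    proof -
      have pM: "primeideal M R" using MF maximalideal_prime by simp
      have "J \<subseteq> M" using MF by simp
      then obtain Q where Q: "primeideal Q R" "J \<subseteq> Q" "Q \<subseteq> M"
        "\<And>a. a \<in> Q \<Longrightarrow> \<exists>s\<in>carrier R - Q. \<exists>n::nat. s \<otimes> a [^] n \<in> J"
        using exists_minimal_prime_below[OF iJ _ pM] by metis
      note \<open>Q \<subseteq> M\<close>
      moreover have "Q \<noteq> {\<zero>}" using J(2) Q(2) x by auto
      ultimately have "Q = M" using maximal_eq_iff[OF max[OF Q(1)]] MF by simp
      then show ?thesis using Q(4) a by simp
    qed
    have inc: "\<not> M \<subseteq> N" if "M \<in> ?F" "N \<in> ?F" "M \<noteq> N" for M N
      using maximal_eq_iff[of M N] that by auto
    have pr: "primeideal M R" "J \<subseteq> M" if "M \<in> ?F" for M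
      using maximalideal_prime that by auto
    show False
      using ta_ideal_three_primes[OF J(1) pr(1)[OF M(1)] pr(1)[OF M(2)] pr(1)[OF M(3)]
          pr(2)[OF M(1)] pr(2)[OF M(2)] pr(2)[OF M(3)]
          inc[OF M(1,2) neq(1)] inc[OF M(1,3) neq(2)] inc[OF M(2,1) neq(1)[symmetric]] inc[OF M(2,3) neq(3)]
          min[OF M(1)] min[OF M(2)]] .
  qed
  show "finite {M. maximalideal M R \<and> x \<in> M}"
  proof (cases "x \<in> Units R")
    case True
    have "x \<notin> M" if M: "maximalideal M R" for M
      using ideal_unit[OF maximalideal.axioms(1)[OF M] _ True] maximalideal.I_notcarr[OF M] by auto
    then have "{M. maximalideal M R \<and> x \<in> M} = {}" by auto
    then show ?thesis by (simp only: finite.emptyI)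
  next
    case False
    obtain Js where Js: "\<forall>J\<in>set Js. ta_ideal J R \<and> ideal J R \<and> J \<noteq> carrier R" "PIdl x = iprod Js"
      using ta[OF _ _ False] x by (auto elim: has_ta_factorizationE)
    have "x \<in> J" if "J \<in> set Js" for J
      using iprod_subset[of Js J] Js that cgenideal_self[of x] x by auto
    then have "finite (\<Union>J\<in>set Js. {M. maximalideal M R \<and> J \<subseteq> M})"
      using one_J Js(1) by simp
    moreover have "{M. maximalideal M R \<and> x \<in> M} \<subseteq> (\<Union>J\<in>set Js. {M. maximalideal M R \<and> J \<subseteq> M})"
    proof
      fix M assume "M \<in> {M. maximalideal M R \<and> x \<in> M}"
      then have M: "maximalideal M R" "x \<in> M" by auto
      have "iprod Js \<subseteq> M"
        using cgenideal_minimal[OF maximalideal.axioms(1)[OF M(1)] M(2)] Js(2) by simp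
      then show "M \<in> (\<Union>J\<in>set Js. {M. maximalideal M R \<and> J \<subseteq> M})"
        using prime_iprod[OF maximalideal_prime[OF M(1)], of Js] Js(1) M(1) by auto
    qed
    ultimately show ?thesis by (rule finite_subset[rotated])
  qed
qed

text \<open>Once the chain contains a nonzero \<open>a\<close>, it is already the unit ideal at
  every maximal ideal that misses \<open>a\<close>. By finite character only finitely many
  localizations remain, and their stabilization indices have a maximum.\<close>

lemma accp_local_global:
  assumes fc: "finite_character R"
    and loc: "\<And>M. maximalideal M R \<Longrightarrow> accp (localization_at R M)"
  shows "accp R"
  unfolding accp_def
proof (intro allI impI)
  fix I :: "nat \<Rightarrow> 'a set"
  assume I: "(\<forall>n. principalideal (I n) R) \<and> (\<forall>n. I n \<subseteq> I (Suc n))"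
  have iI: "ideal (I n) R" for n using I principalideal.axioms(1) by auto
  have mono: "I m \<subseteq> I n" if "m \<le> n" for m n
    using lift_Suc_mono_le[of I] I that by auto
  show "\<exists>N. \<forall>n\<ge>N. I n = I N"
  proof (cases "\<forall>n. I n = {\<zero>}")
    case True
    then show ?thesis by auto
  next
    case False
    then obtain n0 where "I n0 \<noteq> {\<zero>}" by auto
    then obtain a where a: "a \<in> I n0" "a \<noteq> \<zero>" using ideal_zero[OF iI[of n0]] by auto
    have ac: "a \<in> carrier R" using ideal.Icarr[OF iI a(1)] .
    let ?F = "{M. maximalideal M R \<and> a \<in> M}"
    have fin: "finite ?F" using fc ac a(2) unfolding finite_character_def by auto
    have "\<exists>N. \<forall>n\<ge>N. \<forall>b\<in>I n. \<exists>s\<in>carrier R - M. s \<otimes> b \<in> I N" if M: "maximalideal M R" for M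
    proof -
      let ?E = "localization_at R M" and ?f = "\<lambda>a. fraction R (carrier R - M) a \<one>"
      interpret loc: localization_map R ?E "carrier R - M" ?f
        by (rule localization_at_map[OF maximalideal_prime[OF M]])
      have "principalideal (loc.ext (I n)) ?E" for n
      proof -
        have "principalideal (I n) R" using I by simp
        then obtain c where c: "c \<in> carrier R" "I n = PIdl c" unfolding principalideal_iff by auto
        then have "loc.ext (I n) = PIdl\<^bsub>?E\<^esub> (?f c)" using loc.ext_PIdl by simp
        then show ?thesis using loc.E.cgenideal_is_principalideal loc.phi_closed[OF c(1)] by simp
      qed
      moreover have "loc.ext (I n) \<subseteq> loc.ext (I (Suc n))" for n using loc.ext_mono I by simp
      ultimately have "\<exists>N. \<forall>n\<ge>N. loc.ext (I n) = loc.ext (I N)"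
        using loc[OF M, unfolded accp_def, THEN spec, of "\<lambda>n. loc.ext (I n)"] by (elim mp) simp
      then obtain N where N: "\<forall>n\<ge>N. loc.ext (I n) = loc.ext (I N)" ..
      have "\<exists>s\<in>carrier R - M. s \<otimes> b \<in> I N" if n: "n \<ge> N" and b: "b \<in> I n" for n b
      proof -
        have "?f b \<in> loc.ext (I N)"
          using loc.phi_ext[OF b ideal_subset[OF iI]] N[rule_format, OF n] by simp
        then show ?thesis using loc.phi_mem_ext[OF iI ideal.Icarr[OF iI b]] by simp
      qed
      then show ?thesis by blast
    qed
    then obtain N where N: "\<And>M n b. \<lbrakk>maximalideal M R; n \<ge> N M; b \<in> I n\<rbrakk>
        \<Longrightarrow> \<exists>s\<in>carrier R - M. s \<otimes> b \<in> I (N M)"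
      by metis
    \<comment> \<open>Including \<open>n0\<close> ensures that \<open>a\<close> lies in
      \<open>I N0\<close>, which settles the maximal ideals not containing \<open>a\<close>.\<close>
    define N0 where "N0 = Max (insert n0 (N ` ?F))"
    have N0: "n0 \<le> N0" "\<And>M. M \<in> ?F \<Longrightarrow> N M \<le> N0"
      unfolding N0_def using fin by auto
    have "I n = I N0" if n: "n \<ge> N0" for n
    proof
      show "I N0 \<subseteq> I n" using mono[OF n] .
      show "I n \<subseteq> I N0"
      proof
        fix b assume b: "b \<in> I n"
        have bc: "b \<in> carrier R" using ideal.Icarr[OF iI b] .
        show "b \<in> I N0"
        proof (rule ideal_local_global[OF iI bc])
          fix M assume M: "maximalideal M R"
          show "\<exists>s\<in>carrier R - M. s \<otimes> b \<in> I N0"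
          proof (cases "a \<in> M")
            case True
            then have le: "N M \<le> N0" using N0(2) M by simp
            then obtain s where "s \<in> carrier R - M" "s \<otimes> b \<in> I (N M)"
              using N[OF M _ b] n by auto
            then show ?thesis using mono[OF le] by auto
          next
            case False
            have "a \<otimes> b \<in> I N0"
              using ideal.I_r_closed[OF iI _ bc] mono[OF N0(1)] a(1) by auto
            then show ?thesis using False ac by auto
          qed
        qed
      qed
    qed
    then show ?thesis by auto
  qed
qed

text \<open>The local factors are contracted. Each contraction contains the squares of the elements
  of \<open>M\<close>, so no other maximal ideal contains it, and the product of the contractions
  agrees with \<open>I\<close> after localization at \<open>M\<close>.\<close>

lemma local_length_factors:
  assumes M: "maximalideal M R" and I: "ideal I R" "I \<noteq> {\<zero>}" "I \<subseteq> M"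
    and v: "local_domain.length_function (localization_at R M) v"
  shows "\<exists>Js. Js \<noteq> [] \<and>
      (\<forall>J\<in>set Js. ta_ideal J R \<and> ideal J R \<and> J \<subseteq> M \<and> (\<forall>N. maximalideal N R \<longrightarrow> N \<noteq> M \<longrightarrow> \<not> J \<subseteq> N)) \<and>
      (\<forall>b\<in>carrier R. (\<exists>s\<in>carrier R - M. s \<otimes> b \<in> iprod Js) \<longleftrightarrow> (\<exists>s\<in>carrier R - M. s \<otimes> b \<in> I))"
proof -
  note pM = maximalideal_prime[OF M]
  let ?E = "localization_at R M" and ?f = "\<lambda>a. fraction R (carrier R - M) a \<one>"
  interpret loc: localization_map R ?E "carrier R - M" ?f by (rule localization_at_map[OF pM])
  interpret E: local_domain ?E by (rule loc.local_domain_at_prime[OF pM refl])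
  have non: "carrier ?E - Units ?E = loc.ext M" by (rule loc.local_domain_at_prime[OF pM refl])
  have disj: "M \<inter> (carrier R - M) = {}" by auto
  have ext: "ideal (loc.ext I) ?E" "loc.ext I \<noteq> carrier ?E"
    using loc.ext_ideal[OF I(1)] loc.ext_proper_iff[OF I(1)] I(3) by auto
  have "loc.ext I \<noteq> {\<zero>\<^bsub>?E\<^esub>}"
  proof
    assume eq: "loc.ext I = {\<zero>\<^bsub>?E\<^esub>}"
    obtain a where a: "a \<in> I" "a \<noteq> \<zero>" using I(2) ideal_zero[OF I(1)] by auto
    have "?f a \<in> loc.ext I" using loc.phi_ext[OF a(1) ideal_subset[OF I(1)]] .
    then have "?f a = ?f \<zero>" using eq loc.phi_zero by simp
    then show False using loc.phi_eq_iff[OF ideal.Icarr[OF I(1) a(1)] zero_closed] a(2) by simp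
  qed
  then obtain Ks where Ks: "Ks \<noteq> []"
    "\<forall>K\<in>set Ks. ideal K ?E \<and> K \<noteq> carrier ?E \<and> (\<forall>x\<in>loc.ext M. \<forall>y\<in>loc.ext M. x \<otimes>\<^bsub>?E\<^esub> y \<in> K)"
    "loc.ext I = loc.E.iprod Ks"
    using E.length_function_factorization[OF v ext(1) _ ext(2)] unfolding non by metis
  let ?Js = "map loc.contr Ks"
  have Jid: "ideal J R" if "J \<in> set ?Js" for J using that Ks(2) loc.contr_ideal by auto
  have iJs: "ideal (iprod ?Js) R" using iprod_ideal[of ?Js] Jid by blast
  have "ta_ideal J R \<and> J \<subseteq> M \<and> (\<forall>N. maximalideal N R \<longrightarrow> N \<noteq> M \<longrightarrow> \<not> J \<subseteq> N)" if J: "J \<in> set ?Js" for J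
  proof (intro conjI allI impI)
    obtain K where K: "K \<in> set Ks" "J = loc.contr K" using J by auto
    then have iK: "ideal K ?E" "K \<noteq> carrier ?E" "\<And>x y. \<lbrakk>x \<in> loc.ext M; y \<in> loc.ext M\<rbrakk> \<Longrightarrow> x \<otimes>\<^bsub>?E\<^esub> y \<in> K"
      using Ks(2) by auto
    have "ta_ideal K ?E"
      using E.ta_ideal_if_contains_square[OF iK(1)] iK(3) unfolding non by simp
    then show "ta_ideal J R" unfolding K(2) by (rule loc.ta_contr)
    have "K \<subseteq> loc.ext M" using E.proper_ideal_subset_nonunits[OF iK(1,2)] non by simp
    then show "J \<subseteq> M"
      unfolding K(2) loc.contr_def using loc.prime_phi_mem_ext[OF pM disj] by auto
    fix N assume N: "maximalideal N R" "N \<noteq> M"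
    have "\<not> M \<subseteq> N" using maximal_eq_iff[OF M N(1)] N(2) by auto
    then obtain m where m: "m \<in> M" "m \<notin> N" by auto
    have mc: "m \<in> carrier R" using ideal.Icarr[OF maximalideal.axioms(1)[OF M] m(1)] .
    have "?f m \<in> loc.ext M" using loc.prime_phi_mem_ext[OF pM disj mc] m(1) by simp
    then have "?f (m \<otimes> m) \<in> K" using iK(3) loc.phi_mult[OF mc mc] by simp
    then have "m \<otimes> m \<in> J" unfolding K(2) loc.contr_def using mc by simp
    moreover have "m \<otimes> m \<notin> N"
      using primeideal.I_prime[OF maximalideal_prime[OF N(1)] mc mc] m(2) by auto
    ultimately show "\<not> J \<subseteq> N" by auto
  qed
  moreover have "loc.ext (iprod ?Js) = loc.ext I"
  proof -
    have "loc.ext (iprod ?Js) = loc.E.iprod (map loc.ext ?Js)" using loc.ext_iprod[of ?Js] Jid by blast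
    also have "map loc.ext ?Js = Ks" using Ks(2) loc.ext_contr by (simp add: map_idI)
    finally show ?thesis using Ks(3) by simp
  qed
  then have "(\<exists>s\<in>carrier R - M. s \<otimes> b \<in> iprod ?Js) \<longleftrightarrow> (\<exists>s\<in>carrier R - M. s \<otimes> b \<in> I)"
    if b: "b \<in> carrier R" for b
    using loc.phi_mem_ext[OF iJs b] loc.phi_mem_ext[OF I(1) b] by simp
  ultimately show ?thesis using Ks(1) Jid by (intro exI[of _ ?Js]) auto
qed

text \<open>The candidate is the product of the contracted factors over all maximal ideals
  containing \<open>I\<close>; equality with \<open>I\<close> is tested at each maximal ideal
  \<open>N\<close>. If \<open>N\<close> does not contain \<open>I\<close>, both sides are locally
  the unit ideal; otherwise only the factors belonging to \<open>N\<close> count there.\<close>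

lemma local_length_imp_taf:
  assumes fc: "finite_character R"
    and loc: "\<And>M. maximalideal M R \<Longrightarrow> \<exists>v. local_domain.length_function (localization_at R M) v"
  shows "taf_domain R"
  unfolding taf_domain_def
proof (intro conjI allI impI)
  show "domain R" by (rule domain_axioms)
  fix I assume "ideal I R \<and> I \<noteq> carrier R"
  then have I: "ideal I R" "I \<noteq> carrier R" by auto
  show "has_ta_factorization R I"
  proof (cases "I = {\<zero>}")
    case True
    then show ?thesis using zero_has_ta_factorization by simp
  next
    case False
    then obtain a where a: "a \<in> I" "a \<noteq> \<zero>" using ideal_zero[OF I(1)] by auto
    let ?F = "{M. maximalideal M R \<and> I \<subseteq> M}"
    have "finite {M. maximalideal M R \<and> a \<in> M}"
      using fc a ideal.Icarr[OF I(1)] unfolding finite_character_def by auto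
    then have "finite ?F" by (rule finite_subset[rotated]) (use a in auto)
    \<comment> \<open>Distinctness ensures that in a split of \<open>Ms\<close> at \<open>N\<close>
      the two remaining parts involve only other maximal ideals.\<close>
    then obtain Ms where Ms: "set Ms = ?F" "distinct Ms" using finite_distinct_list by metis
    define good where "good M Js \<longleftrightarrow> Js \<noteq> [] \<and>
      (\<forall>J\<in>set Js. ta_ideal J R \<and> ideal J R \<and> J \<subseteq> M \<and> (\<forall>N. maximalideal N R \<longrightarrow> N \<noteq> M \<longrightarrow> \<not> J \<subseteq> N)) \<and>
      (\<forall>b\<in>carrier R. (\<exists>s\<in>carrier R - M. s \<otimes> b \<in> iprod Js) \<longleftrightarrow> (\<exists>s\<in>carrier R - M. s \<otimes> b \<in> I))" for M Js
    have "\<exists>Js. good M Js" if "M \<in> ?F" for M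
      using local_length_factors[of M I] loc[of M] that I(1) False unfolding good_def by blast
    then obtain f where f: "\<And>M. M \<in> ?F \<Longrightarrow> good M (f M)" by metis
    have fD: "ta_ideal J R" "ideal J R" "J \<subseteq> M" "\<And>N. \<lbrakk>maximalideal N R; N \<noteq> M\<rbrakk> \<Longrightarrow> \<not> J \<subseteq> N"
      if "M \<in> ?F" "J \<in> set (f M)" for M J
      using f[OF that(1)] that(2) unfolding good_def by auto
    have floc: "(\<exists>s\<in>carrier R - M. s \<otimes> b \<in> iprod (f M)) \<longleftrightarrow> (\<exists>s\<in>carrier R - M. s \<otimes> b \<in> I)"
      if "M \<in> ?F" "b \<in> carrier R" for M b
      using f[OF that(1)] that(2) unfolding good_def by auto
    let ?L = "\<lambda>Ns. concat (map f Ns)"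
    have L_ideals: "ideal J R" if h: "set Ns \<subseteq> ?F" "J \<in> set (?L Ns)" for Ns J
    proof -
      obtain M where "M \<in> ?F" "J \<in> set (f M)" using h by auto
      then show ?thesis by (rule fD(2))
    qed
    have L_ideal: "ideal (iprod (?L Ns)) R" if "set Ns \<subseteq> ?F" for Ns
      using L_ideals[OF that] by (rule iprod_ideal)
    have L_split: "iprod (?L Ns) =
        ideal_prod R (iprod (?L As)) (ideal_prod R (iprod (f N)) (iprod (?L Bs)))"
      if split: "Ns = As @ N # Bs" and Ns: "set Ns \<subseteq> ?F" for Ns As N Bs
    proof -
      have "?L Ns = ?L As @ (f N @ ?L Bs)" using split by simp
      moreover have "ideal J R" if "J \<in> set (?L As) \<union> set (f N @ ?L Bs)" for J
        using L_ideals[OF Ns, of J] that split by auto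
      ultimately show ?thesis
        using iprod_append[of "?L As" "f N @ ?L Bs"] iprod_append[of "f N" "?L Bs"] by (simp del: foldr_append)
    qed
    \<comment> \<open>Since \<open>N\<close> is prime and contains none of the factors belonging to
      other maximal ideals, it does not contain their product, which is therefore locally trivial at
      \<open>N\<close>.\<close>
    have escape: "\<exists>s\<in>iprod (?L Ns). s \<notin> N"
      if Ns: "set Ns \<subseteq> ?F" and N: "maximalideal N R" "N \<notin> set Ns" for Ns N
    proof (rule ccontr)
      assume "\<not> ?thesis"
      then have "iprod (?L Ns) \<subseteq> N" by auto
      then obtain J where "J \<in> set (?L Ns)" "J \<subseteq> N"
        using prime_iprod[OF maximalideal_prime[OF N(1)] L_ideals[OF Ns]] by blast
      moreover from this(1) obtain M where "M \<in> set Ns" "J \<in> set (f M)" by auto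
      moreover from this(1) have "M \<in> ?F" "N \<noteq> M" using Ns N(2) by auto
      ultimately show False using fD(4)[of M J N] N(1) by simp
    qed
    have LF: "set Ms \<subseteq> ?F" using Ms(1) by simp
    have iL: "ideal (iprod (?L Ms)) R" using L_ideal[OF LF] .
    have "I = iprod (?L Ms)"
    proof
      show "I \<subseteq> iprod (?L Ms)"
      proof
        fix b assume b: "b \<in> I"
        have bc: "b \<in> carrier R" using ideal.Icarr[OF I(1) b] .
        show "b \<in> iprod (?L Ms)"
        proof (rule ideal_local_global[OF iL bc])
          fix N assume N: "maximalideal N R"
          note pN = maximalideal_prime[OF N]
          show "\<exists>s\<in>carrier R - N. s \<otimes> b \<in> iprod (?L Ms)"
          proof (cases "N \<in> ?F")
            case False
            then obtain s where s: "s \<in> iprod (?L Ms)" "s \<notin> N" using escape[OF LF N] Ms(1) by auto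
            then show ?thesis
              using ideal.I_r_closed[OF iL s(1) bc] ideal.Icarr[OF iL s(1)] by auto
          next
            case True
            then obtain As Bs where split: "Ms = As @ N # Bs" using split_list[of N Ms] Ms(1) by auto
            then have nin: "N \<notin> set As" "N \<notin> set Bs" "set As \<subseteq> ?F" "set Bs \<subseteq> ?F"
              using Ms by auto
            \<comment> \<open>These elements outside \<open>N\<close> make up for the factors before
              and after those of \<open>N\<close>: multiplying by them moves an element of
              \<open>iprod (f N)\<close> into the whole product.\<close>
            obtain u w where u: "u \<in> iprod (?L As)" "u \<notin> N" and w: "w \<in> iprod (?L Bs)" "w \<notin> N"
              using escape[OF nin(3) N nin(1)] escape[OF nin(4) N nin(2)] by auto
            have "\<exists>s\<in>carrier R - N. s \<otimes> b \<in> I"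
              using b bc one_notin_prime[OF pN]
              by (intro bexI[of _ \<one>]) auto
            then obtain s where s: "s \<in> carrier R - N" "s \<otimes> b \<in> iprod (f N)" using floc[OF True bc] by auto
            have c: "u \<in> carrier R" "w \<in> carrier R" "s \<in> carrier R"
              using u w s ideal.Icarr[OF L_ideal[OF nin(3)]] ideal.Icarr[OF L_ideal[OF nin(4)]] by auto
            have "u \<otimes> ((s \<otimes> b) \<otimes> w) \<in> iprod (?L Ms)"
              unfolding L_split[OF split LF]
              by (intro ideal_prod.prod u(1) s(2) w(1))
            moreover have "u \<otimes> ((s \<otimes> b) \<otimes> w) = (u \<otimes> s \<otimes> w) \<otimes> b"
              using c bc by (simp add: m_ac)
            ultimately have "(u \<otimes> s \<otimes> w) \<otimes> b \<in> iprod (?L Ms)" by simp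
            moreover have "u \<otimes> s \<notin> N" using primeideal.I_prime[OF pN c(1,3)] u(2) s(1) by auto
            then have "u \<otimes> s \<otimes> w \<notin> N"
              using primeideal.I_prime[OF pN, of "u \<otimes> s" w] w(2) c by auto
            ultimately show ?thesis using c by auto
          qed
        qed
      qed
      show "iprod (?L Ms) \<subseteq> I"
      proof
        fix b assume b: "b \<in> iprod (?L Ms)"
        have bc: "b \<in> carrier R" using ideal.Icarr[OF iL b] .
        show "b \<in> I"
        proof (rule ideal_local_global[OF I(1) bc])
          fix N assume N: "maximalideal N R"
          note pN = maximalideal_prime[OF N]
          show "\<exists>s\<in>carrier R - N. s \<otimes> b \<in> I"
          proof (cases "N \<in> ?F")
            case False
            then obtain s where s: "s \<in> I" "s \<notin> N" using N by auto
            then show ?thesis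
              using ideal.I_r_closed[OF I(1) s(1) bc] ideal.Icarr[OF I(1) s(1)] by auto
          next
            case True
            then obtain As Bs where split: "Ms = As @ N # Bs" using split_list[of N Ms] Ms(1) by auto
            then have sub: "set As \<subseteq> ?F" "set Bs \<subseteq> ?F" using Ms by auto
            have idN: "ideal (iprod (f N)) R" using iprod_ideal[of "f N"] fD(2)[OF True] by blast
            have "iprod (?L Ms) \<subseteq> iprod (f N)"
              using L_split[OF split LF]
                ideal_prod_inter[OF L_ideal[OF sub(1)] ideal_prod_is_ideal[OF idN L_ideal[OF sub(2)]]]
                ideal_prod_inter[OF idN L_ideal[OF sub(2)]] by auto
            then have "\<exists>s\<in>carrier R - N. s \<otimes> b \<in> iprod (f N)"
              using b bc one_notin_prime[OF pN]
              by (intro bexI[of _ \<one>]) auto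
            then show ?thesis using floc[OF True bc] by simp
          qed
        qed
      qed
    qed
    moreover have "?L Ms \<noteq> []"
    proof -
      obtain M where "maximalideal M R" "I \<subseteq> M" using exists_maximalideal[OF I] by metis
      then have M: "M \<in> set Ms" "M \<in> ?F" using Ms(1) by auto
      then have "f M \<noteq> []" using f unfolding good_def by blast
      then show ?thesis using M(1) by auto
    qed
    moreover have "ta_ideal J R" "J \<noteq> carrier R" if J: "J \<in> set (?L Ms)" for J
    proof -
      obtain M where M: "M \<in> ?F" "J \<in> set (f M)" using J LF by auto
      then show "ta_ideal J R" using fD(1) by simp
      show "J \<noteq> carrier R"
        using fD(3)[OF M] M(1) maximalideal.I_notcarr ideal_subset[OF maximalideal.axioms(1)] by blast
    qed
    ultimately show ?thesis by (intro has_ta_factorizationI[of "?L Ms"]) auto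
  qed
qed

text \<open>Both hypotheses descend to the localization: a nonzero prime contracts to a nonzero
  prime, and a principal ideal is generated by the image of a numerator.\<close>

lemma principal_ta_imp_local_length:
  assumes max: "\<And>P. \<lbrakk>primeideal P R; P \<noteq> {\<zero>}\<rbrakk> \<Longrightarrow> maximalideal P R"
    and ta: "\<And>x. \<lbrakk>x \<in> carrier R; x \<noteq> \<zero>; x \<notin> Units R\<rbrakk> \<Longrightarrow> has_ta_factorization R (PIdl x)"
    and M: "maximalideal M R"
  shows "\<exists>v. local_domain.length_function (localization_at R M) v"
proof -
  note pM = maximalideal_prime[OF M]
  let ?E = "localization_at R M" and ?f = "\<lambda>a. fraction R (carrier R - M) a \<one>"
  interpret loc: localization_map R ?E "carrier R - M" ?f by (rule localization_at_map[OF pM])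
  interpret E: local_domain ?E by (rule loc.local_domain_at_prime[OF pM refl])
  have non: "carrier ?E - Units ?E = loc.ext M" by (rule loc.local_domain_at_prime[OF pM refl])
  have disj: "M \<inter> (carrier R - M) = {}" by auto
  have dim: "P = carrier ?E - Units ?E" if P: "primeideal P ?E" "P \<noteq> {\<zero>\<^bsub>?E\<^esub>}" for P
  proof -
    note iP = primeideal.axioms(1)[OF P(1)]
    have "loc.contr P \<noteq> {\<zero>}"
    proof
      assume "loc.contr P = {\<zero>}"
      then have "P = loc.ext {\<zero>}" using loc.ext_contr[OF iP] by simp
      also have "\<dots> = loc.ext (PIdl \<zero>)" using cgenideal_eq_genideal[OF zero_closed] genideal_zero by simp
      also have "\<dots> = PIdl\<^bsub>?E\<^esub> \<zero>\<^bsub>?E\<^esub>" using loc.ext_PIdl[OF zero_closed] loc.phi_zero by simp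
      also have "\<dots> = {\<zero>\<^bsub>?E\<^esub>}"
        using loc.E.cgenideal_eq_genideal[OF loc.E.zero_closed] loc.E.genideal_zero by simp
      finally show False using P(2) by simp
    qed
    then have mx: "maximalideal (loc.contr P) R" using max loc.prime_contr[OF P(1)] by simp
    have "P \<subseteq> loc.ext M"
      using E.proper_ideal_subset_nonunits[OF iP] primeideal.I_notcarr[OF P(1)] non by auto
    then have "loc.contr P \<subseteq> M"
      unfolding loc.contr_def using loc.prime_phi_mem_ext[OF pM disj] by auto
    then have "loc.contr P = M" using maximal_eq_iff[OF mx M] by simp
    then show ?thesis using loc.ext_contr[OF iP] non by simp
  qed
  have taE: "has_ta_factorization ?E (PIdl\<^bsub>?E\<^esub> x)" if x: "x \<in> carrier ?E - Units ?E" "x \<noteq> \<zero>\<^bsub>?E\<^esub>" for x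
  proof -
    obtain a where a: "a \<in> carrier R" "PIdl\<^bsub>?E\<^esub> x = PIdl\<^bsub>?E\<^esub> (?f a)" "a \<noteq> \<zero>"
      using loc.PIdl_of_numerator[of x] x by (metis DiffD1)
    have eq: "PIdl\<^bsub>?E\<^esub> x = loc.ext (PIdl a)" using a(2) loc.ext_PIdl[OF a(1)] by simp
    have ne: "PIdl\<^bsub>?E\<^esub> x \<noteq> carrier ?E" using E.PIdl_nonunit[OF x(1)] .
    have "a \<notin> Units R"
    proof
      assume "a \<in> Units R"
      then have "PIdl a = carrier R" using PIdl_eq_carrier_iff[OF a(1)] by simp
      then show False using ne eq loc.ext_carrier by simp
    qed
    then show ?thesis using loc.has_ta_factorization_ext[OF ta[OF a(1,3)]] ne unfolding eq by simp
  qed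
  have "atomic ?E" "E.atoms_divide_products"
    using E.principal_ta_imp_length dim taE by blast+
  then obtain v where "E.length_function v" by (rule E.exists_length_function)
  then show ?thesis by (rule exI[of E.length_function])
qed

text \<open>A length function yields all three local properties. Conversely, each leads to atomicity
  and \<open>atoms_divide_products\<close>: ACCP implies atomicity, a PVD has the divisibility, and
  a TAF localization is handled through the maximality of its own nonzero primes.\<close>

lemma local_conditions:
  assumes M: "maximalideal M R"
  shows "taf_domain (localization_at R M) \<longleftrightarrow> (\<exists>v. local_domain.length_function (localization_at R M) v)"
    and "atomic (localization_at R M) \<and> pvd (localization_at R M) \<longleftrightarrow> (\<exists>v. local_domain.length_function (localization_at R M) v)"
    and "pvd (localization_at R M) \<and> accp (localization_at R M) \<longleftrightarrow> (\<exists>v. local_domain.length_function (localization_at R M) v)"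
proof -
  note pM = maximalideal_prime[OF M]
  let ?E = "localization_at R M" and ?f = "\<lambda>a. fraction R (carrier R - M) a \<one>"
  interpret loc: localization_map R ?E "carrier R - M" ?f by (rule localization_at_map[OF pM])
  interpret E: local_domain ?E by (rule loc.local_domain_at_prime[OF pM refl])
  have len: "\<exists>v. E.length_function v" if at: "atomic ?E" "E.atoms_divide_products"
  proof -
    obtain v where "E.length_function v" using at by (rule E.exists_length_function)
    then show ?thesis by (rule exI[of E.length_function])
  qed
  have taf: "\<exists>v. E.length_function v" if taf: "taf_domain ?E"
  proof (rule len)
    have dim: "P = E.nonunits" if P: "primeideal P ?E" "P \<noteq> {\<zero>\<^bsub>?E\<^esub>}" for P
      using loc.E.taf_primes_maximal[OF taf P] E.maximalideal_iff by simp
    have ta: "has_ta_factorization ?E (PIdl\<^bsub>?E\<^esub> a)" if a: "a \<in> E.nonunits" "a \<noteq> \<zero>\<^bsub>?E\<^esub>" for a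
      using taf E.PIdl_nonunit[OF a(1)] loc.E.cgenideal_ideal a(1) unfolding taf_domain_def by simp
    show "atomic ?E" "E.atoms_divide_products"
      using E.principal_ta_imp_length[OF dim ta] by simp_all
  qed
  have pvd: "\<exists>v. E.length_function v" if "atomic ?E" "pvd ?E"
    using len that E.pvd_imp_atoms_divide_products by simp
  show "taf_domain ?E \<longleftrightarrow> (\<exists>v. E.length_function v)"
    using taf E.length_function_taf by metis
  show "atomic ?E \<and> pvd ?E \<longleftrightarrow> (\<exists>v. E.length_function v)"
    using pvd E.length_function_imp_pvd E.length_function_accp loc.E.accp_imp_atomic by metis
  show "pvd ?E \<and> accp ?E \<longleftrightarrow> (\<exists>v. E.length_function v)"
    using pvd E.length_function_imp_pvd E.length_function_accp loc.E.accp_imp_atomic by metis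
qed

section \<open>From atoms to principal ideals, and the equivalences\<close>

lemma atom_ta_imp_principal_ta:
  assumes accp: "accp R" and atoms: "\<And>p. atom R p \<Longrightarrow> has_ta_factorization R (PIdl p)"
    and x: "x \<in> carrier R" "x \<noteq> \<zero>" "x \<notin> Units R"
  shows "has_ta_factorization R (PIdl x)"
proof -
  have "has_ta_factorization R (PIdl (fprod ps))" if "\<forall>p\<in>set ps. atom R p" "ps \<noteq> []" for ps
    using that
  proof (induction ps)
    case (Cons p ps)
    have c: "p \<in> carrier R" "fprod ps \<in> carrier R"
      using Cons.prems atomD(1)[of p] fprod_closed[of ps] atoms_subset[of ps] by auto
    show ?case
    proof (cases "ps = []")
      case True
      then show ?thesis using Cons.prems atoms[of p] c by simp
    next
      case False
      then have "has_ta_factorization R (ideal_prod R (PIdl p) (PIdl (fprod ps)))"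
        using Cons atoms[of p] by (intro has_ta_factorization_mult) simp_all
      then show ?thesis using PIdl_prod[OF c] by simp
    qed
  qed simp
  moreover obtain ps where ps: "\<forall>p\<in>set ps. atom R p" "x = fprod ps"
    using accp_imp_atomic[OF accp] x unfolding atomic_def by auto
  moreover have "ps \<noteq> []" using ps x(3) by auto
  ultimately show ?thesis by simp
qed

text \<open>The only difference between the two sides is the zero ideal, which is 2-absorbing in a
  domain and thus factors as itself.\<close>

lemma principal_ta_iff:
  "(\<forall>I. principalideal I R \<and> I \<noteq> carrier R \<longrightarrow> has_ta_factorization R I) \<longleftrightarrow>
   (\<forall>x\<in>carrier R. x \<noteq> \<zero> \<longrightarrow> x \<notin> Units R \<longrightarrow> has_ta_factorization R (PIdl x))" (is "?L \<longleftrightarrow> ?R")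
proof
  assume ?L
  then show ?R
    using cgenideal_is_principalideal PIdl_eq_carrier_iff by simp
next
  assume R: ?R
  show ?L
  proof (intro allI impI)
    fix I assume "principalideal I R \<and> I \<noteq> carrier R"
    then obtain x where x: "x \<in> carrier R" "I = PIdl x" "I \<noteq> carrier R"
      unfolding principalideal_iff by auto
    then have xU: "x \<notin> Units R" using PIdl_eq_carrier_iff by simp
    show "has_ta_factorization R I"
    proof (cases "x = \<zero>")
      case True
      then have "I = {\<zero>}" using x(2) cgenideal_eq_genideal[OF zero_closed] genideal_zero by simp
      then show ?thesis using zero_has_ta_factorization by simp
    next
      case False
      then show ?thesis using R x xU by simp
    qed
  qed
qed

end

theorem theorem4p4:
  fixes D :: "('a, 'm) ring_scheme"
  assumes "domain D"
  shows
    "let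
       a = taf_domain D;
       b = (finite_character D \<and>
            (\<forall>M. maximalideal M D \<longrightarrow> taf_domain (localization_at D M)));
       c = (finite_character D \<and>
            (\<forall>M. maximalideal M D \<longrightarrow>
               atomic (localization_at D M) \<and> pvd (localization_at D M)));
       d = (finite_character D \<and>
            (\<forall>M. maximalideal M D \<longrightarrow>
               pvd (localization_at D M) \<and> accp (localization_at D M)));
       e = ((field D \<or> krull_dim D = 1) \<and> finite_character D \<and>
            (\<forall>I. principalideal I D \<and> I \<noteq> carrier D \<longrightarrow> has_ta_factorization D I));
       f = ((field D \<or> krull_dim D = 1) \<and> accp D \<and> finite_character D \<and>
            (\<forall>p. atom D p \<longrightarrow> has_ta_factorization D (PIdl\<^bsub>D\<^esub> p)))
     in (a \<longleftrightarrow> b) \<and> (b \<longleftrightarrow> c) \<and> (c \<longleftrightarrow> d) \<and> (d \<longleftrightarrow> e) \<and> (e \<longleftrightarrow> f)"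
proof -
  interpret domain D by (rule assms)
  let ?dim = "\<forall>P. primeideal P D \<longrightarrow> P \<noteq> {\<zero>\<^bsub>D\<^esub>} \<longrightarrow> maximalideal P D"
  let ?ta = "\<forall>x\<in>carrier D. x \<noteq> \<zero>\<^bsub>D\<^esub> \<longrightarrow> x \<notin> Units D \<longrightarrow> has_ta_factorization D (PIdl\<^bsub>D\<^esub> x)"
  define a where "a = taf_domain D"
  \<comment> \<open>The common form of (b), (c) and (d); \<open>local_conditions\<close> rewrites
    each of the three local properties into the existence of a length function.\<close>
  define g where "g \<longleftrightarrow> finite_character D \<and>
    (\<forall>M. maximalideal M D \<longrightarrow> (\<exists>v. local_domain.length_function (localization_at D M) v))"
  define e where "e \<longleftrightarrow> ?dim \<and> finite_character D \<and> ?ta"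
  define f where "f \<longleftrightarrow> ?dim \<and> accp D \<and> finite_character D \<and>
    (\<forall>p. atom D p \<longrightarrow> has_ta_factorization D (PIdl\<^bsub>D\<^esub> p))"
  have ae: e if taf: a
  proof -
    have dim: ?dim using taf_primes_maximal taf unfolding a_def by blast
    have ta: ?ta
      using taf PIdl_eq_carrier_iff cgenideal_ideal unfolding a_def taf_domain_def by simp
    have "finite_character D" by (rule ta_finite_character) (use dim ta in auto)
    with dim ta show ?thesis unfolding e_def by simp
  qed
  have eg: g if e
    unfolding g_def
  proof (intro conjI allI impI)
    show "finite_character D" using that unfolding e_def by simp
    fix M assume "maximalideal M D"
    then show "\<exists>v. local_domain.length_function (localization_at D M) v"
      by (intro principal_ta_imp_local_length) (use that in \<open>auto simp: e_def\<close>)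
  qed
  have ga: a if g
    unfolding a_def by (rule local_length_imp_taf) (use that in \<open>auto simp: g_def\<close>)
  have ef: f if e
  proof -
    \<comment> \<open>ACCP is gained locally: (e) provides length functions on the localizations,
      these give ACCP there, and finite character lifts it to \<open>D\<close>.\<close>
    have "accp D"
      by (rule accp_local_global) (use eg[OF that] local_conditions(3) in \<open>auto simp: g_def\<close>)
    moreover have "has_ta_factorization D (PIdl\<^bsub>D\<^esub> p)" if "atom D p" for p
      using \<open>e\<close> atomD(1-3)[OF that] unfolding e_def by simp
    ultimately show ?thesis using that unfolding e_def f_def by simp
  qed
  have fe: e if f
    using that atom_ta_imp_principal_ta unfolding e_def f_def by blast
  have "a \<longleftrightarrow> g" "g \<longleftrightarrow> e" "e \<longleftrightarrow> f" using ae eg ga ef fe by auto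
  then show ?thesis
    unfolding a_def g_def e_def f_def Let_def one_dimensional_iff principal_ta_iff
    using local_conditions by (simp cong: conj_cong imp_cong)
qed

end
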